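(* Let $n\geq 3$ and $d\geq 1$ be integers. The generating set $$\{e_{ij}^d \mid 1\leq i,j\leq n,\ i\neq j\}\cup\{e_{k1}e_{1k}^de_{k1}^{-1}\mid 2\leq k\leq n\}$$ for $\Gamma_d(n)$ is minimal.
   Context: For integers $n\geq 1$ and $d\geq 2$, $\Gamma_d(n)=\{X\in \mathrm{SL}(n;\mathbb{Z}) \mid X\equiv I \pmod d\}$ is the level $d$ principal congruence subgroup of $\mathrm{SL}(n;\mathbb{Z})$, and $\Gamma_1(n)=\mathrm{SL}(n;\mathbb{Z})$. For $1\leq i,j\leq n$ with $i\neq j$, $e_{ij}\in \mathrm{SL}(n;\mathbb{Z})$ is the matrix whose $(i,j)$ entry and diagonal entries are $1$ and whose other entries are $0$.
   Formalization: Minimality (both irredundance and least cardinality) is claimed only for d ≥ 2; for d = 1 only generation is claimed, since there each e_{k1}e_{1k}e_{k1}^{-1} is a product of the e_{ij} and their inverses, so the set is not minimal. *)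

theory Defs
  imports
    "Jordan_Normal_Form.Determinant"
    "HOL-Algebra.Generated_Groups"
    "HOL-Number_Theory.Cong"
begin

definition SL :: "nat \<Rightarrow> int mat monoid" where
  "SL n = \<lparr>carrier = {A \<in> carrier_mat n n. det A = 1}, mult = (*), one = 1\<^sub>m n\<rparr>"

text \<open>For \<open>d = 1\<close> the congruence condition is vacuous, so that \<open>Gamma 1 n\<close> is all of \<open>SL n\<close>.\<close>

definition Gamma :: "nat \<Rightarrow> nat \<Rightarrow> int mat set" where
  "Gamma d n = {X \<in> carrier (SL n). \<forall>i<n. \<forall>j<n. [X $$ (i, j) = 1\<^sub>m n $$ (i, j)] (mod int d)}"

text \<open>Indices are shifted: rows and columns are numbered \<open>0, \<dots>, n - 1\<close>, so the distinguished
  index of the mathematical text, 1, is \<open>0\<close> here.\<close>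

definition elem :: "nat \<Rightarrow> nat \<Rightarrow> nat \<Rightarrow> int mat" where
  "elem n i j = mat n n (\<lambda>(r, c). if r = c \<or> (r = i \<and> c = j) then 1 else 0)"

definition gens :: "nat \<Rightarrow> nat \<Rightarrow> int mat set" where
  "gens d n =
     {elem n i j [^]\<^bsub>SL n\<^esub> d | i j. i < n \<and> j < n \<and> i \<noteq> j} \<union>
     {elem n k 0 \<otimes>\<^bsub>SL n\<^esub> elem n 0 k [^]\<^bsub>SL n\<^esub> d \<otimes>\<^bsub>SL n\<^esub> inv\<^bsub>SL n\<^esub> (elem n k 0) | k. 1 \<le> k \<and> k < n}"

text \<open>``Minimal generating set'' is used in the literature both for irredundant sets and for sets of
  least possible cardinality. Here \<open>H\<close> is a subgroup of an ambient group \<open>G\<close>; a set generates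
  \<open>H\<close> as a group of its own iff the subgroup of \<open>G\<close> that it generates is \<open>H\<close>.\<close>

definition irredundant_generating_set :: "('a, 'b) monoid_scheme \<Rightarrow> 'a set \<Rightarrow> 'a set \<Rightarrow> bool" where
  "irredundant_generating_set G H S \<longleftrightarrow>
     generate G S = H \<and> (\<forall>T. T \<subset> S \<longrightarrow> generate G T \<noteq> H)"

definition least_size_generating_set :: "('a, 'b) monoid_scheme \<Rightarrow> 'a set \<Rightarrow> 'a set \<Rightarrow> bool" where
  "least_size_generating_set G H S \<longleftrightarrow>
     finite S \<and> generate G S = H \<and> (\<forall>T. finite T \<and> generate G T = H \<longrightarrow> card S \<le> card T)"

lemma elem_addrow: "i < n \<Longrightarrow> j < n \<Longrightarrow> i \<noteq> j \<Longrightarrow> elem n i j = addrow_mat n 1 i j"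
  by (rule eq_matI) (auto simp: elem_def addrow_mat_def)

lemma elem_in_SL: "i < n \<Longrightarrow> j < n \<Longrightarrow> i \<noteq> j \<Longrightarrow> elem n i j \<in> carrier (SL n)"
  by (simp add: SL_def elem_addrow det_addrow_mat)

lemma group_SL: "group (SL n)"
proof (rule groupI)
  fix A assume A: "A \<in> carrier (SL n)"
  then have c: "A \<in> carrier_mat n n" and d: "det A = 1" by (auto simp: SL_def)
  note adj = adj_mat[OF c]
  have "det (adj_mat A) * det A = det (adj_mat A * A)"
    using adj(1) c by (simp add: det_mult)
  also have "\<dots> = 1" by (simp add: adj(3) d)
  finally have "det (adj_mat A) = 1" by (simp add: d)
  then show "\<exists>B\<in>carrier (SL n). B \<otimes>\<^bsub>SL n\<^esub> A = \<one>\<^bsub>SL n\<^esub>"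
    using adj by (intro bexI[of _ "adj_mat A"]) (auto simp: SL_def d)
qed (auto simp: SL_def det_mult)

text \<open>Irredundancy fails for \<open>d = 1\<close>: the conjugates are then products of elementary matrices.\<close>

lemma not_irredundant_level_1:
  assumes n: "n \<ge> 2"
  shows "\<not> irredundant_generating_set (SL n) (Gamma 1 n) (gens 1 n)"
proof
  interpret group "SL n" by (rule group_SL)
  let ?G = "SL n"
  define a where "a = elem n 1 0"
  define b where "b = elem n 0 1"
  define x where "x = a \<otimes>\<^bsub>?G\<^esub> b \<otimes>\<^bsub>?G\<^esub> inv\<^bsub>?G\<^esub> a"
  define T where "T = {elem n i j | i j. i < n \<and> j < n \<and> i \<noteq> j}"
  have T: "T \<subseteq> carrier ?G" by (auto simp: T_def elem_in_SL)
  have ab: "a \<in> T" "b \<in> T" using n by (force simp: T_def a_def b_def)+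
  have abG: "a \<in> carrier ?G" "b \<in> carrier ?G" using ab T by auto
  have pow: "i < n \<and> j < n \<and> i \<noteq> j \<Longrightarrow> elem n i j [^]\<^bsub>?G\<^esub> (1::nat) = elem n i j" for i j
    using elem_in_SL[of i n j] by simp
  have TS: "T \<subseteq> gens 1 n" unfolding T_def gens_def using pow by fastforce
  have xS: "x \<in> gens 1 n" unfolding gens_def x_def a_def b_def
    using n pow[of 0 1] by (intro UnI2 CollectI exI[of _ 1]) auto
  have ST: "gens 1 n \<subseteq> generate ?G T"
  proof -
    have e: "elem n i j \<in> generate ?G T" if "i < n" "j < n" "i \<noteq> j" for i j
      using that by (intro generate.incl) (auto simp: T_def)
    have "elem n k 0 \<otimes>\<^bsub>?G\<^esub> elem n 0 k \<otimes>\<^bsub>?G\<^esub> inv\<^bsub>?G\<^esub> elem n k 0 \<in> generate ?G T"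
      if "1 \<le> k" "k < n" for k
      using that by (intro generate.eng e generate_m_inv_closed[OF T]) auto
    then show ?thesis unfolding gens_def using e pow by auto
  qed
  have "x \<notin> T"
  proof
    assume "x \<in> T"
    then obtain i j where ij: "i < n" "j < n" "i \<noteq> j" "x = elem n i j" by (auto simp: T_def)
    have "x \<otimes>\<^bsub>?G\<^esub> a = a \<otimes>\<^bsub>?G\<^esub> b" using abG by (simp add: x_def m_assoc)
    then have "elem n i j * a = a * b" by (simp add: ij SL_def)
    then have eq: "(elem n i j * a) $$ (1, 1) = (a * b) $$ (1, 1)" by simp
    have "(elem n i j * a) $$ (1, 1) = (\<Sum>k<n. elem n i j $$ (1, k) * a $$ (k, 1))"
      using n by (simp add: elem_def a_def scalar_prod_def lessThan_atLeast0)
    also have "\<dots> = (\<Sum>k<n. if k = 1 then 1 else 0)"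
      using n ij by (intro sum.cong) (auto simp: elem_def a_def)
    finally have 1: "(elem n i j * a) $$ (1, 1) = 1" using n by simp
    have "(a * b) $$ (1, 1) = (\<Sum>k<n. a $$ (1, k) * b $$ (k, 1))"
      using n by (simp add: elem_def a_def b_def scalar_prod_def lessThan_atLeast0)
    also have "\<dots> = (\<Sum>k<n. (if k = 1 then 1 else 0) + (if k = 0 then 1 else 0))"
      using n by (intro sum.cong) (auto simp: elem_def a_def b_def)
    also have "\<dots> = 2" using n by (subst sum.distrib) simp
    finally show False using 1 eq by simp
  qed
  then have "T \<subset> gens 1 n" using TS xS by auto
  moreover assume "irredundant_generating_set ?G (Gamma 1 n) (gens 1 n)"
  moreover have "generate ?G T = generate ?G (gens 1 n)"
    using TS ST generate_subgroup_incl[OF ST generate_is_subgroup[OF T]] mono_generate[OF TS]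
    by auto
  ultimately show False unfolding irredundant_generating_set_def by metis
qed

end

theory Submission imports Defs "HOL-Number_Theory.Number_Theory"
begin

section \<open>Reciprocity symbols and their level\<close>

text \<open>Write \<open>e\<close> for the elementary matrices and \<open>N\<close> for the subgroup of \<open>SL n\<close> generated by all transvections
\<open>I + v w\<^sup>T\<close> with \<open>w \<bullet> v = 0\<close> and \<open>q\<close> dividing \<open>v\<close>. It is normal and contained in \<open>Gamma q n\<close>. The proof has
four ingredients.

\<^item> Koszul relations. If \<open>w\<close> is unimodular, every \<open>v\<close> orthogonal to \<open>w\<close> is a combination of the vectors
\<open>w\<^sub>j e\<^sub>i - w\<^sub>i e\<^sub>j\<close>, and with a third index at hand the corresponding transvections are commutators of
matrices that differ from \<open>I\<close> in one row or column. So a subgroup that contains all \<open>e\<^sub>i\<^sub>j(t)\<close> with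
\<open>d\<close> dividing \<open>t\<close> contains all transvections with \<open>d\<^sup>2\<close> dividing \<open>v\<close> (\<open>transvection_K\<close>).

\<^item> The congruence subgroup property in the form \<open>Gamma q n = N\<close> (\<open>Gamma_eq_transv_subgroup\<close>). Modulo \<open>N\<close> every element of
\<open>Gamma q n\<close> is a two-by-two block; modulo \<open>N\<close> these blocks commute with all elementary matrices of size three, and
their classes depend on the first row only. As a function of this row they form a Mennicke symbol.

\<^item> Mennicke symbols over the integers vanish (\<open>F_eq_0\<close>). A Mennicke symbol obeys a reciprocity law
and therefore extends to a symbol \<open>J y x\<close> that resembles the power residue symbol and is trivial for
\<open>x\<close> congruent to 1 modulo \<open>q y\<close>. The dependence on \<open>q\<close> is removed one prime \<open>r\<close> at a time: the part of the
symbol that comes from \<open>r\<close> behaves like a Hilbert symbol, which the Steinberg relation and the product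
formula force to be trivial. As the law is required for negative \<open>x\<close>, too, the real place contributes nothing, and
no analogue of the Jacobi symbol survives. At level one \<open>J p x = 0\<close> follows by
induction on the prime \<open>p\<close>.

\<^item> First-order terms. Sending \<open>X = I + d A\<close> to \<open>A\<close> modulo \<open>d\<close> maps \<open>Gamma d n\<close> homomorphically to
matrices with trace zero, as one sees on transvections. The given generators hit all such matrices, so each
\<open>X\<close> in \<open>Gamma d n\<close> agrees with an element of the generated subgroup \<open>H\<close> up to a factor in \<open>Gamma (d\<^sup>2) n\<close>. That
group is generated by transvections of level \<open>d\<^sup>2\<close>, and these lie in \<open>H\<close> by the Koszul argument; hence \<open>H = Gamma d n\<close>.

For \<open>d \<ge> 2\<close> the image of the first-order map has \<open>d\<close> to the power \<open>n\<^sup>2 - 1\<close> elements and exponent dividing \<open>d\<close>, so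
every generating set has at least \<open>n\<^sup>2 - 1\<close> elements. The given set has at most \<open>(n\<^sup>2 - n) + (n - 1) = n\<^sup>2 - 1\<close>
elements, so it has least size and no proper subset generates.\<close>

lemma common_prime_divisor:
  fixes a b :: int
  assumes "\<not> coprime a b" "b \<noteq> 0"
  obtains s where "prime s" "s dvd a" "s dvd b"
proof -
  have "gcd a b \<noteq> 0" "\<not> is_unit (gcd a b)" using assms by (auto simp: is_unit_gcd)
  then obtain s where "prime s" "s dvd gcd a b" using prime_divisor_exists by blast
  then show ?thesis using that by auto
qed

definition nsmul :: "nat \<Rightarrow> 'v::ab_group_add \<Rightarrow> 'v" where
  "nsmul i x = ((+) x ^^ i) 0"

lemma nsmul_0 [simp]: "nsmul 0 x = 0"
  and nsmul_Suc [simp]: "nsmul (Suc i) x = x + nsmul i x"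
  by (simp_all add: nsmul_def)

lemma nsmul_add: "nsmul (i + j) x = nsmul i x + nsmul j x"
  by (induction i) (auto simp: add.assoc)

lemma nsmul_zero [simp]: "nsmul i 0 = 0"
  by (induction i) auto

lemma nsmul_plus: "nsmul i (x + y) = nsmul i x + nsmul i y"
  by (induction i) (auto simp: algebra_simps)

lemma nsmul_mult: "nsmul (i * j) x = nsmul i (nsmul j x)"
  by (induction i) (auto simp: nsmul_add)

lemma nsmul_torsion_2:
  assumes "x + x = 0"
  shows "nsmul i x = (if even i then 0 else x)"
  using assms by (induction i) auto

lemma nsmul_coprime_eq_0:
  assumes "coprime i j" "nsmul i x = 0" "nsmul j x = 0"
  shows "x = 0"
proof (cases "i = 0")
  case True
  with assms have "j = 1" by simp
  with assms show ?thesis by simp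
next
  case False
  obtain a b where bez: "i * a = j * b + gcd i j" using bezout_nat[OF False] by blast
  have "nsmul (a * i) x = nsmul (b * j + 1) x"
    unfolding mult.commute[of a i] mult.commute[of b j] bez coprime_imp_gcd_eq_1[OF assms(1)] ..
  then have "nsmul a (nsmul i x) = nsmul b (nsmul j x) + nsmul 1 x"
    unfolding nsmul_add nsmul_mult .
  moreover have "nsmul 1 x = x" by simp
  ultimately have "0 = x" by (simp only: assms(2,3) nsmul_zero add_0_left)
  then show ?thesis by (rule sym)
qed

text \<open>The value \<open>J y x\<close> resembles a power residue symbol of \<open>y\<close> over \<open>x\<close>: it is bimultiplicative, depends on
\<open>y\<close> modulo \<open>x\<close> only, and by \<open>J_level\<close> obeys a reciprocity law of conductor \<open>q\<close>. The modulus \<open>x\<close> may be negative,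
and \<open>x\<close> congruent to 1 forces \<open>J y x = 0\<close> whatever its sign. The Jacobi symbol violates this already for
\<open>y = - 1\<close> and \<open>x = - 3\<close>; the symbols of this locale all vanish.\<close>

locale reciprocity_symbol =
  fixes q :: int and J :: "int \<Rightarrow> int \<Rightarrow> 'v::ab_group_add"
  assumes q_pos: "q > 0"
    and J_cong: "\<And>x y y'. coprime x q \<Longrightarrow> coprime y x \<Longrightarrow> [y = y'] (mod x) \<Longrightarrow> J y x = J y' x"
    and J_mult_left: "\<And>x y y'. coprime x q \<Longrightarrow> coprime y x \<Longrightarrow> coprime y' x \<Longrightarrow>
      J (y * y') x = J y x + J y' x"
    and J_mult_right: "\<And>x x' y. coprime x q \<Longrightarrow> coprime x' q \<Longrightarrow> coprime y x \<Longrightarrow> coprime y x' \<Longrightarrow>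
      J y (x * x') = J y x + J y x'"
    and J_level: "\<And>x y. [x = 1] (mod q * y) \<Longrightarrow> J y x = 0"
begin

text \<open>A level is a modulus that may take the place of \<open>q\<close> in the reciprocity law; the moduli \<open>x\<close> stay prime to \<open>q\<close>.
The aim is the level one.\<close>

definition has_level :: "int \<Rightarrow> bool" where
  "has_level N \<longleftrightarrow> (\<forall>x y. coprime x q \<longrightarrow> [x = 1] (mod N * y) \<longrightarrow> J y x = 0)"

lemma J_1_left: "coprime x q \<Longrightarrow> J 1 x = 0"
  using J_mult_left[of x 1 1] by simp

lemma J_power_left:
  assumes "coprime x q" "coprime y x"
  shows "J (y ^ i) x = nsmul i (J y x)"
  using assms by (induction i) (auto simp: J_1_left J_mult_left)

text \<open>Multiplying by an inverse \<open>z\<close> of \<open>x\<close> modulo \<open>N y q\<close> moves both moduli to numbers congruent to 1.\<close>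

lemma J_dep:
  assumes N: "has_level N" and x: "coprime x q" "coprime x' q" "coprime x N" "coprime x y"
    and c: "[x = x'] (mod N * y)"
  shows "J y x = J y x'"
proof -
  have "coprime x (N * y * q)" using x by simp
  then obtain z where z: "[x * z = 1] (mod N * y * q)" using cong_solve_coprime_int by blast
  have zc: "coprime z (N * y * q)"
    using z by (metis cong_imp_coprime cong_sym coprime_1_left coprime_mult_left_iff)
  have 1: "[x * z = 1] (mod N * y)" using z by (rule cong_modulus_mult)
  have "[x' * z = x * z] (mod N * y)" using c by (intro cong_mult cong_refl) (rule cong_sym)
  with 1 have 2: "[x' * z = 1] (mod N * y)" by (rule cong_trans[rotated])
  have cy: "coprime y x'"
  proof -
    have "[x = x'] (mod y)" using c by (rule cong_dvd_modulus) simp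
    then show ?thesis using x(4) by (metis cong_imp_coprime coprime_commute)
  qed
  have "J y (x * z) = 0" "J y (x' * z) = 0"
    using N 1 2 x zc unfolding has_level_def by auto
  moreover have "J y (x * z) = J y x + J y z" "J y (x' * z) = J y x' + J y z"
    using x zc cy by (auto intro!: J_mult_right simp: coprime_commute)
  ultimately show ?thesis by (metis add_right_cancel)
qed

lemma J_1_right: "J y 1 = 0"
  using J_mult_right[of 1 1 y] by simp

end

text \<open>A symbol of level \<open>r\<^sup>k m\<close> shall be shown to have level \<open>m\<close>, where \<open>r\<close> is a prime not dividing \<open>m\<close>. Here \<open>Q\<close> is
the part of \<open>q\<close> prime to \<open>r\<close>.\<close>

locale level_descent = reciprocity_symbol q J for q and J :: "int \<Rightarrow> int \<Rightarrow> 'v::ab_group_add" +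
  fixes r Q m :: int and k K :: nat
  assumes r: "prime r" and q_eq: "q = r ^ K * Q" and K: "K \<ge> 1" and k: "k \<ge> 1"
    and rQ: "coprime r Q" and mQ: "m dvd Q" and lev: "has_level (r ^ k * m)"
begin

text \<open>The obstruction at \<open>r\<close>. If \<open>x\<close> is 1 modulo \<open>Q y\<close>, the value \<open>J y x\<close> can only depend on the class of \<open>x\<close> modulo \<open>r\<^sup>k\<close>
(\<open>B_wd\<close>); as a function of this class it plays the role of the Hilbert symbol at \<open>r\<close> on units.\<close>

definition B :: "int \<Rightarrow> int \<Rightarrow> 'v" where
  "B y u = J y (SOME x. [x = u] (mod r ^ k) \<and> [x = 1] (mod Q * y))"

lemma coprime_q_iff: "coprime x q \<longleftrightarrow> coprime x r \<and> coprime x Q"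
  using K by (simp add: q_eq)

lemma coprime_of_cong_1:
  fixes x a y :: int
  assumes "[x = 1] (mod a * y)"
  shows "coprime x y"
proof -
  have "[1 = x] (mod y)" using cong_dvd_modulus[OF assms dvd_triv_right] by (rule cong_sym)
  then show ?thesis by (rule cong_imp_coprime) simp
qed

lemma coprime_r_m: "coprime r m"
  using dvd_refl mQ rQ by (rule coprime_divisors)

lemma coprime_cong_r:
  assumes "[x = u] (mod r ^ k)" "coprime u r"
  shows "coprime x r"
proof -
  have "r dvd r ^ k" using k by (intro dvd_power) simp
  then have "[u = x] (mod r)" by (rule cong_sym[OF cong_dvd_modulus[OF assms(1)]])
  then show ?thesis using assms(2) by (rule cong_imp_coprime)
qed

lemma chinese: 
  assumes "coprime r a"
  shows "\<exists>x. [x = u] (mod r ^ i) \<and> [x = v] (mod a)"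
  using assms by (intro binary_chinese_remainder_int) simp

lemma B_wd:
  assumes y: "coprime r y" and u: "coprime u r" and x: "coprime x q" "[x = u] (mod r ^ k)" "[x = 1] (mod m * y)"
  shows "J y x = B y u"
proof -
  let ?P = "\<lambda>x. [x = u] (mod r ^ k) \<and> [x = 1] (mod Q * y)"
  have "\<exists>x. ?P x" using chinese[of "Q * y" u k 1] rQ y by simp
  then have P: "?P (SOME x. ?P x)" by (rule someI_ex)
  define x' where "x' = (SOME x. ?P x)"
  have x': "[x' = u] (mod r ^ k)" "[x' = 1] (mod Q * y)" using P by (auto simp: x'_def)
  have "coprime x' Q"
    by (rule coprime_of_cong_1[of x' y Q]) (use x'(2) in \<open>simp only: mult.commute[of y Q]\<close>)
  then have cq: "coprime x' q" using coprime_cong_r[OF x'(1) u] by (simp only: coprime_q_iff simp_thms)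
  have 1: "[x' = 1] (mod m * y)" using x'(2) by (rule cong_dvd_modulus) (simp add: mQ mult_dvd_mono)
  have "[x = x'] (mod r ^ k)" using x(2) x'(1) by (metis cong_sym cong_trans)
  moreover have "[x = x'] (mod m * y)" using x(3) 1 by (metis cong_sym cong_trans)
  moreover have "coprime (r ^ k) (m * y)" using coprime_r_m y by simp
  ultimately have "[x = x'] (mod r ^ k * (m * y))" by (rule coprime_cong_mult)
  then have "[x = x'] (mod r ^ k * m * y)" by (simp only: mult.assoc)
  moreover have "coprime x y" using x(3) by (rule coprime_of_cong_1)
  moreover have "coprime x m"
    by (rule coprime_of_cong_1[of x y m]) (use x(3) in \<open>simp only: mult.commute[of y m]\<close>)
  then have "coprime x (r ^ k * m)" using coprime_cong_r[OF x(2) u] by simp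
  ultimately have "J y x = J y x'" using x(1) cq by (intro J_dep[OF lev])
  then show ?thesis by (simp add: B_def x'_def)
qed

lemma B_rep:
  assumes y: "coprime r y" and u: "coprime u r"
  obtains x where "coprime x q" "[x = u] (mod r ^ k)" "[x = 1] (mod Q * y)" "[x = 1] (mod m * y)"
    "coprime y x"
proof -
  obtain x where x: "[x = u] (mod r ^ k)" "[x = 1] (mod Q * y)"
    using chinese[of "Q * y" u k 1] rQ y by auto
  moreover have "coprime x q" using x u coprime_cong_r[of x u]
    by (metis coprime_q_iff coprime_of_cong_1 mult.commute)
  moreover have "[x = 1] (mod m * y)"
    using x(2) by (rule cong_dvd_modulus) (simp add: mQ mult_dvd_mono)
  moreover have "coprime y x" using x(2) by (metis coprime_of_cong_1 coprime_commute)
  ultimately show ?thesis using that by blast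
qed

lemma B_mult_left:
  assumes "coprime r y" "coprime r y'" "coprime u r"
  shows "B (y * y') u = B y u + B y' u"
proof -
  obtain x where x: "coprime x q" "[x = u] (mod r ^ k)" "[x = 1] (mod m * (y * y'))" "coprime (y * y') x"
    using B_rep[of "y * y'" u] assms by auto
  have "[x = 1] (mod m * y)" "[x = 1] (mod m * y')"
    using x(3) by (auto intro: cong_dvd_modulus)
  then have "J y x = B y u" "J y' x = B y' u" using assms x by (auto intro: B_wd)
  moreover have "J (y * y') x = B (y * y') u" using assms x by (auto intro: B_wd)
  moreover have "J (y * y') x = J y x + J y' x" using x by (auto intro: J_mult_left)
  ultimately show ?thesis by simp
qed

lemma B_mult_right:
  assumes "coprime r y" "coprime u r" "coprime u' r"
  shows "B y (u * u') = B y u + B y u'"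
proof -
  obtain x where x: "coprime x q" "[x = u] (mod r ^ k)" "[x = 1] (mod m * y)" "coprime y x"
    using B_rep[of y u] assms by auto
  obtain x' where x': "coprime x' q" "[x' = u'] (mod r ^ k)" "[x' = 1] (mod m * y)" "coprime y x'"
    using B_rep[of y u'] assms by auto
  have "[x * x' = 1] (mod m * y)" using cong_mult[OF x(3) x'(3)] by simp
  moreover have "[x * x' = u * u'] (mod r ^ k)" using cong_mult[OF x(2) x'(2)] .
  ultimately have "J y (x * x') = B y (u * u')" using assms x x' by (intro B_wd) auto
  moreover have "J y x = B y u" "J y x' = B y u'" using assms x x' by (auto intro: B_wd)
  moreover have "J y (x * x') = J y x + J y x'" using x x' by (auto intro: J_mult_right)
  ultimately show ?thesis by simp
qed

lemma B_cong_right: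
  assumes "coprime r y" "coprime u r" "[u = u'] (mod r ^ k)"
  shows "B y u = B y u'"
proof -
  obtain x where x: "coprime x q" "[x = u] (mod r ^ k)" "[x = 1] (mod m * y)"
    using B_rep[of y u] assms by auto
  have "coprime u' r" using assms by (metis coprime_cong_r cong_sym)
  moreover have "[x = u'] (mod r ^ k)" using x(2) assms(3) by (rule cong_trans)
  ultimately show ?thesis using x assms B_wd[of y u x] B_wd[of y u' x] by simp
qed

lemma B_1_left: "coprime u r \<Longrightarrow> B 1 u = 0"
  using B_mult_left[of 1 1 u] by simp

lemma B_1_right: "coprime r y \<Longrightarrow> B y 1 = 0"
  using B_mult_right[of y 1 1] by simp

lemma B_power_left: "coprime r y \<Longrightarrow> coprime u r \<Longrightarrow> B (y ^ i) u = nsmul i (B y u)"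
  by (induction i) (auto simp: B_1_left B_mult_left)

lemma B_power_right: "coprime r y \<Longrightarrow> coprime u r \<Longrightarrow> B y (u ^ i) = nsmul i (B y u)"
  by (induction i) (auto simp: B_1_right B_mult_right)

text \<open>The product formula. Modulo \<open>x\<close> the product \<open>- (r\<^sup>j Q\<^sup>2 w n)\<close> is 1, so its symbol vanishes; it
expands into the symbols of the factors, all of which except that of \<open>r\<close> are local terms. The
square of \<open>Q\<close> is there because the local term of \<open>Q\<close> itself needs \<open>x\<close> to be 1 modulo \<open>Q\<^sup>2\<close>.\<close>

lemma B_relation:
  assumes w: "coprime w r" and n: "coprime n r" and x: "x = 1 + r ^ j * (Q ^ 2 * w * n)" "coprime x r"
  shows "nsmul j (J r x) + (B (- 1) x + B Q x + B Q x + B w x + B n x) = 0"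
proof -
  have cx: "coprime x y" if "y dvd r ^ j * (Q ^ 2 * w * n)" for y
  proof -
    have "[x = 1] (mod y)" using that x(1) by (simp add: cong_iff_dvd_diff)
    then show ?thesis by (metis coprime_of_cong_1 mult_1)
  qed
  have xq: "coprime x q"
    using x(2) cx[of Q] by (simp add: coprime_q_iff power2_eq_square)
  have c: "coprime Q x" "coprime w x" "coprime n x" "coprime r x"
    using cx[of Q] cx[of w] cx[of n] x(2) by (auto simp: coprime_commute power2_eq_square)
  have m1: "[x = 1] (mod m * y)" if "Q * y dvd r ^ j * (Q ^ 2 * w * n)" for y
  proof -
    have "m * y dvd x - 1" using that x(1) mQ
      by (metis add_diff_cancel_left' dvd_trans mult_dvd_mono dvd_refl)
    then show ?thesis by (simp add: cong_iff_dvd_diff)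
  qed
  have JB: "J Q x = B Q x" "J w x = B w x" "J n x = B n x" "J (- 1) x = B (- 1) x"
    using xq w n x(2) rQ m1[of Q] m1[of w] m1[of n] m1[of "- 1"]
    by (auto intro!: B_wd simp: coprime_commute power2_eq_square mult_ac)
  have "0 = J 1 x" using xq by (simp add: J_1_left)
  also have "\<dots> = J (- 1 * (r ^ j * (Q * Q * w * n))) x"
    using xq x(1) by (intro J_cong) (auto simp: cong_iff_dvd_diff power2_eq_square)
  also have "\<dots> = J (- 1) x + (nsmul j (J r x) + (J Q x + J Q x + J w x + J n x))"
    using xq c by (subst J_mult_left) (auto simp: J_mult_left J_power_left)
  finally show ?thesis by (simp add: JB algebra_simps)
qed

text \<open>For \<open>j = 0\<close> the value at \<open>r\<close> drops out and a relation between local terms remains.\<close>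

lemma B_relation_0:
  assumes w: "coprime w r" and n: "coprime n r" and u: "coprime u r"
    and c: "[u = 1 + Q ^ 2 * w * n] (mod r ^ k)"
  shows "B (- 1) u + B Q u + B Q u + B w u + B n u = 0"
proof -
  define x where "x = 1 + Q ^ 2 * w * n"
  have xr: "coprime x r" using c u coprime_cong_r[of x u] by (simp add: x_def cong_sym)
  have "B y x = B y u" if "coprime r y" for y
    using that xr c by (intro B_cong_right) (auto simp: x_def cong_sym)
  then show ?thesis using B_relation[OF w n, of x 0] xr w n rQ by (simp add: x_def coprime_commute)
qed

lemma inverse_mod_r:
  assumes "coprime a r"
  obtains z where "[a * z = 1] (mod r ^ i)" "coprime z r"
proof -
  have "coprime a (r ^ Suc i)" using assms by simp
  then obtain z where z: "[a * z = 1] (mod r ^ Suc i)" using cong_solve_coprime_int by blast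
  then have "[a * z = 1] (mod r)" by (rule cong_dvd_modulus) simp
  then have "coprime (a * z) r" by (metis cong_imp_coprime cong_sym coprime_1_left)
  moreover have "[a * z = 1] (mod r ^ i)" using z by (rule cong_dvd_modulus) simp
  ultimately show ?thesis using that by simp
qed

lemma coprime_r_iff: "coprime a r \<longleftrightarrow> \<not> r dvd a"
  using r by (metis coprime_commute not_prime_unit prime_imp_coprime coprime_absorb_left)

text \<open>Symmetric to \<open>B_cong_right\<close>, but in its first argument \<open>B\<close> is not periodic by definition. It is enough to
check this near 1.\<close>

lemma B_cong_leftI:
  assumes one: "\<And>w. [w = 1] (mod r ^ k) \<Longrightarrow> coprime w r \<Longrightarrow> B w u = 0"
    and u: "coprime u r" and y: "coprime y r" "[y = y'] (mod r ^ k)"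
  shows "B y u = B y' u"
proof -
  obtain z where z: "[y * z = 1] (mod r ^ k)" "coprime z r" using inverse_mod_r[OF y(1)] .
  have y': "coprime y' r" using y by (metis coprime_cong_r cong_sym)
  have "[y' * z = y * z] (mod r ^ k)" using y(2) by (intro cong_mult cong_refl) (rule cong_sym)
  then have "[y' * z = 1] (mod r ^ k)" using z(1) by (rule cong_trans)
  then have "B (y * z) u = 0" "B (y' * z) u = 0" using z y y' by (auto intro!: one)
  then show ?thesis using B_mult_left[of y z u] B_mult_left[of y' z u] y(1) y' z(2) u
    by (simp add: coprime_commute) (metis add_right_cancel)
qed

text \<open>The symbol of \<open>y\<close> splits into a power of \<open>J r x\<close> and a local term; both have to vanish.\<close>

lemma has_level_mI:
  assumes B0: "\<And>w u. coprime w r \<Longrightarrow> coprime u r \<Longrightarrow> B w u = 0"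
    and r0: "\<And>x. coprime x q \<Longrightarrow> [x = 1] (mod m * r) \<Longrightarrow> J r x = 0"
  shows "has_level m"
  unfolding has_level_def
proof (intro allI impI)
  fix x y assume x: "coprime x q" "[x = 1] (mod m * y)"
  show "J y x = 0"
  proof (cases "y = 0")
    case True
    then have "x = 1" using x(2) by simp
    then show ?thesis by (simp add: J_1_right)
  next
    case False
    then obtain y' where y': "y = r ^ multiplicity r y * y'" "\<not> r dvd y'"
      using r by (metis multiplicity_decompose' not_prime_unit)
    define e where "e = multiplicity r y"
    have y: "y = r ^ e * y'" using y' by (simp add: e_def)
    have cyx: "coprime x y" using x(2) by (rule coprime_of_cong_1)
    have xr: "coprime x r" using x(1) by (simp add: coprime_q_iff)
    have y'r: "coprime y' r" using y'(2) by (simp add: coprime_r_iff)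
    have "[x = 1] (mod m * y')" using x(2) by (rule cong_dvd_modulus) (simp add: y)
    then have "J y' x = B y' x"
      using y'r xr x(1) by (intro B_wd) (auto simp: coprime_commute)
    also have "\<dots> = 0" using y'r xr by (intro B0)
    finally have 1: "J y' x = 0" .
    have 2: "nsmul e (J r x) = 0"
    proof (cases "e = 0")
      case False
      then have "m * r dvd m * y" by (auto simp: y intro!: mult_dvd_mono dvd_mult2 dvd_power)
      with x have "J r x = 0" by (intro r0) (auto intro: cong_dvd_modulus)
      then show ?thesis by simp
    qed simp
    have "J y x = nsmul e (J r x) + J y' x"
      using x(1) cyx xr by (simp add: y J_mult_left J_power_left coprime_commute)
    then show ?thesis using 1 2 by simp
  qed
qed

end

section \<open>Lowering the level at an odd prime\<close>

locale odd_level_descent = level_descent q J r Q m k K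
  for q and J :: "int \<Rightarrow> int \<Rightarrow> 'v::ab_group_add" and r Q m k K +
  assumes odd_r: "odd r"
begin

lemma r_gt_2: "r > 2"
  using prime_gt_1_int[OF r] odd_r by (cases "r = 2") auto

text \<open>The relation \<open>B_relation_0\<close> for the pairs \<open>(w, n)\<close> and \<open>(1, n)\<close> has the same other terms, as \<open>w\<close> is 1 modulo \<open>r\<^sup>k\<close>. It
needs a unit \<open>n\<close> proportional to \<open>u - 1\<close>.\<close>

lemma B_1_mod_aux:
  assumes w: "[w = 1] (mod r ^ k)" and u: "coprime u r" "coprime (u - 1) r"
  shows "B w u = 0"
proof -
  have wr: "coprime w r" using coprime_cong_r[OF w] by simp
  obtain z where z: "[Q ^ 2 * z = 1] (mod r ^ k)" "coprime z r"
    using inverse_mod_r[of "Q ^ 2" k] rQ by (auto simp: coprime_commute)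
  define n where "n = z * (u - 1)"
  have n: "coprime n r" using z u by (simp add: n_def)
  have 1: "[u = 1 + Q ^ 2 * n] (mod r ^ k)"
  proof -
    have "[1 + Q ^ 2 * z * (u - 1) = 1 + 1 * (u - 1)] (mod r ^ k)"
      by (intro cong_add cong_mult z cong_refl)
    then show ?thesis by (simp add: n_def mult.assoc cong_sym)
  qed
  have "[1 + Q ^ 2 * w * n = 1 + Q ^ 2 * 1 * n] (mod r ^ k)"
    by (intro cong_add cong_mult w cong_refl)
  then have 2: "[u = 1 + Q ^ 2 * w * n] (mod r ^ k)" using 1 by (metis cong_sym cong_trans mult_1_right)
  have "B (- 1) u + B Q u + B Q u + B w u + B n u = 0" using B_relation_0[OF wr n u(1) 2] .
  moreover have "B (- 1) u + B Q u + B Q u + B 1 u + B n u = 0"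
    using B_relation_0[of 1 n u] n u(1) 1 by simp
  ultimately show ?thesis using B_1_left[OF u(1)] by (metis add_left_cancel add_right_cancel)
qed

text \<open>If \<open>u - 1\<close> is divisible by \<open>r\<close>, then neither \<open>- u - 1\<close> nor \<open>- 1 - 1\<close> is, since \<open>r\<close> is odd.\<close>

lemma B_1_mod:
  assumes w: "[w = 1] (mod r ^ k)" and u: "coprime u r"
  shows "B w u = 0"
proof (cases "coprime (u - 1) r")
  case True
  then show ?thesis using B_1_mod_aux w u by blast
next
  case False
  then have d: "r dvd u - 1" by (simp add: coprime_r_iff)
  have no2: "\<not> r dvd 2" using r_gt_2 zdvd_imp_le[of r 2] by auto
  have "\<not> r dvd - u - 1"
  proof
    assume "r dvd - u - 1"
    with d have "r dvd (u - 1) + (- u - 1)" by (rule dvd_add)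
    then show False using no2 by simp
  qed
  then have "B w (- u) = 0"
    using B_1_mod_aux[OF w, of "- u"] u by (auto simp: coprime_r_iff)
  moreover have "B w (- 1) = 0"
    using no2 r_gt_2 by (intro B_1_mod_aux[OF w]) (auto simp: coprime_r_iff)
  moreover have "coprime r w" using coprime_cong_r[OF w] by (simp add: coprime_commute)
  ultimately show ?thesis using B_mult_right[of w "- 1" "- u"] u by simp
qed

lemma B_cong_left:
  assumes "coprime u r" "coprime y r" "[y = y'] (mod r ^ k)"
  shows "B y u = B y' u"
  using B_1_mod assms by (intro B_cong_leftI) auto

text \<open>The product formula for \<open>u = 1 + Q\<^sup>2 n\<close>: the local terms combine to the symbol of \<open>- (Q\<^sup>2 n)\<close>, which is
congruent to \<open>1 - u\<close>.\<close>

lemma steinberg: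
  assumes s: "coprime s r" and u: "coprime u r" and c: "[s + u = 1] (mod r ^ k)"
  shows "B s u = 0"
proof -
  have "[1 - u = s] (mod r ^ k)" using cong_diff[OF cong_sym[OF c] cong_refl[of u]] by simp
  then have u1: "coprime (1 - u) r" using s by (rule coprime_cong_r)
  obtain z where z: "[Q ^ 2 * z = 1] (mod r ^ k)" "coprime z r"
    using inverse_mod_r[of "Q ^ 2" k] rQ by (auto simp: coprime_commute)
  define n where "n = z * (u - 1)"
  have "coprime (u - 1) r" using u1 by (subst coprime_minus_left_iff[symmetric]) simp
  then have n: "coprime n r" using z by (simp add: n_def)
  have 1: "[Q ^ 2 * n = 1 * (u - 1)] (mod r ^ k)"
    unfolding n_def mult.assoc[symmetric] by (intro cong_mult z cong_refl)
  have 2: "[u = 1 + Q ^ 2 * 1 * n] (mod r ^ k)"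
    using cong_add[OF cong_refl[of 1] 1] by (simp add: cong_sym)
  have "B (- 1) u + B Q u + B Q u + B 1 u + B n u = 0"
    using n u 2 by (intro B_relation_0) auto
  then have "B (- 1 * (Q * (Q * n))) u = 0"
    using n u rQ by (subst B_mult_left, simp_all add: coprime_commute)+ (simp_all add: B_1_left[OF u] algebra_simps)
  moreover have "[- 1 * (Q * (Q * n)) = s] (mod r ^ k)"
  proof -
    have "[- 1 * (Q ^ 2 * n) = - 1 * (1 * (u - 1))] (mod r ^ k)" by (intro cong_mult 1 cong_refl)
    then show ?thesis using \<open>[1 - u = s] (mod r ^ k)\<close>
      by (simp add: power2_eq_square mult.assoc) (metis cong_trans)
  qed
  ultimately show ?thesis
    using B_cong_left[OF u s, of "- 1 * (Q * (Q * n))"] by (simp add: cong_sym)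
qed

text \<open>The classical consequence of the Steinberg relation, obtained from \<open>- u = (1 - u) / (1 - u\<^sup>-\<^sup>1)\<close>.\<close>

lemma B_self:
  assumes u: "coprime u r" and u1: "coprime (1 - u) r"
  shows "B u u = B (- 1) u"
proof -
  obtain v where v: "[u * v = 1] (mod r ^ k)" "coprime v r" using inverse_mod_r[OF u] .
  have c: "[u * (1 - v) = u - 1] (mod r ^ k)"
    using cong_diff[OF cong_refl[of u] v(1)] by (simp add: algebra_simps)
  have u1': "coprime (u - 1) r" using u1 by (metis coprime_minus_left_iff minus_diff_eq)
  have v1: "coprime (1 - v) r" using coprime_cong_r[OF c u1'] by simp
  have "B (1 - v) v = 0" using v v1 by (intro steinberg) auto
  moreover have "B (1 - v) (u * v) = 0"
    using B_cong_right[OF _ _ v(1), of "1 - v"] v1 u v(2) by (simp add: coprime_commute B_1_right)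
  ultimately have "B (1 - v) u = 0" using B_mult_right[of "1 - v" u v] v1 u v(2) by (simp add: coprime_commute)
  moreover have "B (1 - u) u = 0" using u u1 by (intro steinberg) auto
  moreover have "B (u * (1 - v)) u = B (- 1 * (1 - u)) u" using c u v1 by (intro B_cong_left) auto
  ultimately show ?thesis
    using B_mult_left[of u "1 - v" u] B_mult_left[of "- 1" "1 - u" u] u v1 u1
    by (simp add: coprime_commute)
qed

text \<open>By the last property the parity of the exponent depends on the residue class modulo \<open>r\<close> only; it is the quadratic
character.\<close>

lemma generator:
  obtains g where "coprime g r" "\<And>x. coprime x r \<Longrightarrow> \<exists>i. [x = g ^ i] (mod r ^ k)"
    "\<And>i. [g ^ i = 1] (mod r) \<Longrightarrow> even i"
proof -
  define p where "p = nat r"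
  have rp: "r = int p" using r_gt_2 by (simp add: p_def)
  have p: "prime p" "odd p" using r odd_r by (auto simp: rp)
  obtain g where g: "\<forall>k>0. residue_primroot (p ^ k) g" using residue_primroot_odd_prime_power_exists[OF p] .
  have gp: "coprime p g" using g[rule_format, of 1] by (simp add: residue_primroot_def)
  have pk: "p ^ k > 1" using k prime_gt_1_nat[OF p(1)] by (intro one_less_power) auto
  show ?thesis
  proof
    show "coprime (int g) r" using gp by (simp add: rp coprime_commute)
  next
    fix x :: int assume x: "coprime x r"
    define y where "y = nat (x mod r ^ k)"
    have yx: "int y = x mod r ^ k" using r_gt_2 by (simp add: y_def)
    then have c: "[int y = x] (mod r ^ k)" by simp
    have "coprime (int y) r" using c x by (rule coprime_cong_r)
    then have yp: "coprime y p" by (simp add: rp)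
    have "x mod r ^ k < r ^ k" using r_gt_2 by (intro pos_mod_bound zero_less_power) simp
    then have "int y < int (p ^ k)" by (simp only: yx rp of_nat_power)
    then have "y < p ^ k" by (simp only: of_nat_less_iff)
    moreover have "y > 0" using yp p(1) by (cases "y = 0") auto
    ultimately have "y \<in> totatives (p ^ k)" using yp by (auto simp: totatives_def)
    then have "y \<in> (\<lambda>i. g ^ i mod p ^ k) ` {..<totient (p ^ k)}"
      using residue_primroot_is_generator[OF pk, of g] g k by (auto simp: bij_betw_def)
    then obtain i where "y = g ^ i mod p ^ k" by auto
    then have "[y = g ^ i] (mod p ^ k)" by simp
    then have "[int y = int g ^ i] (mod r ^ k)" by (simp add: rp flip: cong_int_iff)
    then have "[x = int g ^ i] (mod r ^ k)" by (rule cong_trans[OF cong_sym[OF c]])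
    then show "\<exists>i. [x = int g ^ i] (mod r ^ k)" ..
  next
    fix i assume "[int g ^ i = 1] (mod r)"
    then have "[g ^ i = 1] (mod p)" by (simp add: rp flip: cong_int_iff)
    then have "ord p g dvd i" unfolding ord_divides .
    have "ord p g = p - 1" using g[rule_format, of 1] p by (simp add: residue_primroot_def totient_prime)
    then have "even (ord p g)" using p by simp
    then show "even i" using \<open>ord p g dvd i\<close> by (rule dvd_trans)
  qed
qed

text \<open>The units modulo \<open>r\<^sup>k\<close> are generated by one \<open>g\<close>, and \<open>B g g = B (- 1) g\<close> has order at most two. So \<open>B\<close> is
nontrivial at most on pairs of nonresidues modulo \<open>r\<close>, where it is constant. Two consecutive units \<open>z - 1\<close> and
\<open>z\<close>, a residue and a nonresidue, then contradict the Steinberg relation for \<open>1 - z\<close> and \<open>z\<close>.\<close>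

lemma B_eq_0:
  assumes w: "coprime w r" and u: "coprime u r"
  shows "B w u = 0"
proof -
  obtain g where g: "coprime g r" and gen: "\<And>x. coprime x r \<Longrightarrow> \<exists>i. [x = g ^ i] (mod r ^ k)"
    and ev: "\<And>i. [g ^ i = 1] (mod r) \<Longrightarrow> even i" using generator by blast
  have rg: "coprime r g" using g by (simp add: coprime_commute)
  define e where "e = B g g"
  have "\<not> [g = 1] (mod r)" using ev[of 1] by auto
  then have "coprime (1 - g) r" by (simp add: coprime_r_iff cong_iff_dvd_diff dvd_diff_commute)
  then have e: "e = B (- 1) g" unfolding e_def using g by (intro B_self)
  have tors: "e + e = 0" using B_mult_left[of "- 1" "- 1" g] g by (simp add: e B_1_left)
  have pw: "B (g ^ i) (g ^ j) = (if odd i \<and> odd j then e else 0)" for i j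
    using rg g by (simp add: B_power_left B_power_right nsmul_torsion_2[OF tors] nsmul_mult flip: e_def)
  have dep: "B x y = B (g ^ i) (g ^ j)"
    if "coprime x r" "coprime y r" "[x = g ^ i] (mod r ^ k)" "[y = g ^ j] (mod r ^ k)" for x y i j
    using that g by (subst B_cong_left[of y x "g ^ i"]) (auto intro: B_cong_right simp: coprime_commute)
  have "e = 0"
  proof (rule ccontr)
    assume ne: "e \<noteq> 0"
    define P where "P z \<longleftrightarrow> coprime (int z) r \<and> B (int z) g \<noteq> 0" for z
    define z0 where "z0 = nat (g mod r ^ k)"
    have "int z0 = g mod r ^ k" using r_gt_2 by (simp add: z0_def)
    then have c0: "[int z0 = g] (mod r ^ k)" by simp
    have "coprime (int z0) r" using coprime_cong_r[OF c0 g] .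
    moreover from this have "B (int z0) g = e" unfolding e_def using c0 by (intro B_cong_left[OF g])
    ultimately have "P z0" using ne unfolding P_def by metis
    then have "P (LEAST z. P z)" by (rule LeastI)
    then obtain z where z: "P z" and least: "\<And>y. y < z \<Longrightarrow> \<not> P y" by (metis not_less_Least)
    obtain i where i: "[int z = g ^ i] (mod r ^ k)" using gen z by (auto simp: P_def)
    have iodd: "odd i" using dep[of "int z" g i 1] pw[of i 1] z i g by (auto simp: P_def split: if_splits)
    have "z \<noteq> 0" using z r_gt_2 by (cases "z = 0") (auto simp: P_def)
    have "[int z = g ^ i] (mod r)" using i k by (auto intro: cong_dvd_modulus)
    then have "\<not> [int z = 1] (mod r)" using ev[of i] iodd by (metis cong_sym cong_trans)
    then have c1: "coprime (int z - 1) r" by (simp add: coprime_r_iff cong_iff_dvd_diff)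
    \<comment> \<open>By minimality of \<open>z\<close> its predecessor is a residue; it is prime to \<open>r\<close>, as \<open>z\<close> is not 1 modulo \<open>r\<close>.\<close>
    have "\<not> P (z - 1)" using \<open>z \<noteq> 0\<close> by (intro least) simp
    then have "B (int z - 1) g = 0" using c1 \<open>z \<noteq> 0\<close> by (simp add: P_def of_nat_diff)
    moreover obtain j where j: "[int z - 1 = g ^ j] (mod r ^ k)" using gen c1 by auto
    ultimately have jev: "even j" using dep[of "int z - 1" g j 1] pw[of j 1] c1 g ne by (auto split: if_splits)
    \<comment> \<open>The value \<open>e = B (- 1) g\<close> is not zero, so \<open>- 1\<close> is a nonresidue and \<open>1 - z\<close> is one, too.\<close>
    obtain f where f: "[- 1 = g ^ f] (mod r ^ k)" using gen[of "- 1"] by auto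
    then have fodd: "odd f" using dep[of "- 1" g f 1] pw[of f 1] g ne e by (auto split: if_splits)
    have c1': "coprime (1 - int z) r" using c1 by (metis coprime_minus_left_iff minus_diff_eq)
    have "B (1 - int z) (int z) = 0" using z c1' by (intro steinberg) (auto simp: P_def)
    moreover have "[1 - int z = g ^ (f + j)] (mod r ^ k)"
      using cong_mult[OF f j] by (simp add: power_add)
    ultimately show False
      using dep[of "1 - int z" "int z" "f + j" i] pw[of "f + j" i] z c1' i iodd fodd jev ne
      by (simp add: P_def)
  qed
  moreover obtain i j where "[w = g ^ i] (mod r ^ k)" "[u = g ^ j] (mod r ^ k)" using gen w u by meson
  ultimately show ?thesis using dep[of w u i j] pw[of i j] w u by (simp split: if_splits)
qed

text \<open>The product formula for \<open>j = 1\<close>, where all local terms are already known to vanish.\<close>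

lemma J_r_eq_0_aux:
  assumes x: "coprime x q" "[x = 1] (mod m * r)" and nd: "\<not> r ^ 2 dvd x - 1"
  shows "J r x = 0"
proof -
  have "r dvd x - 1" using x(2) by (metis cong_iff_dvd_diff dvd_mult_right)
  then obtain t where t: "x - 1 = r * t" by blast
  have tr: "coprime t r" using nd t by (auto simp: coprime_r_iff power2_eq_square)
  obtain z where z: "[Q ^ 2 * z = 1] (mod r ^ k)" "coprime z r"
    using inverse_mod_r[of "Q ^ 2" k] rQ by (auto simp: coprime_commute)
  define n where "n = z * t"
  have n: "coprime n r" using z tr by (simp add: n_def)
  define x' where "x' = 1 + r ^ 1 * (Q ^ 2 * 1 * n)"
  have xr: "coprime x r" using x(1) by (simp add: coprime_q_iff)
  have x'r: "coprime x' r"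
  proof -
    have "[1 = x'] (mod r)" by (simp add: x'_def cong_iff_dvd_diff)
    then show ?thesis by (metis cong_imp_coprime coprime_1_left)
  qed
  have "[r * (Q ^ 2 * z * t) = r * (1 * t)] (mod r * r ^ k)"
    by (intro cong_cmult_leftI cong_mult z cong_refl)
  then have 1: "[x = x'] (mod r ^ Suc k)"
  proof -
    have "x = 1 + r * (1 * t)" using t by simp
    moreover have "x' = 1 + r * (Q ^ 2 * z * t)" by (simp only: x'_def n_def power_one_right mult_1_right mult.assoc)
    ultimately show ?thesis
      using cong_add[OF cong_refl[of 1] \<open>[r * (Q ^ 2 * z * t) = r * (1 * t)] (mod r * r ^ k)\<close>]
      by (simp only: power_Suc) (rule cong_sym)
  qed
  have "[x' = 1] (mod m)" using mQ by (auto simp: x'_def cong_iff_dvd_diff power2_eq_square)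
  moreover have "[x = 1] (mod m)" using x(2) by (rule cong_modulus_mult)
  ultimately have "[x = x'] (mod m)" by (metis cong_sym cong_trans)
  with 1 have "[x = x'] (mod r ^ Suc k * m)" using coprime_r_m by (intro coprime_cong_mult) auto
  then have c: "[x = x'] (mod (r ^ k * m) * r)" by (simp add: mult_ac)
  have "[1 = x'] (mod Q)" by (simp add: x'_def cong_iff_dvd_diff power2_eq_square)
  then have "coprime x' Q" by (metis cong_imp_coprime coprime_1_left)
  with x'r have x'q: "coprime x' q" by (simp add: coprime_q_iff)
  have "coprime x m" using x(1) mQ by (metis coprime_q_iff coprime_divisors dvd_refl)
  then have "J r x = J r x'" using x x'q xr c by (intro J_dep[OF lev]) auto
  also have "\<dots> = 0"
    using B_relation[of 1 n x' 1] n x'r rQ by (simp add: x'_def B_eq_0 coprime_commute)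
  finally show ?thesis .
qed

lemma has_level_m: "has_level m"
proof (rule has_level_mI[OF B_eq_0])
  fix x assume x: "coprime x q" "[x = 1] (mod m * r)"
  show "J r x = 0"
  proof (cases "r ^ 2 dvd x - 1")
    case True
    \<comment> \<open>If \<open>r\<^sup>2\<close> divides \<open>x - 1\<close>, the factor \<open>y\<close> spoils this, and both \<open>y\<close> and \<open>x y\<close> fall under the previous lemma.\<close>
    obtain y where y: "[y = 1 + r] (mod r ^ 2)" "[y = 1] (mod Q)"
      using chinese[OF rQ, of "1 + r" 2 1] by auto
    have y1: "[y = 1] (mod r)" using y(1)
      by (metis cong_add_lcancel_0 cong_dvd_modulus cong_trans dvd_triv_left power2_eq_square cong_mult_self_left mult.right_neutral)
    have yq: "coprime y q" using y1 y(2) by (metis coprime_q_iff cong_imp_coprime cong_sym coprime_1_left)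
    have "[y = 1] (mod m)" using y(2) mQ by (rule cong_dvd_modulus)
    then have ym: "[y = 1] (mod m * r)" using y1 coprime_r_m by (intro coprime_cong_mult) (auto simp: coprime_commute)
    have xy: "[x * y = 1] (mod m * r)" using cong_mult[OF x(2) ym] by simp
    have ny: "\<not> [y = 1] (mod r ^ 2)"
    proof
      assume "[y = 1] (mod r ^ 2)"
      then have "[1 + r = 1] (mod r ^ 2)" using y(1) by (metis cong_sym cong_trans)
      then have "r ^ 2 dvd r" by (simp add: cong_iff_dvd_diff)
      then show False using r_gt_2 zdvd_imp_le[of "r ^ 2" r] by (simp add: power2_eq_square)
    qed
    have "[x * y = 1 * y] (mod r ^ 2)" using True by (intro cong_mult cong_refl) (simp add: cong_iff_dvd_diff)
    then have nxy: "\<not> [x * y = 1] (mod r ^ 2)" using ny by (metis cong_sym cong_trans mult_1)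
    have "J r (x * y) = 0" "J r y = 0"
      using J_r_eq_0_aux[of "x * y"] J_r_eq_0_aux[of y] x yq xy ym ny nxy by (auto simp: cong_iff_dvd_diff)
    moreover have "coprime r x" "coprime r y" using x(1) yq coprime_q_iff coprime_commute by blast+
    then have "J r (x * y) = J r x + J r y"
      using x(1) yq by (intro J_mult_right)
    ultimately show ?thesis by simp
  qed (use J_r_eq_0_aux x in blast)
qed

end

section \<open>Lowering the level at the prime two\<close>

lemma power_two_power_3: "\<exists>c. odd c \<and> (3::int) ^ (2 ^ Suc i) = 1 + 2 ^ (i + 3) * c"
proof (induction i)
  case (Suc i)
  then obtain c where c: "odd c" "(3::int) ^ (2 ^ Suc i) = 1 + 2 ^ (i + 3) * c" by blast
  have "(3::int) ^ (2 ^ Suc (Suc i)) = (3 ^ (2 ^ Suc i)) ^ 2"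
    by (simp add: power_mult[symmetric] mult.commute)
  also have "\<dots> = 1 + 2 ^ (Suc i + 3) * (c + 2 ^ (i + 2) * c ^ 2)"
    unfolding c(2) by (simp add: power2_eq_square algebra_simps power_add)
  finally show ?case using c(1) by (intro exI[of _ "c + 2 ^ (i + 2) * c ^ 2"] conjI) auto
qed (auto intro!: exI[of _ 1])

text \<open>The numbers \<open>- 1\<close> and \<open>3\<close> generate the odd residue classes modulo a power of two: once \<open>3\<^sup>i\<close> is right modulo
\<open>2\<close> to the power \<open>M + 3\<close>, a factor \<open>3\<close> to the power \<open>2\<close> to the \<open>M + 1\<close> corrects the next binary digit.\<close>

lemma odd_mod_two_power:
  assumes "odd (x::int)"
  shows "\<exists>i. [x = 3 ^ i] (mod 2 ^ (M + 3)) \<or> [x = - (3 ^ i)] (mod 2 ^ (M + 3))"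
proof (induction M)
  case 0
  have "x mod 8 = 1 \<or> x mod 8 = 3 \<or> x mod 8 = 5 \<or> x mod 8 = 7" using assms by presburger
  then show ?case
  proof (elim disjE)
    assume "x mod 8 = 1" then show ?thesis by (intro exI[of _ 0]) (simp add: cong_def)
  next
    assume "x mod 8 = 3" then show ?thesis by (intro exI[of _ 1]) (simp add: cong_def)
  next
    assume "x mod 8 = 5" then show ?thesis by (intro exI[of _ 1]) (simp add: cong_def)
  next
    assume "x mod 8 = 7" then show ?thesis by (intro exI[of _ 0]) (simp add: cong_def)
  qed
next
  case (Suc M)
  have *: "\<exists>i. [y = 3 ^ i] (mod 2 ^ (Suc M + 3))" if y: "[y = 3 ^ i] (mod 2 ^ (M + 3))" for y :: int and i
  proof -
    obtain t where t: "y = 3 ^ i + 2 ^ (M + 3) * t" using y by (metis cong_iff_lin cong_sym)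
    obtain c where c: "odd c" "(3::int) ^ (2 ^ Suc M) = 1 + 2 ^ (M + 3) * c"
      using power_two_power_3 by blast
    show ?thesis
    proof (cases "even t")
      case True
      then obtain v where "t = 2 * v" by blast
      then have "y - 3 ^ i = 2 ^ (Suc M + 3) * v" by (simp add: t power_add)
      then show ?thesis by (intro exI[of _ i]) (simp only: cong_iff_dvd_diff dvd_triv_left)
    next
      case False
      then have "even (t - 3 ^ i * c)" using c by simp
      then obtain v where v: "t - 3 ^ i * c = 2 * v" by blast
      have "y - 3 ^ (i + 2 ^ Suc M) = 2 ^ (M + 3) * (t - 3 ^ i * c)"
        unfolding power_add c(2) t by (simp add: algebra_simps)
      then have "y - 3 ^ (i + 2 ^ Suc M) = 2 ^ (Suc M + 3) * v" by (simp add: v power_add)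
      then show ?thesis by (intro exI[of _ "i + 2 ^ Suc M"]) (simp only: cong_iff_dvd_diff dvd_triv_left)
    qed
  qed
  from Suc.IH obtain i where "[x = 3 ^ i] (mod 2 ^ (M + 3)) \<or> [x = - (3 ^ i)] (mod 2 ^ (M + 3))" by blast
  then show ?case
  proof
    assume "[x = - (3 ^ i)] (mod 2 ^ (M + 3))"
    then have "[- x = 3 ^ i] (mod 2 ^ (M + 3))" by (metis cong_minus_minus_iff minus_minus)
    then obtain j where "[- x = 3 ^ j] (mod 2 ^ (Suc M + 3))" using * by blast
    then have "[x = - (3 ^ j)] (mod 2 ^ (Suc M + 3))" by (metis cong_minus_minus_iff minus_minus)
    then show ?thesis by blast
  qed (use * in blast)
qed

lemma power_3_mod_8: "(3::int) ^ i mod 8 = (if even i then 1 else 3)"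
proof (induction i)
  case (Suc i)
  have "(3::int) ^ Suc i mod 8 = 3 * (3 ^ i mod 8) mod 8" by (simp add: mod_mult_right_eq)
  then show ?case using Suc.IH by simp
qed simp

text \<open>At the prime two the group of units is not cyclic, and \<open>1 - u\<close> is never a unit when \<open>u\<close> is, so the Steinberg relation
necessarily involves the value of the symbol at two. The bound on \<open>k\<close> makes residue classes modulo
\<open>2\<close> to the power \<open>k + 1\<close> determine those modulo 8.\<close>

locale two_level_descent = level_descent q J 2 Q 1 k K
  for q and J :: "int \<Rightarrow> int \<Rightarrow> 'v::ab_group_add" and Q k K +
  assumes k2: "k \<ge> 2"
begin

lemma odd_Q: "odd Q"
  using rQ by simp

lemma coprime_2_iff: "coprime x 2 \<longleftrightarrow> odd (x::int)" "coprime 2 x \<longleftrightarrow> odd x"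
  by (auto simp: coprime_commute)

lemma odd_q: "coprime x q \<Longrightarrow> odd x"
  by (simp add: coprime_q_iff coprime_2_iff)

text \<open>The value at two depends on \<open>x\<close> modulo twice the level. As \<open>x\<close> is odd, it is determined by a residue class modulo
\<open>2\<close> to the power \<open>k + 1\<close> (\<open>f_wd\<close>).\<close>

definition f :: "int \<Rightarrow> 'v" where
  "f u = J 2 (SOME x. [x = u] (mod 2 ^ Suc k) \<and> [x = 1] (mod Q))"

lemma coprime_q_of_cong:
  assumes "[x = u] (mod 2 ^ Suc k)" "[x = 1] (mod Q)" "odd u"
  shows "coprime x q"
proof -
  have "[x = u] (mod 2 ^ k)" using assms(1) by (rule cong_dvd_modulus) simp
  then have "coprime x 2" using assms(3) by (intro coprime_cong_r[of x u]) (simp_all add: coprime_2_iff)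
  moreover have "coprime x Q" using assms(2) by (metis cong_imp_coprime cong_sym coprime_1_left)
  ultimately show ?thesis by (simp add: coprime_q_iff)
qed

lemma f_wd:
  assumes x: "coprime x q" "[x = u] (mod 2 ^ Suc k)" and u: "odd u"
  shows "J 2 x = f u"
proof -
  let ?P = "\<lambda>x. [x = u] (mod 2 ^ Suc k) \<and> [x = 1] (mod Q)"
  define y where "y = (SOME x. ?P x)"
  have "\<exists>x. ?P x" using chinese[OF rQ, of u "Suc k" 1] .
  then have "?P y" unfolding y_def by (rule someI_ex)
  then have y: "[y = u] (mod 2 ^ Suc k)" "coprime y q" using coprime_q_of_cong u by auto
  have "[x = y] (mod 2 ^ Suc k)" using x(2) y(1) by (metis cong_sym cong_trans)
  then have "[x = y] (mod (2 ^ k * 1) * 2)" by (simp add: mult.commute)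
  then have "J 2 x = J 2 y"
    using x y odd_q[OF x(1)] by (intro J_dep[OF lev]) (auto simp: coprime_2_iff)
  then show ?thesis by (simp add: f_def y_def)
qed

lemma f_rep:
  assumes "odd u"
  obtains x where "coprime x q" "[x = u] (mod 2 ^ Suc k)"
  using chinese[OF rQ, of u "Suc k" 1] coprime_q_of_cong assms by blast

lemma f_mult:
  assumes "odd u" "odd v"
  shows "f (u * v) = f u + f v"
proof -
  obtain x y where x: "coprime x q" "[x = u] (mod 2 ^ Suc k)" and y: "coprime y q" "[y = v] (mod 2 ^ Suc k)"
    using f_rep assms by metis
  have "J 2 (x * y) = J 2 x + J 2 y"
    using x(1) y(1) odd_q by (intro J_mult_right) (auto simp: coprime_2_iff)
  moreover have "J 2 (x * y) = f (u * v)"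
    using x y assms by (intro f_wd cong_mult) auto
  moreover have "J 2 x = f u" "J 2 y = f v" using x y assms by (auto intro: f_wd)
  ultimately show ?thesis by simp
qed

lemma f_cong:
  assumes "odd u" "[u = v] (mod 2 ^ Suc k)"
  shows "f u = f v"
proof -
  obtain x where x: "coprime x q" "[x = u] (mod 2 ^ Suc k)" using f_rep assms by metis
  have "[u = v] (mod 2)" using assms(2) by (rule cong_dvd_modulus) simp
  then have "odd v" using assms(1) by (simp add: cong_def) presburger
  then show ?thesis using f_wd[OF x assms(1)] f_wd[of x v] x assms(2) by (metis cong_trans)
qed

lemma f_1: "f 1 = 0"
  using f_mult[of 1 1] by simp

lemma f_power: "odd u \<Longrightarrow> f (u ^ i) = nsmul i (f u)"
  by (induction i) (auto simp: f_1 f_mult)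

lemma f_relation:
  assumes j: "j \<ge> 1" and w: "odd w" and n: "odd n" and u: "[u = 1 + 2 ^ j * (Q ^ 2 * w * n)] (mod 2 ^ Suc k)"
  shows "nsmul j (f u) + (B (- 1) u + B Q u + B Q u + B w u + B n u) = 0"
proof -
  define x where "x = 1 + 2 ^ j * (Q ^ 2 * w * n)"
  have xo: "odd x" using j by (simp add: x_def)
  have xu: "[x = u] (mod 2 ^ Suc k)" using u by (simp add: x_def cong_sym)
  then have "[x = u] (mod 2)" by (rule cong_dvd_modulus) simp
  then have uo: "odd u" using xo by (simp add: cong_def) presburger
  have "[x = 1] (mod Q)" by (simp add: x_def cong_iff_dvd_diff power2_eq_square)
  then have xq: "coprime x q" using xu uo by (intro coprime_q_of_cong)
  have c: "[x = u] (mod 2 ^ k)" using xu by (rule cong_dvd_modulus) simp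
  have Bx: "B y x = B y u" if "odd y" for y
    using that xo c by (intro B_cong_right) (auto simp: coprime_2_iff)
  have "nsmul j (J 2 x) + (B (- 1) x + B Q x + B Q x + B w x + B n x) = 0"
    using w n xo by (intro B_relation) (auto simp: x_def coprime_2_iff)
  then show ?thesis using f_wd[OF xq xu uo] Bx w n odd_Q by simp
qed

lemma inverse_Q2:
  obtains z where "[Q ^ 2 * z = 1] (mod 2 ^ Suc k)" "odd z"
  using inverse_mod_r[of "Q ^ 2" "Suc k"] odd_Q by (auto simp: coprime_2_iff)

lemma cong_Q2:
  assumes "[Q ^ 2 * z = 1] (mod 2 ^ Suc k)"
  shows "[1 + 2 ^ j * (Q ^ 2 * 1 * (z * s)) = 1 + 2 ^ j * s] (mod 2 ^ Suc k)"
proof -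
  have "[1 + 2 ^ j * (Q ^ 2 * z * s) = 1 + 2 ^ j * (1 * s)] (mod 2 ^ Suc k)"
    by (intro cong_add cong_mult assms cong_refl)
  then show ?thesis by (simp add: mult.assoc)
qed

text \<open>As for odd primes two instances of the product formula are compared. If \<open>2\<^sup>j\<close> exactly divides \<open>u - 1\<close>, then
\<open>2\<^sup>j w\<close> and \<open>2\<^sup>j\<close> agree modulo twice the level, since \<open>j\<close> is positive.\<close>

lemma B_1_mod_two:
  assumes w: "[w = 1] (mod 2 ^ k)" and u: "odd u"
  shows "B w u = 0"
proof -
  have wo: "odd w" using coprime_cong_r[OF w] by (simp add: coprime_2_iff)
  \<comment> \<open>The multiplicity of 2 in \<open>u - 1\<close> is meaningful only if \<open>u\<close> differs from 1.\<close>
  define v where "v = (if u = 1 then u + 2 ^ Suc k else u)"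
  have vu: "[u = v] (mod 2 ^ Suc k)" by (auto simp: v_def cong_iff_dvd_diff)
  have v1: "v - 1 \<noteq> 0" by (auto simp: v_def)
  then obtain s where s: "v - 1 = 2 ^ multiplicity 2 (v - 1) * s" "odd s"
    using multiplicity_decompose'[of "v - 1" 2] by auto
  define j where "j = multiplicity 2 (v - 1)"
  have vj: "v = 1 + 2 ^ j * s" using s by (simp add: j_def)
  have "odd v" using u by (auto simp: v_def)
  then have j1: "j \<ge> 1" using vj s(2) by (cases j) auto
  obtain z where z: "[Q ^ 2 * z = 1] (mod 2 ^ Suc k)" "odd z" using inverse_Q2 .
  have 1: "[u = 1 + 2 ^ j * (Q ^ 2 * 1 * (z * s))] (mod 2 ^ Suc k)"
    by (rule cong_trans[OF vu]) (simp only: vj cong_sym[OF cong_Q2[OF z(1)]])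
  have "2 * 2 ^ k dvd 2 ^ j * (w - 1)"
    using w j1 by (intro mult_dvd_mono) (auto simp: cong_iff_dvd_diff)
  then have "[2 ^ j * w = 2 ^ j * 1] (mod 2 ^ Suc k)" by (simp add: cong_iff_dvd_diff algebra_simps)
  then have "[1 + 2 ^ j * w * (Q ^ 2 * (z * s)) = 1 + 2 ^ j * 1 * (Q ^ 2 * (z * s))] (mod 2 ^ Suc k)"
    by (rule cong_add[OF cong_refl cong_mult[OF _ cong_refl]])
  moreover have "1 + 2 ^ j * w * (Q ^ 2 * (z * s)) = 1 + 2 ^ j * (Q ^ 2 * w * (z * s))"
    "1 + 2 ^ j * 1 * (Q ^ 2 * (z * s)) = 1 + 2 ^ j * (Q ^ 2 * 1 * (z * s))"
    by (simp_all only: mult_ac)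
  ultimately have "[1 + 2 ^ j * (Q ^ 2 * w * (z * s)) = 1 + 2 ^ j * (Q ^ 2 * 1 * (z * s))] (mod 2 ^ Suc k)"
    by (simp only:)
  then have 2: "[u = 1 + 2 ^ j * (Q ^ 2 * w * (z * s))] (mod 2 ^ Suc k)"
    by (rule cong_trans[OF 1 cong_sym])
  have "nsmul j (f u) + (B (- 1) u + B Q u + B Q u + B w u + B (z * s) u) = 0"
    "nsmul j (f u) + (B (- 1) u + B Q u + B Q u + B 1 u + B (z * s) u) = 0"
    by (rule f_relation[OF j1 wo _ 2], use z(2) s(2) in simp)
       (rule f_relation[OF j1 _ _ 1], use z(2) s(2) in simp_all)
  moreover have "B 1 u = 0" using u by (intro B_1_left) (simp add: coprime_2_iff)
  ultimately show ?thesis by (metis add_left_cancel add_right_cancel)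
qed

lemma B_cong_left_two:
  assumes "odd u" "odd y" "[y = y'] (mod 2 ^ k)"
  shows "B y u = B y' u"
  using B_1_mod_two assms by (intro B_cong_leftI) (auto simp: coprime_2_iff)

text \<open>The Steinberg relation for \<open>u\<close> and \<open>1 - u = 2\<^sup>j s\<close>.\<close>

lemma f_steinberg:
  assumes j: "j \<ge> 1" and s: "odd s"
  shows "nsmul j (f (1 - 2 ^ j * s)) + B s (1 - 2 ^ j * s) = 0"
proof -
  define u where "u = 1 - 2 ^ j * s"
  have uo: "odd u" using j by (simp add: u_def)
  obtain z where z: "[Q ^ 2 * z = 1] (mod 2 ^ Suc k)" "odd z" using inverse_Q2 .
  have "[u = 1 + 2 ^ j * (Q ^ 2 * 1 * (z * (- s)))] (mod 2 ^ Suc k)"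
    using cong_Q2[OF z(1), of j "- s"] by (simp add: u_def cong_sym)
  then have "nsmul j (f u) + (B (- 1) u + B Q u + B Q u + B 1 u + B (z * (- s)) u) = 0"
    using z(2) s j by (intro f_relation) auto
  moreover have "B (- 1 * (Q * (Q * (z * (- s))))) u = B (- 1) u + B Q u + B Q u + B 1 u + B (z * (- s)) u"
    using uo z(2) s odd_Q B_1_left[of u]
    by (subst B_mult_left, simp_all add: coprime_2_iff del: mult_minus_right mult_minus_left)+
  moreover have "B (- 1 * (Q * (Q * (z * (- s))))) u = B s u"
  proof (intro B_cong_left_two)
    have "[- 1 * (Q ^ 2 * z * (- s)) = - 1 * (1 * (- s))] (mod 2 ^ Suc k)"
      by (intro cong_mult z cong_refl)
    then have "[- 1 * (Q * (Q * (z * (- s)))) = s] (mod 2 ^ Suc k)" by (simp add: power2_eq_square mult_ac)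
    then show "[- 1 * (Q * (Q * (z * (- s)))) = s] (mod 2 ^ k)" by (rule cong_dvd_modulus) simp
  qed (use uo z s odd_Q in auto)
  ultimately show ?thesis by (simp add: u_def)
qed

text \<open>All numbers are congruent modulo \<open>- 1\<close>, so the symbol vanishes there. This is where a contribution of the real place would appear.\<close>

lemma B_m1_m1: "B (- 1) (- 1) = 0"
proof -
  have "J (- 1) (- 1) = B (- 1) (- 1)" by (intro B_wd) (auto simp: coprime_2_iff)
  moreover have "J (- 1) (- 1) = J 1 (- 1)" by (intro J_cong) (auto simp: cong_iff_dvd_diff)
  ultimately show ?thesis by (simp add: J_1_left)
qed

lemma pow3_cases:
  assumes "odd (x::int)"
  obtains i where "[x = 3 ^ i] (mod 2 ^ Suc k)" | i where "[x = - (3 ^ i)] (mod 2 ^ Suc k)"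
proof -
  have "Suc k - 3 + 3 = Suc k" using k2 by simp
  then show ?thesis using odd_mod_two_power[OF assms, of "Suc k - 3"] that by metis
qed

lemma mod_8: 
  assumes "[x = y] (mod 2 ^ Suc k)"
  shows "(x::int) mod 8 = y mod 8"
proof -
  have "(2::int) ^ 3 dvd 2 ^ Suc k" using k2 by (intro le_imp_power_dvd) simp
  then have "[x = y] (mod 2 ^ 3)" by (rule cong_dvd_modulus[OF assms])
  then show ?thesis by (simp add: cong_def)
qed

lemma mod_k: "[x = y] (mod 2 ^ Suc k) \<Longrightarrow> [x = y] (mod (2::int) ^ k)"
  by (rule cong_dvd_modulus) auto

text \<open>The symbols \<open>f\<close> and \<open>B\<close> are determined by their values at the generators \<open>- 1\<close> and \<open>3\<close>. The Steinberg
relation for \<open>u = 1 - 2\<^sup>j s\<close> gives the following equations.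
\<open>u = - 1\<close> yields \<open>f (- 1) = 0\<close>, and \<open>u = 3\<close> yields \<open>f 3 + B (- 1) 3 = 0\<close>.
\<open>u = - 5\<close> yields \<open>f 3 + B 3 3 = 0\<close>, because \<open>- 5\<close> is an odd power of 3.
\<open>u = - 9\<close> yields \<open>B 3 (- 1) = 0\<close>, because \<open>- 5\<close> is an odd power of 3 and \<open>f (- 9)\<close> is twice \<open>f 3\<close>.
\<open>u = - 27\<close>, where \<open>j = 2\<close>, yields \<open>B (- 1) 3 = 0\<close>, because \<open>- 7\<close> is an even power of 3.\<close>

lemma f_B_eq_0: "f 3 = 0 \<and> B 3 3 = 0 \<and> B 3 (- 1) = 0 \<and> B (- 1) 3 = 0 \<and> f (- 1) = 0"
proof -
  define b p s t where "b = f 3" and "p = B (- 1) 3" and "s = B 3 (- 1)" and "t = B 3 3"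
  have fm1: "f (- 1) = 0"
    using f_steinberg[of 1 1] B_1_left[of "- 1"] by (simp add: coprime_2_iff)
  have pp: "p + p = 0" using B_mult_left[of "- 1" "- 1" 3] B_1_left[of 3] by (simp add: p_def coprime_2_iff)
  have ss: "s + s = 0" using B_mult_right[of 3 "- 1" "- 1"] B_1_right[of 3] by (simp add: s_def coprime_2_iff)
  have bp: "b + p = 0" using f_steinberg[of 1 "- 1"] by (simp add: b_def p_def)
  then have bp': "b = p" using pp by (metis add_right_cancel)
  have f3: "f (3 ^ i) = nsmul i b" for i by (simp add: f_power b_def)
  have B3: "B (3 ^ i) u = nsmul i (B 3 u)" if "odd u" for i u
    using that by (intro B_power_left) (auto simp: coprime_2_iff)
  have B3': "B y (3 ^ i) = nsmul i (B y 3)" if "odd y" for i y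
    using that by (intro B_power_right) (auto simp: coprime_2_iff)
  have Bm: "B y (- u) = B y (- 1) + B y u" if "odd y" "odd u" for y u
    using that B_mult_right[of y "- 1" u] by (simp add: coprime_2_iff)
  have Bm': "B (- y) u = B (- 1) u + B y u" if "odd y" "odd u" for y u
    using that B_mult_left[of "- 1" y u] by (simp add: coprime_2_iff)
  have BB: "B (- (3 ^ i)) (- (3 ^ j)) = nsmul j p + nsmul i (s + nsmul j t)" for i j
    using Bm'[of "3 ^ i" "- (3 ^ j)"] Bm[of "- 1" "3 ^ j"] Bm[of 3 "3 ^ j"] B3[of "- (3 ^ j)" i]
      B3'[of "- 1" j] B3'[of 3 j] by (simp add: B_m1_m1 p_def s_def t_def)
  have fm: "f (- u) = f u" if "odd u" for u
    using that f_mult[of "- 1" u] by (simp add: fm1)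
  \<comment> \<open>The Steinberg relation will give that an odd multiple of \<open>b + t\<close> vanishes. Some 2-power multiple
    vanishes as well, since 3 has 2-power order modulo \<open>2 ^ k\<close>.\<close>
  have t_tors: "nsmul (2 ^ Suc k) t = 0"
  proof -
    obtain c where "(3::int) ^ (2 ^ Suc k) = 1 + 2 ^ (k + 3) * c" using power_two_power_3 by blast
    then have "[(3::int) ^ (2 ^ Suc k) = 1] (mod 2 ^ k)" by (simp add: cong_iff_dvd_diff power_add)
    then have "B (3 ^ (2 ^ Suc k)) 3 = B 1 3" by (intro B_cong_left_two) auto
    then show ?thesis by (subst (asm) B3) (auto simp: t_def B_1_left coprime_2_iff)
  qed
  have "b + t = 0"
  proof -
    obtain i where i: "[- 5 = (3::int) ^ i] (mod 2 ^ Suc k)" "odd i"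
    proof (rule pow3_cases[of "- 5"])
      fix i assume "[- 5 = (3::int) ^ i] (mod 2 ^ Suc k)"
      with mod_8[OF this] that show thesis by (auto simp: power_3_mod_8 split: if_splits)
    next
      fix i assume "[- 5 = - ((3::int) ^ i)] (mod 2 ^ Suc k)"
      then have "[5 = (3::int) ^ i] (mod 2 ^ Suc k)" by (metis cong_minus_minus_iff)
      from mod_8[OF this] show thesis by (auto simp: power_3_mod_8 split: if_splits)
    qed auto
    have "f (- 5) = nsmul i b" using f_cong[OF _ i(1)] f3 by simp
    moreover have "B 3 (- 5) = nsmul i t"
      using B_cong_right[OF _ _ mod_k[OF i(1)], of 3] B3'[of 3 i] by (simp add: coprime_2_iff t_def)
    moreover have "f (- 5) + B 3 (- 5) = 0" using f_steinberg[of 1 3] by simp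
    ultimately have 1: "nsmul i (b + t) = 0" by (simp add: nsmul_plus)
    have "nsmul (2 ^ Suc k) b = 0" using pp by (subst nsmul_torsion_2) (auto simp: bp')
    then have "nsmul (2 ^ Suc k) (b + t) = 0" using t_tors by (simp add: nsmul_plus)
    moreover have "coprime i (2 ^ Suc k)" using i(2) by simp
    ultimately show "b + t = 0" using 1 nsmul_coprime_eq_0 by blast
  qed
  then have t: "t = p" using bp bp' by (metis add_left_cancel)
  have s: "s = 0"
  proof -
    obtain i where i: "[5 = - ((3::int) ^ i)] (mod 2 ^ Suc k)" "odd i"
    proof (rule pow3_cases[of 5])
      fix i assume "[5 = (3::int) ^ i] (mod 2 ^ Suc k)"
      from mod_8[OF this] show thesis by (auto simp: power_3_mod_8 split: if_splits)
    next
      fix i assume *: "[5 = - ((3::int) ^ i)] (mod 2 ^ Suc k)"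
      then have "[- 5 = (3::int) ^ i] (mod 2 ^ Suc k)" by (metis cong_minus_minus_iff minus_minus)
      from mod_8[OF this] show thesis using * that by (auto simp: power_3_mod_8 split: if_splits)
    qed auto
    have "B 5 (- 9) = B (- (3 ^ i)) (- (3 ^ 2))"
      using B_cong_left_two[OF _ _ mod_k[OF i(1)], of "- 9"] by simp
    also have "\<dots> = nsmul 2 p + nsmul i (s + nsmul 2 t)" by (rule BB)
    also have "\<dots> = s" using pp ss i(2) by (simp add: t nsmul_torsion_2)
    finally have "B 5 (- 9) = s" .
    moreover have "f (- 9) = 0" using fm[of "3 ^ 2"] f3[of 2] pp by (simp add: bp' numeral_2_eq_2)
    moreover have "f (- 9) + B 5 (- 9) = 0" using f_steinberg[of 1 5] by simp
    ultimately show "s = 0" by simp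
  qed
  have p: "p = 0"
  proof -
    obtain i where i: "[7 = - ((3::int) ^ i)] (mod 2 ^ Suc k)" "even i"
    proof (rule pow3_cases[of 7])
      fix i assume "[7 = (3::int) ^ i] (mod 2 ^ Suc k)"
      from mod_8[OF this] show thesis by (auto simp: power_3_mod_8 split: if_splits)
    next
      fix i assume *: "[7 = - ((3::int) ^ i)] (mod 2 ^ Suc k)"
      then have "[- 7 = (3::int) ^ i] (mod 2 ^ Suc k)" by (metis cong_minus_minus_iff minus_minus)
      from mod_8[OF this] show thesis using * that by (auto simp: power_3_mod_8 split: if_splits)
    qed auto
    have "B 7 (- 27) = B (- (3 ^ i)) (- (3 ^ 3))"
      using B_cong_left_two[OF _ _ mod_k[OF i(1)], of "- 27"] by simp
    also have "\<dots> = nsmul 3 p + nsmul i (s + nsmul 3 t)" by (rule BB)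
    also have "\<dots> = p" using pp ss i(2) by (simp add: t s nsmul_torsion_2)
    finally have "B 7 (- 27) = p" .
    moreover have "nsmul 2 (f (- 27)) = 0"
      using fm[of "3 ^ 3"] f3[of 3] pp by (simp add: bp' nsmul_torsion_2)
    moreover have "nsmul 2 (f (- 27)) + B 7 (- 27) = 0" using f_steinberg[of 2 7] by simp
    ultimately show "p = 0" by simp
  qed
  show ?thesis using p s t bp' fm1 by (simp add: b_def p_def s_def t_def)
qed

lemma f_eq_0:
  assumes "odd u"
  shows "f u = 0"
proof -
  have 3: "f (3 ^ i) = 0" for i using f_B_eq_0 by (simp add: f_power)
  have "f (- (3 ^ i)) = 0" for i using f_mult[of "- 1" "3 ^ i"] f_B_eq_0 3 by simp
  with 3 show ?thesis using f_cong[OF assms] by (metis pow3_cases[OF assms])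
qed

lemma B_eq_0_two:
  assumes w: "odd w" and u: "odd u"
  shows "B w u = 0"
proof -
  have 3: "B y u = 0" if "y = 3 \<or> y = - 1" for y
  proof -
    have y: "coprime 2 y" using that by (auto simp: coprime_2_iff)
    have 1: "B y (3 ^ i) = 0" for i
      using that f_B_eq_0 by (subst B_power_right) (auto simp: coprime_2_iff)
    have "B y (- 1) = 0" using that f_B_eq_0 B_m1_m1 by auto
    then have 2: "B y (- (3 ^ i)) = 0" for i
      using B_mult_right[OF y, of "- 1" "3 ^ i"] 1 by (simp add: coprime_2_iff)
    show ?thesis using u
      by (rule pow3_cases) (use 1 2 B_cong_right[OF y _ mod_k] u in \<open>simp_all add: coprime_2_iff\<close>)
  qed
  have uc: "coprime u 2" using u by (simp add: coprime_2_iff)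
  have 1: "B (3 ^ i) u = 0" for i using 3 B_power_left[of 3 u i] uc by (simp add: coprime_2_iff)
  have 2: "B (- (3 ^ i)) u = 0" for i
    using 3 1 B_mult_left[of "- 1" "3 ^ i" u] uc by (simp add: coprime_2_iff)
  show ?thesis using w
    by (rule pow3_cases) (use 1 2 B_cong_left_two[OF u w mod_k] in simp_all)
qed

lemma has_level_1: "has_level 1"
proof (rule has_level_mI)
  fix x assume x: "coprime x q"
  then show "J 2 x = 0" using f_wd[OF x cong_refl] odd_q[OF x] by (simp add: f_eq_0)
qed (simp add: B_eq_0_two coprime_2_iff)

end

context reciprocity_symbol
begin

section \<open>Reciprocity symbols vanish\<close>

lemma has_level_mono: "has_level N \<Longrightarrow> N dvd N' \<Longrightarrow> has_level N'"
  unfolding has_level_def by (meson cong_dvd_modulus dvd_refl mult_dvd_mono)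

text \<open>Odd prime factors of the level are removed one after the other.\<close>

lemma has_level_two_power:
  assumes "N > 0" "N dvd q" "has_level N"
  shows "\<exists>a. 2 ^ a dvd q \<and> has_level (2 ^ a)"
  using assms
proof (induction "nat N" arbitrary: N rule: less_induct)
  case less
  show ?case
  proof (cases "\<exists>r. prime r \<and> odd r \<and> r dvd N")
    case True
    then obtain r where r: "prime r" "odd r" "r dvd N" by blast
    have nu: "\<not> is_unit r" using r(1) not_prime_unit by blast
    have nz: "N \<noteq> 0" "q \<noteq> 0" using less.prems(1) q_pos by auto
    obtain m where m: "N = r ^ multiplicity r N * m" "\<not> r dvd m"
      by (rule multiplicity_decompose'[OF nz(1) nu])
    obtain Q where Q: "q = r ^ multiplicity r q * Q" "\<not> r dvd Q"
      by (rule multiplicity_decompose'[OF nz(2) nu])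
    have "r dvd q" using r(3) less.prems(2) by (rule dvd_trans)
    then have kK: "multiplicity r N \<ge> 1" "multiplicity r q \<ge> 1"
      using multiplicity_gt_zero_iff[OF nz(1) nu] multiplicity_gt_zero_iff[OF nz(2) nu] r(3) by simp_all
    have cop: "coprime r m" "coprime r Q" using prime_imp_coprime[OF r(1)] m(2) Q(2) by blast+
    have "m dvd N" by (subst m(1)) (rule dvd_triv_right)
    then have mq: "m dvd q" using less.prems(2) by (rule dvd_trans)
    then have "m dvd r ^ multiplicity r q * Q" by (subst Q(1)[symmetric])
    moreover have "coprime m (r ^ multiplicity r q)" using cop(1) by (simp add: coprime_commute)
    ultimately have mQ: "m dvd Q" by (simp only: coprime_dvd_mult_right_iff)
    have lev: "has_level (r ^ multiplicity r N * m)" using less.prems(3) by (subst m(1)[symmetric])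
    interpret odd_level_descent q J r Q m "multiplicity r N" "multiplicity r q"
      by unfold_locales (fact r(1) Q(1) kK cop(2) mQ lev r(2))+
    have rk: "r ^ multiplicity r N > 1" using prime_gt_1_int[OF r(1)] kK(1) by (intro one_less_power) simp_all
    have "0 < r ^ multiplicity r N * m" using less.prems(1) by (subst m(1)[symmetric])
    moreover have "0 < r ^ multiplicity r N" using rk by linarith
    ultimately have m0: "m > 0" by (rule zero_less_mult_pos)
    have "1 * m < r ^ multiplicity r N * m" using rk m0 by (rule mult_strict_right_mono)
    then have "m < N" unfolding m(1)[symmetric] mult_1 .
    then show ?thesis using less.hyps[of m] has_level_m mq m0 by simp
  next
    case False
    obtain m where m: "N = 2 ^ multiplicity 2 N * m" "odd m"
      using less.prems(1) multiplicity_decompose'[of N 2] by auto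
    have "m > 0"
      by (rule zero_less_mult_pos[of "2 ^ multiplicity 2 N"]) (use less.prems(1) in \<open>simp_all flip: m(1)\<close>)
    have "m = 1"
    proof (rule ccontr)
      assume "m \<noteq> 1"
      with \<open>m > 0\<close> obtain r where "prime r" "r dvd m" using prime_divisor_exists[of m] by auto
      moreover from \<open>r dvd m\<close> have "r dvd N" by (subst m(1)) (rule dvd_mult)
      moreover from \<open>r dvd m\<close> have "odd r" using m(2) dvd_trans by blast
      ultimately show False using False by blast
    qed
    from m(1) have N: "N = 2 ^ multiplicity 2 N" unfolding \<open>m = 1\<close> mult_1_right .
    have "2 ^ multiplicity 2 N dvd q \<and> has_level (2 ^ multiplicity 2 N)"
      using less.prems(2,3) by (simp only: N[symmetric] simp_thms)
    then show ?thesis by (rule exI)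
  qed
qed

text \<open>Once the level is a power of two, enlarging it by 4 makes the descent at two applicable, which then leads to level one
in a single step.\<close>

lemma level_1: "has_level 1"
proof -
  have "has_level q" unfolding has_level_def using J_level by blast
  then obtain a where a: "2 ^ a dvd q" "has_level (2 ^ a)" using has_level_two_power[of q] q_pos by auto
  show ?thesis
  proof (cases "a = 0")
    case False
    obtain Q where Q: "q = 2 ^ multiplicity 2 q * Q" "odd Q"
      using q_pos multiplicity_decompose'[of q 2] by auto
    have "2 dvd q" using a(1) False by (metis dvd_power dvd_trans neq0_conv)
    then have K: "multiplicity 2 q \<ge> 1" using Q by (metis One_nat_def Suc_leI mult_1 neq0_conv power_0)
    \<comment> \<open>The exponent \<open>a + 2\<close> may exceed the multiplicity of 2 in \<open>q\<close>; the descent allows this.\<close>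
    have "has_level (2 ^ (a + 2))" using a(2) by (rule has_level_mono) (simp add: power_add)
    then interpret two_level_descent q J Q "a + 2" "multiplicity 2 q"
      using Q K by unfold_locales auto
    show ?thesis by (rule has_level_1)
  qed (use a in simp)
qed

lemma J_cong_right:
  assumes "coprime x q" "coprime x' q" "coprime x y" "[x = x'] (mod y)"
  shows "J y x = J y x'"
  using assms by (intro J_dep[OF level_1]) auto

lemma J_smooth:
  assumes P: "\<And>s. prime s \<Longrightarrow> s dvd y \<Longrightarrow> J s x = 0" and x: "coprime x q" "coprime y x" and y: "y > 0"
  shows "J y x = 0"
  using y P x(2)
proof (induction "nat y" arbitrary: y rule: less_induct)
  case less
  show ?case
  proof (cases "y = 1")
    case True
    then show ?thesis using x(1) by (simp add: J_1_left)
  next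
    case False
    then obtain s where s: "prime s" "s dvd y" using less.prems(1) prime_divisor_exists[of y] by auto
    then obtain t where t: "y = s * t" by blast
    have s1: "s > 1" using s(1) by (rule prime_gt_1_int)
    have "0 < s * t" using less.prems(1) unfolding t .
    then have tp: "t > 0" by (rule zero_less_mult_pos) (use s1 in linarith)
    have ty: "t < y" using t s1 tp by simp
    have c: "coprime s x" "coprime t x" using less.prems(3) t by auto
    have "J t x = 0"
    proof (rule less.hyps)
      show "nat t < nat y" using tp ty by simp
      show "J s' x = 0" if "prime s'" "s' dvd t" for s'
        using that dvd_mult[of s' t s] unfolding t[symmetric] by (intro less.prems(2))
    qed (fact tp, fact c(2))
    moreover have "J s x = 0" using less.prems(2) s by blast
    ultimately show ?thesis using x(1) c by (simp add: t J_mult_left)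
  qed
qed

text \<open>Take for \<open>m\<close> a high power of the product of all primes below \<open>p\<close> that do not divide \<open>c\<close>. A prime \<open>s\<close> below \<open>p\<close>
divides exactly one of \<open>p m\<close> and \<open>c\<close>, and \<open>p\<close> divides only \<open>p m\<close>. For a prime \<open>s\<close> above \<open>p\<close> that divides \<open>q\<close> the exponent is
a multiple of \<open>s - 1\<close>, so that \<open>p m - c\<close> is congruent to \<open>p - c\<close>, which lies strictly between 0 and \<open>s\<close>.\<close>

lemma smooth_multiplier:
  fixes p c :: int
  assumes p: "prime p" and c: "0 < c" "c < p"
  obtains m where "m > 0" "\<And>s. prime s \<Longrightarrow> s dvd m \<Longrightarrow> s < p" "coprime m c" "coprime (p * m - c) q"
proof -
  define S where "S = {s. prime s \<and> s < p \<and> \<not> s dvd c}"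
  define E where "E = (\<Prod>s\<in>prime_factors q. nat (s - 1))"
  define m where "m = (\<Prod>s\<in>S. s) ^ E"
  have "S \<subseteq> {0..<p}" by (auto simp: S_def prime_ge_0_int)
  then have fin: "finite S" by (rule finite_subset) simp
  have E: "E > 0" unfolding E_def by (intro prod_pos) (auto simp: in_prime_factors_iff dest: prime_gt_1_int)
  have prime_m: "s \<in> S" if s: "prime s" "s dvd m" for s
  proof -
    have "s dvd (\<Prod>s\<in>S. s)" using s prime_dvd_power unfolding m_def by blast
    then obtain t where "t \<in> S" "s dvd t" using s(1) fin prime_dvd_prod_iff[of S s "\<lambda>s. s"] by auto
    then show ?thesis using s(1) by (metis S_def mem_Collect_eq primes_dvd_imp_eq)
  qed
  have m_dvd: "s dvd m" if "s \<in> S" for s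
    unfolding m_def using that fin E by (meson dvd_power dvd_prod_eqI dvd_trans dvd_prodI)
  show ?thesis
  proof
    show "m > 0" unfolding m_def by (intro zero_less_power prod_pos) (auto simp: S_def prime_gt_0_int)
    show "s < p" if "prime s" "s dvd m" for s using prime_m[OF that] by (simp add: S_def)
    show "coprime m c"
    proof (rule ccontr)
      assume "\<not> coprime m c"
      then obtain s where "prime s" "s dvd m" "s dvd c" using c(1) common_prime_divisor by blast
      then show False using prime_m by (auto simp: S_def)
    qed
    show "coprime (p * m - c) q"
    proof (rule ccontr)
      assume "\<not> coprime (p * m - c) q"
      then obtain s where s: "prime s" "s dvd p * m - c" "s dvd q"
        using q_pos common_prime_divisor by blast
      have "s < p \<or> s = p \<or> s > p" by auto
      then show False
      proof (elim disjE)
        assume sp: "s < p"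
        show False
        proof (cases "s dvd c")
          case True
          then have "s dvd p * m" using s(2) by (metis dvd_diff_commute dvd_add_right_iff diff_add_cancel add.commute)
          then have "s dvd m" using s(1) sp p by (metis less_irrefl prime_dvd_mult_iff primes_dvd_imp_eq)
          then show False using prime_m[OF s(1)] True by (simp add: S_def)
        next
          case False
          then have "s dvd p * m" using m_dvd[of s] sp s(1) by (simp add: S_def)
          then have "s dvd p * m - (p * m - c)" using s(2) by (rule dvd_diff)
          then show False using False by simp
        qed
      next
        assume "s = p"
        then have "p dvd p * m - c" using s(2) by simp
        then have "p dvd p * m - (p * m - c)" by (rule dvd_diff[OF dvd_triv_left])
        then show False using c zdvd_imp_le[of p c] by simp
      next
        assume sp: "s > p"
        define m0 where "m0 = (\<Prod>s\<in>S. s)"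
        have "\<not> s dvd m"
          using prime_m[OF s(1)] sp by (auto simp: S_def)
        then have nd: "\<not> s dvd m0" using E by (metis m_def m0_def dvd_power dvd_trans)
        have "nat (s - 1) dvd E"
          unfolding E_def using s q_pos by (intro dvd_prodI) (auto simp: in_prime_factors_iff)
        then obtain t where t: "E = nat (s - 1) * t" by blast
        have "[m0 ^ nat (s - 1) = 1] (mod s)"
        proof -
          define s' where "s' = nat s"
          have s': "s = int s'" using prime_gt_0_int[OF s(1)] by (simp add: s'_def)
          have ps: "prime s'" using s(1) by (simp add: s')
          define w where "w = nat (m0 mod s)"
          have w: "int w = m0 mod s" using prime_gt_0_int[OF s(1)] by (simp add: w_def)
          then have wm: "[int w = m0] (mod s)" by simp
          have "\<not> s' dvd w" using nd w by (metis s' int_dvd_int_iff dvd_mod_iff dvd_refl)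
          then have "[w ^ (s' - 1) = 1] (mod s')" using ps fermat_theorem by blast
          then have "[int w ^ nat (s - 1) = 1] (mod s)"
            unfolding s' by (simp add: nat_diff_distrib' flip: cong_int_iff)
          then show ?thesis using cong_pow[OF wm, of "nat (s - 1)"] by (metis cong_sym cong_trans)
        qed
        then have "[m = 1] (mod s)"
          unfolding m_def m0_def[symmetric] t power_mult by (metis cong_pow power_one)
        then have "[p * m - c = p * 1 - c] (mod s)" by (intro cong_diff cong_mult cong_refl)
        then have "s dvd p - c" using s(2) by (simp add: cong_dvd_iff)
        then show False using zdvd_imp_le[of s "p - c"] c sp by simp
      qed
    qed
  qed
qed

text \<open>Induction on \<open>p\<close>. At level one \<open>x\<close> may be replaced by any \<open>y = p m - c\<close> in its class modulo \<open>p\<close>. Modulo \<open>y\<close> the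
product \<open>p m\<close> is \<open>c\<close>, and \<open>m\<close> and \<open>c\<close> have prime factors below \<open>p\<close> only.\<close>

lemma J_prime:
  assumes "prime p" "coprime x q" "coprime p x"
  shows "J p x = 0"
  using assms
proof (induction "nat p" arbitrary: p x rule: less_induct)
  case less
  define c where "c = (- x) mod p"
  have p1: "p > 1" using less.prems(1) by (rule prime_gt_1_int)
  have "\<not> p dvd x" using less.prems(1,3) p1 by (auto simp: coprime_absorb_left)
  then have "c \<noteq> 0" by (simp add: c_def flip: dvd_eq_mod_eq_0)
  moreover have "0 \<le> c" "c < p" unfolding c_def using p1 by simp_all
  ultimately have c: "0 < c" "c < p" by simp_all
  obtain m where m: "m > 0" "\<And>s. prime s \<Longrightarrow> s dvd m \<Longrightarrow> s < p" "coprime m c" "coprime (p * m - c) q"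
    using smooth_multiplier[OF less.prems(1) c] by blast
  define y where "y = p * m - c"
  have yq: "coprime y q" using m(4) by (simp add: y_def)
  have "[- c = x] (mod p)" by (simp add: c_def cong_def mod_minus_eq)
  then have "p dvd (- c - x) + p * m" by (simp add: cong_iff_dvd_diff)
  then have "p dvd - ((- c - x) + p * m)" by (simp only: dvd_minus_iff)
  moreover have "- ((- c - x) + p * m) = x - y" by (simp add: y_def)
  ultimately have xy: "[x = y] (mod p)" by (simp only: cong_iff_dvd_diff)
  then have py: "coprime p y" using less.prems(3) by (metis cong_imp_coprime coprime_commute)
  have "coprime p c" using less.prems(1) c zdvd_imp_le[of p c] by (intro prime_imp_coprime) auto
  then have cpm: "coprime c (p * m)" using m(3) by (simp add: coprime_commute)
  have cy: "coprime c y"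
  proof -
    have "[p * m = y] (mod c)" by (simp add: y_def cong_iff_dvd_diff)
    then show ?thesis using cpm by (metis cong_imp_coprime coprime_commute)
  qed
  have my: "coprime m y"
  proof -
    have "[y = - c] (mod m)" by (simp add: y_def cong_iff_dvd_diff)
    then show ?thesis using m(3) by (metis cong_imp_coprime cong_sym coprime_commute coprime_minus_left_iff)
  qed
  have IH: "J s y = 0" if "prime s" "s dvd z" "z = m \<or> z = c" for s z
  proof -
    have "s < p"
      using that(3)
    proof
      assume "z = m"
      then show ?thesis using m(2) that by blast
    next
      assume "z = c"
      then have "s \<le> c" using that(2) c(1) by (intro zdvd_imp_le) simp_all
      then show ?thesis using c(2) by simp
    qed
    moreover have "coprime s y" using that my cy by (metis coprime_divisors dvd_refl)
    ultimately show ?thesis using p1 that(1) yq by (intro less.hyps) auto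
  qed
  have "J m y = 0" by (rule J_smooth[OF _ yq my m(1)]) (rule IH[where z = m], simp_all)
  moreover have "J c y = 0" by (rule J_smooth[OF _ yq cy c(1)]) (rule IH[where z = c], simp_all)
  moreover have "J (p * m) y = J c y"
    using yq py my by (intro J_cong) (auto simp: y_def cong_iff_dvd_diff)
  ultimately have "J p y = 0" using yq py my by (simp add: J_mult_left)
  moreover have "J p x = J p y" using less.prems yq xy by (intro J_cong_right) (auto simp: coprime_commute)
  ultimately show ?case by simp
qed

text \<open>It remains to move \<open>y\<close> to a positive representative modulo \<open>x\<close>.\<close>

theorem J_eq_0:
  assumes x: "coprime x q" "coprime y x"
  shows "J y x = 0"
proof -
  define t where "t = 1 + \<bar>y\<bar>"
  have "x \<noteq> 0 \<or> y \<noteq> 0" using x by auto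
  show ?thesis
  proof (cases "x = 0")
    \<comment> \<open>The modulus 0 is prime to \<open>q\<close> only if \<open>q = 1\<close>.\<close>
    case True
    then have "q = 1" using x(1) q_pos by simp
    have "y = 1 \<or> y = - 1" using True x(2) by auto
    then show ?thesis using J_level[of 0 y] \<open>q = 1\<close> True by (auto simp: cong_iff_dvd_diff)
  next
    case False
    define z where "z = y + \<bar>x\<bar> * t"
    have "\<bar>x\<bar> * t \<ge> 1 * t" using False by (intro mult_right_mono) (auto simp: t_def)
    then have "z > 0" by (simp add: z_def t_def)
    have yz: "[y = z] (mod x)" by (simp add: z_def cong_iff_dvd_diff)
    then have "coprime z x" using x(2) by (rule cong_imp_coprime)
    have "J z x = 0"
    proof (rule J_smooth)
      show "J s x = 0" if "prime s" "s dvd z" for s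
        using that(1) x(1) coprime_divisors[OF that(2) dvd_refl \<open>coprime z x\<close>] by (rule J_prime)
    qed fact+
    then show ?thesis using J_cong[OF x yz] by simp
  qed
qed

end

section \<open>Mennicke symbols vanish\<close>

text \<open>Here \<open>F c a\<close> stands for the Mennicke symbol of the row \<open>(a, q c)\<close>. The two invariance properties are those under
elementary column operations.\<close>

locale mennicke_symbol =
  fixes q :: int and F :: "int \<Rightarrow> int \<Rightarrow> 'v::ab_group_add"
  assumes q_pos: "q > 0"
    and F_left: "\<And>a c t. [a = 1] (mod q) \<Longrightarrow> coprime c a \<Longrightarrow> F (c + t * a) a = F c a"
    and F_right: "\<And>a c t. [a = 1] (mod q) \<Longrightarrow> coprime c a \<Longrightarrow> F c (a + t * (q * c)) = F c a"
    and F_mult: "\<And>a c c'. [a = 1] (mod q) \<Longrightarrow> coprime c a \<Longrightarrow> coprime c' a \<Longrightarrow>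
      F (c * c') a = F c a + F c' a"
begin

lemma F_left_cong:
  assumes "[a = 1] (mod q)" "coprime c a" "[c = c'] (mod a)"
  shows "F c a = F c' a"
proof -
  obtain k where "c' = c + a * k" using assms(3) by (metis cong_iff_lin)
  then show ?thesis using F_left[OF assms(1,2), of k] by (simp add: mult.commute)
qed

lemma F_right_cong:
  assumes "[a = 1] (mod q)" "coprime c a" "[a = a'] (mod q * c)"
  shows "F c a = F c a'"
proof -
  obtain k where "a' = a + (q * c) * k" using assms(3) by (metis cong_iff_lin)
  then show ?thesis using F_right[OF assms(1,2), of k] by (simp add: mult.commute)
qed

lemma F_1_left: "[a = 1] (mod q) \<Longrightarrow> F 1 a = 0"
  using F_mult[of a 1 1] by simp

lemma F_1_right: "F c 1 = 0"
  using F_left_cong[of 1 c 1] F_1_left[of 1] by simp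

lemma F_congruent_1: "[a = 1] (mod q * c) \<Longrightarrow> F c a = 0"
  using F_right_cong[of 1 c a] by (simp add: F_1_right cong_sym)

lemma F_m1: "[a = 1] (mod q) \<Longrightarrow> F (- 1) a = 0"
  by (intro F_congruent_1) (simp add: cong_iff_dvd_diff)

lemma coprime_level:
  assumes "[a = 1] (mod q)" shows "coprime q a"
  using assms by (metis cong_imp_coprime cong_sym coprime_1_left coprime_commute)

lemma F_level: 
  assumes a: "[a = 1] (mod q)"
  shows "F q a = 0"
proof -
  obtain k where k: "a - 1 = q * k" using a by (metis cong_iff_dvd_diff dvdE)
  have ck: "coprime k a"
  proof -
    have "[a = 1] (mod k)" using k by (simp add: cong_iff_dvd_diff)
    then show ?thesis by (metis cong_imp_coprime cong_sym coprime_1_left coprime_commute)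
  qed
  have "F (q * k) a = F (- 1) a"
    using coprime_level[OF a] ck by (intro F_left_cong a) (auto simp: cong_iff_dvd_diff simp flip: k)
  moreover have "F k a = 0" using k by (intro F_congruent_1) (simp add: cong_iff_dvd_diff)
  ultimately show ?thesis using F_mult[OF a coprime_level[OF a] ck] F_m1[OF a] by simp
qed

text \<open>Write \<open>a - c = q k\<close>. Then \<open>c\<close> is \<open>- q k\<close> modulo \<open>a\<close>, and \<open>a\<close> is \<open>q k\<close> modulo \<open>c\<close>, while \<open>a\<close> and \<open>c\<close> agree modulo \<open>q k\<close>. The factors
\<open>- 1\<close> and \<open>q\<close> have trivial symbol.\<close>

lemma F_reciprocity:
  assumes a: "[a = 1] (mod q)" and c: "[c = 1] (mod q)" and ac: "coprime a c"
  shows "F c a = F a c"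
proof -
  have "[a = c] (mod q)" using a c by (metis cong_sym cong_trans)
  then obtain k where k: "a - c = q * k" by (metis cong_iff_dvd_diff dvdE)
  have kac: "coprime k a" "coprime k c"
  proof -
    have *: "[a = c] (mod k)" using k by (simp add: cong_iff_dvd_diff)
    have "gcd k a dvd c" using * by (metis cong_dvd_iff cong_dvd_modulus gcd_dvd1 gcd_dvd2)
    then have "is_unit (gcd k a)" using ac by (metis coprime_common_divisor gcd_dvd2)
    then show "coprime k a" by (simp add: coprime_iff_gcd_eq_1)
    have "gcd k c dvd a" using * by (metis cong_dvd_iff cong_dvd_modulus gcd_dvd1 gcd_dvd2)
    then have "is_unit (gcd k c)" using ac by (metis coprime_common_divisor gcd_dvd2)
    then show "coprime k c" by (simp add: coprime_iff_gcd_eq_1)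
  qed
  have "F c a = F (- 1 * (q * k)) a"
    using ac by (intro F_left_cong a) (auto simp: coprime_commute cong_iff_dvd_diff simp flip: k)
  also have "\<dots> = F k a"
    using coprime_level[OF a] kac F_mult[OF a, of "- 1" "q * k"] F_mult[OF a, of q k]
    by (simp add: F_m1 F_level a)
  also have "\<dots> = F k c" using kac k by (intro F_right_cong a) (auto simp: cong_iff_dvd_diff)
  also have "\<dots> = F (q * k) c" using coprime_level[OF c] kac F_mult[OF c, of q k] by (simp add: F_level c)
  also have "\<dots> = F a c"
  proof (rule F_left_cong[OF c])
    show "coprime (q * k) c" using kac coprime_level[OF c] by simp
    show "[q * k = a] (mod c)" by (simp add: cong_iff_dvd_diff flip: k)
  qed
  finally show ?thesis .
qed

text \<open>Multiplicativity in \<open>c\<close>, carried over by reciprocity; for this \<open>c\<close> is first made congruent to 1 modulo \<open>q\<close>.\<close>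

lemma F_mult_right:
  assumes a: "[a = 1] (mod q)" and b: "[b = 1] (mod q)" and c: "coprime c a" "coprime c b"
  shows "F c (a * b) = F c a + F c b"
proof -
  have ab: "[a * b = 1] (mod q)" using cong_mult[OF a b] by simp
  obtain d where d: "[d = c] (mod a * b)" "[d = 1] (mod q)"
    using binary_chinese_remainder_int[of "a * b" q] coprime_level[OF ab] by (auto simp: coprime_commute)
  have da: "[d = c] (mod a)" "[d = c] (mod b)" using d(1) by (auto intro: cong_dvd_modulus)
  have cd: "coprime d a" "coprime d b"
    using da c by (metis cong_imp_coprime cong_sym)+
  have "F c (a * b) = F d (a * b)" using c d(1) by (intro F_left_cong ab) (auto simp: cong_sym)
  also have "\<dots> = F (a * b) d" using cd by (intro F_reciprocity ab d) (auto simp: coprime_commute)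
  also have "\<dots> = F a d + F b d" using cd by (intro F_mult d) (auto simp: coprime_commute)
  also have "\<dots> = F d a + F d b" using cd a b d by (simp add: F_reciprocity coprime_commute)
  also have "\<dots> = F c a + F c b" using cd da a b by (simp add: F_left_cong[of _ d c])
  finally show ?thesis .
qed

text \<open>The roles of the arguments are exchanged: \<open>x\<close> need only be prime to \<open>q\<close>, and \<open>y\<close> is moved within its class modulo
\<open>x\<close> to some \<open>a\<close> that is 1 modulo \<open>q\<close>. For \<open>x\<close> that is 1 modulo \<open>q\<close> nothing changes, by reciprocity (\<open>J_eq_F\<close>).\<close>

definition J :: "int \<Rightarrow> int \<Rightarrow> 'v" where
  "J y x = F x (SOME a. [a = y] (mod x) \<and> [a = 1] (mod q))"

lemma J_wd:
  assumes x: "coprime x q" "coprime y x" and a: "[a = y] (mod x)" "[a = 1] (mod q)"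
  shows "J y x = F x a"
proof -
  let ?P = "\<lambda>a. [a = y] (mod x) \<and> [a = 1] (mod q)"
  define b where "b = (SOME a. ?P a)"
  have "\<exists>a. ?P a" using binary_chinese_remainder_int[OF x(1)] .
  then have b: "?P b" unfolding b_def by (rule someI_ex)
  have "[b = a] (mod x)" "[b = a] (mod q)" using a b by (metis cong_sym cong_trans)+
  then have "[b = a] (mod q * x)" using x(1) by (intro coprime_cong_mult) (auto simp: coprime_commute)
  moreover have "coprime x b" using b x(2) by (metis cong_imp_coprime cong_sym coprime_commute)
  ultimately show ?thesis unfolding J_def b_def[symmetric] using b by (intro F_right_cong) auto
qed

lemma J_rep:
  assumes "coprime x q" "coprime y x"
  obtains a where "[a = y] (mod x)" "[a = 1] (mod q)" "coprime x a" "J y x = F x a"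
proof -
  obtain a where a: "[a = y] (mod x)" "[a = 1] (mod q)"
    using binary_chinese_remainder_int[OF assms(1)] by blast
  moreover have "coprime x a" using a assms(2) by (metis cong_imp_coprime cong_sym coprime_commute)
  ultimately show ?thesis using that J_wd[OF assms a] by blast
qed

lemma J_eq_F:
  assumes x: "[x = 1] (mod q)" "coprime y x"
  shows "J y x = F y x"
proof -
  have xq: "coprime x q" using coprime_level[OF x(1)] by (simp add: coprime_commute)
  obtain a where a: "[a = y] (mod x)" "[a = 1] (mod q)" "coprime x a" "J y x = F x a" using J_rep[OF xq x(2)] .
  have "F x a = F a x" using a x by (intro F_reciprocity) (auto simp: coprime_commute)
  also have "\<dots> = F y x" using a x by (intro F_left_cong) (auto simp: coprime_commute)
  finally show ?thesis using a(4) by simp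
qed

sublocale reciprocity_symbol q J
proof
  show "q > 0" by (rule q_pos)
next
  fix x y y' assume x: "coprime x q" "coprime y x" "[y = y'] (mod x)"
  obtain a where a: "[a = y] (mod x)" "[a = 1] (mod q)" "J y x = F x a" using J_rep[OF x(1,2)] by blast
  have "coprime y' x" using x by (metis cong_imp_coprime)
  moreover have "[a = y'] (mod x)" using a(1) x(3) by (rule cong_trans)
  ultimately show "J y x = J y' x" using J_wd[OF x(1)] a by simp
next
  fix x y y' assume x: "coprime x q" "coprime y x" "coprime y' x"
  obtain a where a: "[a = y] (mod x)" "[a = 1] (mod q)" "coprime x a" "J y x = F x a" using J_rep[OF x(1,2)] .
  obtain b where b: "[b = y'] (mod x)" "[b = 1] (mod q)" "coprime x b" "J y' x = F x b" using J_rep[OF x(1,3)] .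
  have "[a * b = y * y'] (mod x)" "[a * b = 1] (mod q)"
    using cong_mult[OF a(1) b(1)] cong_mult[OF a(2) b(2)] by auto
  then have "J (y * y') x = F x (a * b)" using x by (intro J_wd) auto
  then show "J (y * y') x = J y x + J y' x" using F_mult_right[OF a(2) b(2) a(3) b(3)] a(4) b(4) by simp
next
  fix x x' y assume x: "coprime x q" "coprime x' q" "coprime y x" "coprime y x'"
  obtain a where a: "[a = y] (mod x * x')" "[a = 1] (mod q)" "coprime (x * x') a" "J y (x * x') = F (x * x') a"
    using J_rep[of "x * x'" y] x by auto
  have "[a = y] (mod x)" "[a = y] (mod x')" using a(1) by (auto intro: cong_dvd_modulus)
  then have "J y x = F x a" "J y x' = F x' a" using a x by (auto intro: J_wd)
  then show "J y (x * x') = J y x + J y x'" using a F_mult[OF a(2), of x x'] by simp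
next
  fix x y assume x: "[x = 1] (mod q * y)"
  have 1: "[x = 1] (mod q)" using x by (rule cong_modulus_mult)
  have "[x = 1] (mod y)" using x by (rule cong_dvd_modulus) simp
  then have "coprime y x" by (metis cong_imp_coprime cong_sym coprime_1_left coprime_commute)
  then show "J y x = 0" using 1 x by (simp add: J_eq_F F_congruent_1)
qed

theorem F_eq_0:
  assumes "[a = 1] (mod q)" "coprime c a"
  shows "F c a = 0"
  using J_eq_F[OF assms] J_eq_0[of a c] coprime_level[OF assms(1)] assms(2) by (simp add: coprime_commute)

end

section \<open>Transvections and Koszul relations\<close>

lemma carrier_SL: "A \<in> carrier (SL n) \<longleftrightarrow> A \<in> carrier_mat n n \<and> det A = 1"
  by (auto simp: SL_def)

lemma mult_SL [simp]: "A \<otimes>\<^bsub>SL n\<^esub> B = A * B"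
  by (simp add: SL_def)

lemma one_SL [simp]: "\<one>\<^bsub>SL n\<^esub> = 1\<^sub>m n"
  by (simp add: SL_def)

definition dot :: "nat \<Rightarrow> (nat \<Rightarrow> int) \<Rightarrow> (nat \<Rightarrow> int) \<Rightarrow> int" where
  "dot n w v = (\<Sum>k<n. w k * v k)"

definition unit_fun :: "nat \<Rightarrow> nat \<Rightarrow> int" where
  "unit_fun i k = (if k = i then 1 else 0)"

text \<open>The matrix \<open>I + v w\<^sup>T\<close>. It is a transvection, and has determinant one, if \<open>w \<bullet> v = 0\<close>.\<close>

definition transv :: "nat \<Rightarrow> (nat \<Rightarrow> int) \<Rightarrow> (nat \<Rightarrow> int) \<Rightarrow> int mat" where
  "transv n v w = mat n n (\<lambda>(i, j). (if i = j then 1 else 0) + v i * w j)"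

lemma transv_carrier [simp]: "transv n v w \<in> carrier_mat n n"
  and transv_dim [simp]: "dim_row (transv n v w) = n" "dim_col (transv n v w) = n"
  by (auto simp: transv_def)

lemma transv_index: "i < n \<Longrightarrow> j < n \<Longrightarrow> transv n v w $$ (i, j) = (if i = j then 1 else 0) + v i * w j"
  by (simp add: transv_def)

lemma transv_cong:
  assumes "\<And>i j. i < n \<Longrightarrow> j < n \<Longrightarrow> v i * w j = v' i * w' j"
  shows "transv n v w = transv n v' w'"
  using assms by (intro eq_matI) (auto simp: transv_index)

lemma dot_unit_fun [simp]: "u < n \<Longrightarrow> dot n (unit_fun u) v = v u" "u < n \<Longrightarrow> dot n v (unit_fun u) = v u"
  by (auto simp: dot_def unit_fun_def if_distrib if_distribR cong: if_cong)

lemma dot_linear: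
  "dot n (\<lambda>k. w k + w' k) v = dot n w v + dot n w' v"
  "dot n w (\<lambda>k. v k + v' k) = dot n w v + dot n w v'"
  "dot n (\<lambda>k. c * w k) v = c * dot n w v"
  "dot n w (\<lambda>k. c * v k) = c * dot n w v"
  "dot n w (\<lambda>k. - v k) = - dot n w v"
  "dot n w (\<lambda>k. v k - v' k) = dot n w v - dot n w v'"
  by (auto simp: dot_def algebra_simps sum.distrib sum_distrib_left sum_negf sum_subtractf)

lemma mat_mult_index:
  fixes A B :: "int mat"
  assumes "A \<in> carrier_mat n n" "B \<in> carrier_mat n n" "i < n" "j < n"
  shows "(A * B) $$ (i, j) = (\<Sum>k<n. A $$ (i, k) * B $$ (k, j))"
  using assms by (auto simp: scalar_prod_def lessThan_atLeast0 intro!: sum.cong)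

lemma transv_mult_index:
  assumes "X \<in> carrier_mat n n" "i < n" "j < n"
  shows "(transv n v w * X) $$ (i, j) = X $$ (i, j) + v i * dot n w (\<lambda>k. X $$ (k, j))"
proof -
  have "(transv n v w * X) $$ (i, j) = (\<Sum>k<n. (if i = k then X $$ (k, j) else 0) + v i * (w k * X $$ (k, j)))"
    using assms by (subst mat_mult_index) (auto simp: transv_index algebra_simps intro!: sum.cong)
  also have "\<dots> = X $$ (i, j) + v i * dot n w (\<lambda>k. X $$ (k, j))"
    using assms by (simp add: sum.distrib dot_def sum_distrib_left)
  finally show ?thesis .
qed

lemma mult_transv_index:
  assumes "X \<in> carrier_mat n n" "i < n" "j < n"
  shows "(X * transv n v w) $$ (i, j) = X $$ (i, j) + dot n (\<lambda>k. X $$ (i, k)) v * w j"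
proof -
  have "(X * transv n v w) $$ (i, j) = (\<Sum>k<n. (if k = j then X $$ (i, k) else 0) + X $$ (i, k) * v k * w j)"
    using assms by (subst mat_mult_index) (auto simp: transv_index algebra_simps intro!: sum.cong)
  also have "\<dots> = X $$ (i, j) + dot n (\<lambda>k. X $$ (i, k)) v * w j"
    using assms by (simp add: sum.distrib dot_def sum_distrib_right)
  finally show ?thesis .
qed

lemma dot_transv:
  assumes "j < n"
  shows "dot n w (\<lambda>k. transv n v w' $$ (k, j)) = w j + dot n w v * w' j"
proof -
  have "dot n w (\<lambda>k. transv n v w' $$ (k, j)) = (\<Sum>k<n. (if k = j then w k else 0) + w k * v k * w' j)"
    using assms unfolding dot_def by (intro sum.cong) (auto simp: transv_index algebra_simps)
  also have "\<dots> = w j + dot n w v * w' j"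
    using assms by (simp add: sum.distrib dot_def sum_distrib_right)
  finally show ?thesis .
qed

lemma transv_add_left:
  assumes "dot n w v' = 0"
  shows "transv n v w * transv n v' w = transv n (\<lambda>k. v k + v' k) w"
  using assms by (intro eq_matI) (auto simp: transv_mult_index dot_transv transv_index algebra_simps simp del: index_mult_mat(1))

lemma transv_add_right:
  assumes "dot n w v = 0"
  shows "transv n v w * transv n v w' = transv n v (\<lambda>k. w k + w' k)"
  using assms by (intro eq_matI) (auto simp: transv_mult_index dot_transv transv_index algebra_simps simp del: index_mult_mat(1))

lemma transv_0: "(\<And>k. k < n \<Longrightarrow> v k = 0) \<Longrightarrow> transv n v w = 1\<^sub>m n"
  by (intro eq_matI) (auto simp: transv_index)

lemma commutator_eqI:
  fixes A B A' B' T :: "int mat"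
  assumes c: "A \<in> carrier_mat n n" "B \<in> carrier_mat n n" "A' \<in> carrier_mat n n" "B' \<in> carrier_mat n n"
      "T \<in> carrier_mat n n"
    and eq: "A * B = T * (B * A)" "A * A' = 1\<^sub>m n" "B * B' = 1\<^sub>m n"
  shows "A * B * A' * B' = T"
proof -
  have "T * (B * A) * A' * B' = T * (B * (A * A')) * B'"
    using c by (simp add: assoc_mult_mat[of _ n n _ n _ n])
  also have "\<dots> = T * (B * B')" using c by (simp add: eq assoc_mult_mat[of _ n n _ n _ n])
  also have "\<dots> = T" using c by (simp add: eq)
  finally show ?thesis by (simp add: eq)
qed

text \<open>The index \<open>u\<close>, at which both vectors vanish, supplies a spare coordinate through which \<open>v w\<^sup>T\<close> factors.\<close>

lemma transv_commutator:
  assumes u: "u < n" "v u = 0" "w u = 0" and wv: "dot n w v = 0"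
  shows "transv n v (unit_fun u) * transv n (\<lambda>k. c * unit_fun u k) w * transv n (\<lambda>k. - v k) (unit_fun u) * transv n (\<lambda>k. - c * unit_fun u k) w
    = transv n (\<lambda>k. c * v k) w"
proof -
  let ?A = "transv n v (unit_fun u)" and ?B = "transv n (\<lambda>k. c * unit_fun u k) w"
  let ?A' = "transv n (\<lambda>k. - v k) (unit_fun u)" and ?B' = "transv n (\<lambda>k. - c * unit_fun u k) w"
  let ?T = "transv n (\<lambda>k. c * v k) w"
  have 0: "dot n (unit_fun u) v = 0" "dot n w (\<lambda>k. c * unit_fun u k) = 0"
    using u by (simp_all add: dot_linear)
  have "?A * ?B = ?T * (?B * ?A)"
  proof (rule eq_matI)
    fix i j assume ij: "i < dim_row (?T * (?B * ?A))" "j < dim_col (?T * (?B * ?A))"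
    then have ij: "i < n" "j < n" by auto
    have BA: "(?B * ?A) $$ (k, j) = transv n v (unit_fun u) $$ (k, j) + c * unit_fun u k * w j" if "k < n" for k
      using that ij wv by (simp add: transv_mult_index dot_transv del: index_mult_mat(1))
    have "dot n w (\<lambda>k. (?B * ?A) $$ (k, j)) = dot n w (\<lambda>k. transv n v (unit_fun u) $$ (k, j) + w j * (c * unit_fun u k))"
      unfolding dot_def by (intro sum.cong) (auto simp: BA simp del: index_mult_mat(1))
    also have "\<dots> = w j" using ij wv u by (simp add: dot_linear dot_transv)
    finally have 1: "dot n w (\<lambda>k. (?B * ?A) $$ (k, j)) = w j" .
    have "(?T * (?B * ?A)) $$ (i, j) = (?B * ?A) $$ (i, j) + c * v i * w j"
      using ij by (subst transv_mult_index) (auto simp: 1 simp del: index_mult_mat(1))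
    also have "\<dots> = (?A * ?B) $$ (i, j)"
      unfolding BA[OF ij(1)] using ij u
      by (subst transv_mult_index) (auto simp: dot_transv transv_index dot_linear algebra_simps unit_fun_def simp del: index_mult_mat(1))
    finally show "(?A * ?B) $$ (i, j) = (?T * (?B * ?A)) $$ (i, j)" by simp
  qed auto
  moreover have "?A * ?A' = 1\<^sub>m n" "?B * ?B' = 1\<^sub>m n"
  proof -
    show "?A * ?A' = 1\<^sub>m n" using 0 u by (subst transv_add_left) (auto simp: dot_linear intro: transv_0)
    show "?B * ?B' = 1\<^sub>m n" using 0 u by (subst transv_add_left) (auto simp: dot_linear algebra_simps intro: transv_0)
  qed
  ultimately show ?thesis by (intro commutator_eqI[of _ n]) simp_all
qed

text \<open>The elementary matrix with entry \<open>t\<close> at the position \<open>(i, j)\<close>.\<close>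

abbreviation elmat :: "nat \<Rightarrow> nat \<Rightarrow> nat \<Rightarrow> int \<Rightarrow> int mat" where
  "elmat n i j t \<equiv> transv n (\<lambda>k. t * unit_fun i k) (unit_fun j)"

lemma elmat_addrow: "i < n \<Longrightarrow> j < n \<Longrightarrow> i \<noteq> j \<Longrightarrow> elmat n i j t = addrow_mat n t i j"
  by (rule eq_matI) (auto simp: transv_index unit_fun_def addrow_mat_def)

lemma elmat_SL: "i < n \<Longrightarrow> j < n \<Longrightarrow> i \<noteq> j \<Longrightarrow> elmat n i j t \<in> carrier (SL n)"
  by (simp add: carrier_SL elmat_addrow det_addrow_mat)

lemma bezout_fun:
  fixes n :: nat
  shows "\<exists>g u. (\<forall>k<n. g dvd w k) \<and> (\<Sum>k<n. u k * w k) = (g::int)"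
proof (induction n)
  case (Suc n)
  then obtain g u where g: "\<forall>k<n. g dvd w k" "(\<Sum>k<n. u k * w k) = g" by blast
  obtain a b where ab: "a * g + b * w n = gcd g (w n)" using bezout_int by blast
  have "(\<Sum>k<Suc n. (if k = n then b else a * u k) * w k) = (\<Sum>k<n. a * (u k * w k)) + b * w n"
    by (simp add: mult.assoc)
  also have "\<dots> = gcd g (w n)" using g(2) ab by (simp flip: sum_distrib_left)
  finally have "(\<Sum>k<Suc n. (if k = n then b else a * u k) * w k) = gcd g (w n)" .
  moreover have "\<forall>k<Suc n. gcd g (w n) dvd w k" using g(1) by (auto simp: less_Suc_eq intro: dvd_trans[OF gcd_dvd1])
  ultimately show ?case by (intro exI[of _ "gcd g (w n)"] exI[of _ "\<lambda>k. if k = n then b else a * u k"]) simp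
qed (auto intro: exI[of _ 0])

text \<open>A subgroup that contains the elementary matrices of level \<open>d\<close>. In general it is not normal and does not
contain all transvections of level \<open>d\<close>; those of level \<open>d\<^sup>2\<close> will turn out to belong to it.\<close>

locale elementary_subgroup =
  fixes n :: nat and K :: "int mat set" and d :: int
  assumes n: "n \<ge> 3" and K: "subgroup K (SL n)"
    and elmat_K: "\<And>i j t. i < n \<Longrightarrow> j < n \<Longrightarrow> i \<noteq> j \<Longrightarrow> d dvd t \<Longrightarrow> elmat n i j t \<in> K"
begin

lemma mult_K: "A \<in> K \<Longrightarrow> B \<in> K \<Longrightarrow> A * B \<in> K"
  using subgroup.m_closed[OF K] by simp

lemma one_K: "1\<^sub>m n \<in> K"
  using subgroup.one_closed[OF K] by simp

lemma column_K:
  assumes u: "u < n" "v u = 0" and d: "\<And>k. k < n \<Longrightarrow> d dvd v k"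
  shows "transv n v (unit_fun u) \<in> K"
proof -
  have "transv n (\<lambda>k. if k < m then v k else 0) (unit_fun u) \<in> K" if "m \<le> n" for m
    using that
  proof (induction m)
    case 0
    show ?case using one_K by (simp add: transv_0)
  next
    case (Suc m)
    have e: "transv n (\<lambda>k. v m * unit_fun m k) (unit_fun u) \<in> K"
      using elmat_K[of m u "v m"] Suc.prems u d one_K by (cases "m = u") (auto simp: transv_0)
    have "transv n (\<lambda>k. if k < m then v k else 0) (unit_fun u) * transv n (\<lambda>k. v m * unit_fun m k) (unit_fun u)
      = transv n (\<lambda>k. if k < Suc m then v k else 0) (unit_fun u)"
      using u by (subst transv_add_left) (auto simp: unit_fun_def less_Suc_eq intro!: transv_cong)
    then show ?case using mult_K[OF Suc.IH e] Suc.prems by simp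
  qed
  from this[of n] have "transv n (\<lambda>k. if k < n then v k else 0) (unit_fun u) \<in> K" by simp
  also have "transv n (\<lambda>k. if k < n then v k else 0) (unit_fun u) = transv n v (unit_fun u)" by (rule transv_cong) auto
  finally show ?thesis .
qed

lemma row_K:
  assumes u: "u < n" "w u = 0" and d: "d dvd t"
  shows "transv n (\<lambda>k. t * unit_fun u k) w \<in> K"
proof -
  have "transv n (\<lambda>k. t * unit_fun u k) (\<lambda>k. if k < m then w k else 0) \<in> K" if "m \<le> n" for m
    using that
  proof (induction m)
    case 0
    have "transv n (\<lambda>k. t * unit_fun u k) (\<lambda>k. 0) = transv n (\<lambda>k. 0) (\<lambda>k. 0)" by (rule transv_cong) auto
    then show ?case using one_K by (simp add: transv_0)
  next
    case (Suc m)
    have e: "transv n (\<lambda>k. t * unit_fun u k) (\<lambda>k. w m * unit_fun m k) \<in> K"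
    proof (cases "m = u")
      case True
      have "transv n (\<lambda>k. t * unit_fun u k) (\<lambda>k. w m * unit_fun m k) = transv n (\<lambda>k. 0) (\<lambda>k. 0)"
        using True u by (intro transv_cong) auto
      then show ?thesis using one_K by (simp add: transv_0)
    next
      case False
      have "transv n (\<lambda>k. t * unit_fun u k) (\<lambda>k. w m * unit_fun m k) = elmat n u m (t * w m)" by (rule transv_cong) auto
      then show ?thesis using elmat_K[of u m "t * w m"] Suc.prems u d False by simp
    qed
    have "dot n (\<lambda>k. if k < m then w k else 0) (\<lambda>k. t * unit_fun u k) = 0"
      using u by (simp add: dot_linear)
    then have "transv n (\<lambda>k. t * unit_fun u k) (\<lambda>k. if k < m then w k else 0) * transv n (\<lambda>k. t * unit_fun u k) (\<lambda>k. w m * unit_fun m k)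
      = transv n (\<lambda>k. t * unit_fun u k) (\<lambda>k. if k < Suc m then w k else 0)"
      by (subst transv_add_right) (auto simp: unit_fun_def less_Suc_eq intro!: transv_cong)
    then show ?case using mult_K[OF Suc.IH e] Suc.prems by simp
  qed
  from this[of n] have "transv n (\<lambda>k. t * unit_fun u k) (\<lambda>k. if k < n then w k else 0) \<in> K" by simp
  also have "transv n (\<lambda>k. t * unit_fun u k) (\<lambda>k. if k < n then w k else 0) = transv n (\<lambda>k. t * unit_fun u k) w"
    by (rule transv_cong) auto
  finally show ?thesis .
qed

text \<open>Split \<open>w\<close> into its part \<open>w1\<close> at the positions \<open>i\<close> and \<open>j\<close> and the rest \<open>w2\<close>. For \<open>w2\<close> the matrix is a product of two
matrices that differ from \<open>I\<close> in one row. For \<open>w1\<close> it is a commutator of matrices of level \<open>d\<close> that involve a third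
index \<open>u\<close>; this accounts for \<open>d\<^sup>2\<close>.\<close>

lemma koszul_K:
  assumes ij: "i < n" "j < n"
  shows "transv n (\<lambda>k. d ^ 2 * (c * (w j * unit_fun i k - w i * unit_fun j k))) w \<in> K"
proof (cases "i = j")
  case True
  then show ?thesis using one_K by (simp add: transv_0)
next
  case False
  define v where "v k = c * (w j * unit_fun i k - w i * unit_fun j k)" for k
  define w1 where "w1 k = (if k = i \<or> k = j then w k else 0)" for k
  define w2 where "w2 k = (if k = i \<or> k = j then 0 else w k)" for k
  let ?V = "\<lambda>k. d ^ 2 * v k"
  have w1v: "dot n w1 v = 0"
    unfolding v_def using ij by (simp add: dot_linear w1_def)
  have w2v: "transv n ?V w2 \<in> K"
  proof -
    have "transv n (\<lambda>k. (d ^ 2 * c * w j) * unit_fun i k) w2 * transv n (\<lambda>k. (- (d ^ 2) * c * w i) * unit_fun j k) w2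
      = transv n ?V w2"
    proof (subst transv_add_left)
      show "dot n w2 (\<lambda>k. (- (d ^ 2) * c * w i) * unit_fun j k) = 0"
        using ij by (simp only: dot_linear dot_unit_fun) (simp add: w2_def)
    qed (auto simp: v_def algebra_simps intro!: transv_cong)
    moreover have "transv n (\<lambda>k. (d ^ 2 * c * w j) * unit_fun i k) w2 \<in> K" "transv n (\<lambda>k. (- (d ^ 2) * c * w i) * unit_fun j k) w2 \<in> K"
      using ij row_K[of i w2 "d ^ 2 * c * w j"] row_K[of j w2 "- (d ^ 2) * c * w i"]
      by (simp_all add: w2_def power2_eq_square)
    ultimately show ?thesis using mult_K by metis
  qed
  have w1K: "transv n ?V w1 \<in> K"
  proof -
    obtain u where u: "u < n" "u \<noteq> i" "u \<noteq> j"
    proof -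
      have "card {i, j} < card {..<n}" using n card_insert_le_m1[of 2 "{j}" i] by simp
      then have "\<not> {..<n} \<subseteq> {i, j}" using card_mono[of "{i, j}" "{..<n}"] by auto
      then show ?thesis using that by auto
    qed
    have "transv n (\<lambda>k. d * v k) (unit_fun u) \<in> K" "transv n (\<lambda>k. - (d * v k)) (unit_fun u) \<in> K"
      using u by (auto intro!: column_K simp: v_def unit_fun_def)
    moreover have "transv n (\<lambda>k. d * unit_fun u k) w1 \<in> K" "transv n (\<lambda>k. - d * unit_fun u k) w1 \<in> K"
      using u by (auto intro!: row_K simp: w1_def simp del: mult_minus_left)
    moreover have "transv n (\<lambda>k. d * (d * v k)) w1 =
      transv n (\<lambda>k. d * v k) (unit_fun u) * transv n (\<lambda>k. d * unit_fun u k) w1 * transv n (\<lambda>k. - (d * v k)) (unit_fun u) * transv n (\<lambda>k. - d * unit_fun u k) w1"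
    proof (rule transv_commutator[symmetric])
      show "d * v u = 0" using u by (simp add: v_def unit_fun_def)
      show "w1 u = 0" using u by (simp add: w1_def)
      show "dot n w1 (\<lambda>k. d * v k) = 0" using w1v by (simp add: dot_linear)
    qed (fact u)
    ultimately have "transv n (\<lambda>k. d * (d * v k)) w1 \<in> K" by (simp add: mult_K)
    then show ?thesis by (simp add: power2_eq_square mult.assoc)
  qed
  have "transv n ?V w1 * transv n ?V w2 = transv n ?V (\<lambda>k. w1 k + w2 k)"
    using w1v by (intro transv_add_right) (simp add: dot_linear)
  also have "(\<lambda>k. w1 k + w2 k) = w" by (auto simp: w1_def w2_def)
  finally show ?thesis using mult_K[OF w1K w2v] by (simp add: v_def)
qed

lemma transv_sum_K:
  assumes "finite S" and f: "\<And>x. x \<in> S \<Longrightarrow> transv n (f x) w \<in> K \<and> dot n w (f x) = 0"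
  shows "transv n (\<lambda>k. \<Sum>x\<in>S. f x k) w \<in> K"
  using assms
proof (induction S)
  case empty
  then show ?case using one_K by (simp add: transv_0)
next
  case (insert x S)
  have "dot n w (\<lambda>k. \<Sum>x\<in>S. f x k) = (\<Sum>x\<in>S. dot n w (f x))"
    unfolding dot_def by (subst sum.swap) (simp add: sum_distrib_left)
  then have "dot n w (\<lambda>k. \<Sum>x\<in>S. f x k) = 0" using insert.prems by simp
  then have "transv n (f x) w * transv n (\<lambda>k. \<Sum>x\<in>S. f x k) w = transv n (\<lambda>k. \<Sum>x\<in>insert x S. f x k) w"
    using insert.hyps by (subst transv_add_left) auto
  then show ?case using insert mult_K by (metis insertI1 insertI2)
qed

text \<open>After division by the gcd the vector \<open>w\<close> is unimodular, say \<open>u \<bullet> w = 1\<close>. Then a vector \<open>x\<close> orthogonal to \<open>w\<close> equals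
the sum of \<open>u\<^sub>j x\<^sub>i (w\<^sub>j e\<^sub>i - w\<^sub>i e\<^sub>j)\<close> over all \<open>i\<close> and \<open>j\<close>, so \<open>koszul_K\<close> applies.\<close>

theorem transvection_K:
  assumes wv: "dot n w v = 0" and d: "\<And>k. k < n \<Longrightarrow> d ^ 2 dvd v k"
  shows "transv n v w \<in> K"
proof -
  obtain g u where g: "\<forall>k<n. g dvd w k" "(\<Sum>k<n. u k * w k) = g" using bezout_fun by blast
  show ?thesis
  proof (cases "g = 0")
    case True
    then have "transv n v w = transv n (\<lambda>k. 0) w" using g(1) by (intro transv_cong) auto
    then show ?thesis using one_K by (simp add: transv_0)
  next
    case False
    define w' where "w' k = w k div g" for k
    define x where "x k = g * (v k div d ^ 2)" for k
    have w': "w k = g * w' k" if "k < n" for k using g(1) that by (simp add: w'_def)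
    have v: "g * v k = d ^ 2 * x k" if "k < n" for k using d[OF that] by (simp add: x_def)
    have "g * dot n u w' = dot n u w"
      unfolding dot_linear(4)[symmetric] unfolding dot_def by (intro sum.cong) (auto simp: w')
    then have uw: "dot n u w' = 1" using g(2) False by (simp add: dot_def)
    have "d ^ 2 * dot n w' x = dot n w' (\<lambda>k. g * v k)"
      unfolding dot_linear(4)[symmetric] unfolding dot_def by (intro sum.cong) (auto simp: v)
    also have "\<dots> = dot n (\<lambda>k. g * w' k) v" by (simp add: dot_linear)
    also have "\<dots> = dot n w v" unfolding dot_def by (intro sum.cong) (auto simp: w')
    finally have dx: "d ^ 2 * dot n w' x = 0" using wv by simp
    have eq: "transv n v w = transv n (\<lambda>k. d ^ 2 * x k) w'"
      by (rule transv_cong) (simp add: w' flip: v)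
    show ?thesis
    proof (cases "d = 0")
      case True
      then show ?thesis unfolding eq using one_K by (simp add: transv_0)
    next
      case False
      then have wx: "dot n w' x = 0" using dx by simp
      \<comment> \<open>The coefficients \<open>u\<^sub>j x\<^sub>i\<close> reproduce \<open>x\<close>: summing over \<open>j\<close> gives \<open>(u \<bullet> w') x - (w' \<bullet> x) u = x\<close>.\<close>
      let ?f = "\<lambda>(i, j) k. d ^ 2 * ((u j * x i) * (w' j * unit_fun i k - w' i * unit_fun j k))"
      let ?S = "{..<n} \<times> {..<n}"
      have "transv n (\<lambda>k. \<Sum>p\<in>?S. ?f p k) w' \<in> K"
      proof (rule transv_sum_K)
        fix p assume "p \<in> ?S"
        then obtain i j where p: "p = (i, j)" "i < n" "j < n" by auto
        have "dot n w' (\<lambda>k. d ^ 2 * ((u j * x i) * (w' j * unit_fun i k - w' i * unit_fun j k))) = 0"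
          using p by (simp add: dot_linear)
        then show "transv n (?f p) w' \<in> K \<and> dot n w' (?f p) = 0"
          using koszul_K[of i j "u j * x i" w'] p by simp
      qed auto
      also have "transv n (\<lambda>k. \<Sum>p\<in>?S. ?f p k) w' = transv n (\<lambda>k. d ^ 2 * x k) w'"
      proof (rule transv_cong)
        fix k j' assume k: "k < n"
        have "(\<Sum>p\<in>?S. ?f p k) = (\<Sum>i<n. \<Sum>j<n. d ^ 2 * ((u j * x i) * (w' j * unit_fun i k - w' i * unit_fun j k)))"
          by (simp add: sum.cartesian_product case_prod_unfold)
        also have "\<dots> = d ^ 2 * ((\<Sum>i<n. x i * unit_fun i k * dot n u w') - (\<Sum>i<n. w' i * x i * dot n u (\<lambda>j. unit_fun j k)))"
          by (simp add: dot_def algebra_simps sum_distrib_left sum_subtractf)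
        also have "dot n u (\<lambda>j. unit_fun j k) = u k"
          using k by (simp add: dot_def unit_fun_def if_distrib cong: if_cong)
        also have "(\<Sum>i<n. x i * unit_fun i k * dot n u w') = x k"
        proof -
          have "(\<Sum>i<n. x i * unit_fun i k * dot n u w') = (\<Sum>i<n. if k = i then x i else 0)"
            by (intro sum.cong) (auto simp: uw unit_fun_def)
          then show ?thesis using k by simp
        qed
        also have "(\<Sum>i<n. w' i * x i * u k) = 0"
          using wx by (simp add: dot_def flip: sum_distrib_right)
        finally show "(\<Sum>p\<in>?S. ?f p k) * w' j' = d ^ 2 * x k * w' j'" by simp
      qed
      finally show ?thesis unfolding eq .
    qed
  qed
qed

end

text \<open>The transvection theorem for the full group and \<open>d = 1\<close> saves a determinant computation.\<close>

lemma transv_SL: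
  assumes "n \<ge> 3" "dot n w v = 0"
  shows "transv n v w \<in> carrier (SL n)"
proof -
  interpret elementary_subgroup n "carrier (SL n)" 1
    using assms(1) group.subgroup_self[OF group_SL] by (intro elementary_subgroup.intro) (auto simp: elmat_SL)
  show ?thesis using assms(2) by (intro transvection_K) auto
qed

section \<open>Reducing congruence subgroups modulo transvections\<close>

lemma Gamma_iff:
  "X \<in> Gamma q n \<longleftrightarrow> X \<in> carrier (SL n) \<and>
    (\<forall>i<n. \<forall>j<n. [X $$ (i, j) = (if i = j then 1 else 0)] (mod int q))"
  by (auto simp: Gamma_def)

lemma Gamma_subgroup: "subgroup (Gamma q n) (SL n)"
proof (rule group.subgroupI[OF group_SL])
  show "Gamma q n \<subseteq> carrier (SL n)" by (auto simp: Gamma_iff)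
  have "1\<^sub>m n \<in> Gamma q n" by (auto simp: Gamma_iff carrier_SL)
  then show "Gamma q n \<noteq> {}" by blast
  have mult_cong: "[(X * Y) $$ (i, j) = Y $$ (i, j)] (mod int q)"
    if X: "X \<in> Gamma q n" and Y: "Y \<in> carrier_mat n n" and ij: "i < n" "j < n" for X Y i j
  proof -
    have "[(\<Sum>k<n. X $$ (i, k) * Y $$ (k, j)) = (\<Sum>k<n. (if i = k then 1 else 0) * Y $$ (k, j))] (mod int q)"
      using X ij by (intro cong_sum cong_mult cong_refl) (auto simp: Gamma_iff)
    also have "(\<Sum>k<n. (if i = k then 1 else 0) * Y $$ (k, j)) = (\<Sum>k<n. if i = k then Y $$ (k, j) else 0)"
      by (intro sum.cong) auto
    also have "\<dots> = Y $$ (i, j)" using ij by simp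
    finally show ?thesis using X Y ij by (subst mat_mult_index[of _ n]) (auto simp: Gamma_iff carrier_SL)
  qed
  fix X assume X: "X \<in> Gamma q n"
  then have Xc: "X \<in> carrier (SL n)" by (simp add: Gamma_iff)
  show "inv\<^bsub>SL n\<^esub> X \<in> Gamma q n"
  proof -
    have Yc: "inv\<^bsub>SL n\<^esub> X \<in> carrier (SL n)" using group.inv_closed[OF group_SL Xc] .
    have XY: "X * inv\<^bsub>SL n\<^esub> X = 1\<^sub>m n" using group.r_inv[OF group_SL Xc] by simp
    have "[(inv\<^bsub>SL n\<^esub> X) $$ (i, j) = (if i = j then 1 else 0)] (mod int q)" if "i < n" "j < n" for i j
      using mult_cong[OF X _ that, of "inv\<^bsub>SL n\<^esub> X"] Yc that by (simp add: XY carrier_SL cong_sym)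
    then show ?thesis using Yc by (simp add: Gamma_iff)
  qed
  fix Y assume Y: "Y \<in> Gamma q n"
  then have Yc: "Y \<in> carrier (SL n)" by (simp add: Gamma_iff)
  have XY: "X \<otimes>\<^bsub>SL n\<^esub> Y \<in> carrier (SL n)"
    using Xc Yc monoid.m_closed[OF group.is_monoid[OF group_SL]] by blast
  have "[(X * Y) $$ (i, j) = (if i = j then 1 else 0)] (mod int q)" if "i < n" "j < n" for i j
  proof (rule cong_trans)
    show "[(X * Y) $$ (i, j) = Y $$ (i, j)] (mod int q)"
      using Yc that by (intro mult_cong X) (auto simp: carrier_SL)
    show "[Y $$ (i, j) = (if i = j then 1 else 0)] (mod int q)" using Y that by (simp add: Gamma_iff)
  qed
  then show "X \<otimes>\<^bsub>SL n\<^esub> Y \<in> Gamma q n" using XY by (auto simp: Gamma_iff)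
qed

lemma transv_conj:
  assumes g: "g \<in> carrier_mat n n" "g' \<in> carrier_mat n n" "g * g' = 1\<^sub>m n"
  shows "g * transv n v w * g' = transv n (\<lambda>i. dot n (\<lambda>k. g $$ (i, k)) v) (\<lambda>j. dot n w (\<lambda>k. g' $$ (k, j)))"
proof (rule eq_matI)
  let ?T = "transv n (\<lambda>i. dot n (\<lambda>k. g $$ (i, k)) v) (\<lambda>j. dot n w (\<lambda>k. g' $$ (k, j)))"
  fix i j assume "i < dim_row ?T" "j < dim_col ?T"
  then have ij: "i < n" "j < n" by auto
  have "(g * transv n v w * g') $$ (i, j) = (g * (transv n v w * g')) $$ (i, j)"
    using g by (simp add: assoc_mult_mat[of _ n n _ n _ n])
  also have "\<dots> = (\<Sum>k<n. g $$ (i, k) * (transv n v w * g') $$ (k, j))"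
    using ij g by (intro mat_mult_index) auto
  also have "\<dots> = (\<Sum>k<n. g $$ (i, k) * g' $$ (k, j) + g $$ (i, k) * v k * dot n w (\<lambda>k. g' $$ (k, j)))"
    using ij g by (intro sum.cong) (auto simp: transv_mult_index algebra_simps simp del: index_mult_mat(1))
  also have "\<dots> = (g * g') $$ (i, j) + dot n (\<lambda>k. g $$ (i, k)) v * dot n w (\<lambda>k. g' $$ (k, j))"
    using ij g by (subst mat_mult_index[of _ n]) (auto simp: sum.distrib dot_def[of n "\<lambda>k. g $$ (i, k)"] sum_distrib_right)
  finally show "(g * transv n v w * g') $$ (i, j) = ?T $$ (i, j)"
    using ij g(3) by (simp add: transv_index)
qed (use g in auto)

lemma dot_conj:
  assumes g: "g \<in> carrier_mat n n" "g' \<in> carrier_mat n n" "g' * g = 1\<^sub>m n"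
  shows "dot n (\<lambda>j. dot n w (\<lambda>k. g' $$ (k, j))) (\<lambda>i. dot n (\<lambda>k. g $$ (i, k)) v) = dot n w v"
proof -
  have "dot n (\<lambda>j. dot n w (\<lambda>k. g' $$ (k, j))) (\<lambda>i. dot n (\<lambda>k. g $$ (i, k)) v)
    = (\<Sum>j<n. \<Sum>k<n. \<Sum>l<n. w k * v l * (g' $$ (k, j) * g $$ (j, l)))"
    unfolding dot_def sum_product by (intro sum.cong refl) (simp add: mult_ac)
  also have "\<dots> = (\<Sum>k<n. \<Sum>j<n. \<Sum>l<n. w k * v l * (g' $$ (k, j) * g $$ (j, l)))" by (rule sum.swap)
  also have "\<dots> = (\<Sum>k<n. \<Sum>l<n. \<Sum>j<n. w k * v l * (g' $$ (k, j) * g $$ (j, l)))"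
    by (rule sum.cong[OF refl sum.swap])
  also have "\<dots> = (\<Sum>k<n. \<Sum>l<n. w k * v l * (g' * g) $$ (k, l))"
    using g(1,2) by (intro sum.cong refl) (simp add: mat_mult_index sum_distrib_left del: index_mult_mat(1))
  also have "\<dots> = (\<Sum>k<n. \<Sum>l<n. if k = l then w k * v l else 0)"
    by (intro sum.cong refl) (auto simp: g(3))
  also have "\<dots> = dot n w v" by (simp add: dot_def)
  finally show ?thesis .
qed

definition transvections :: "nat \<Rightarrow> nat \<Rightarrow> int mat set" where
  "transvections q n = {transv n v w | v w. dot n w v = 0 \<and> (\<forall>k<n. int q dvd v k)}"

text \<open>The transvections of level \<open>q\<close> are stable under conjugation, so the group that they generate is normal. It
is the normal closure of the elementary matrices of level \<open>q\<close>.\<close>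

definition transv_subgroup :: "nat \<Rightarrow> nat \<Rightarrow> int mat set" where
  "transv_subgroup q n = generate (SL n) (transvections q n)"

text \<open>Let \<open>t\<close> be the product of the primes that divide \<open>g\<close> but not \<open>x\<close>. Every prime factor of \<open>g\<close> then divides exactly one of \<open>x\<close> and \<open>t a\<close>.\<close>

lemma coprime_shift:
  fixes x a g :: int
  assumes g: "g \<noteq> 0" and cop: "\<And>p. prime p \<Longrightarrow> p dvd x \<Longrightarrow> p dvd a \<Longrightarrow> p dvd g \<Longrightarrow> False"
  shows "\<exists>t. coprime (x + t * a) g"
proof -
  define S where "S = {p \<in> prime_factors g. \<not> p dvd x}"
  have fin: "finite S" by (simp add: S_def)
  define t where "t = \<Prod>S"
  have "coprime (x + t * a) g"
  proof (rule ccontr)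
    assume "\<not> coprime (x + t * a) g"
    then obtain p where p: "prime p" "p dvd x + t * a" "p dvd g" using g common_prime_divisor by blast
    show False
    proof (cases "p dvd x")
      case True
      then have "p dvd t * a" using p(2) by (simp add: dvd_add_right_iff)
      then consider "p dvd a" | "p dvd t" using p(1) by (auto simp: prime_dvd_mult_iff)
      then show False
      proof cases
        case 2
        then obtain s where "s \<in> S" "p dvd s"
          using p(1) fin prime_dvd_prod_iff[of S p "\<lambda>s. s"] by (auto simp: t_def)
        then have "p = s" using p(1) by (auto simp: S_def in_prime_factors_iff intro: primes_dvd_imp_eq)
        then show False using \<open>s \<in> S\<close> True by (simp add: S_def)
      qed (use cop p True in blast)
    next
      case False
      then have "p \<in> S" using p g by (simp add: S_def in_prime_factors_iff)
      then have "p dvd t" using fin by (auto simp: t_def intro: dvd_prodI)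
      then show False using False p(2) by (simp add: dvd_add_left_iff)
    qed
  qed
  then show ?thesis ..
qed

text \<open>The stable range condition for the integers. Only one of the entries has to be changed, namely so that it becomes
prime to the gcd of the others; if these are all zero, one of them is replaced by \<open>a\<close>.\<close>

lemma unimodular_shift:
  fixes y z :: "nat \<Rightarrow> int"
  assumes c: "c \<ge> 2" and uni: "(\<Sum>i<c. z i * y i) + b * a = 1"
  shows "\<exists>s u. (\<Sum>i<c. u i * (y i + s i * a)) = 1"
proof -
  obtain m where m: "c = Suc (Suc m)" using c by (metis add_2_eq_Suc le_Suc_ex)
  obtain g u where g: "\<forall>k<Suc m. g dvd y (Suc k)" "(\<Sum>k<Suc m. u k * y (Suc k)) = g"
    using bezout_fun[of "Suc m" "\<lambda>k. y (Suc k)"] by blast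
  have split: "(\<Sum>i<c. f i) = f 0 + (\<Sum>k<Suc m. f (Suc k))" for f :: "nat \<Rightarrow> int"
    unfolding m by (rule sum.lessThan_Suc_shift)
  have cop: False if p: "prime p" "p dvd y 0" "p dvd a" "p dvd g" for p
  proof -
    have "p dvd (\<Sum>i<c. z i * y i)"
      using p g(1) unfolding split by (intro dvd_add dvd_mult dvd_sum) (auto intro: dvd_trans)
    then have "p dvd (\<Sum>i<c. z i * y i) + b * a" using p(3) by simp
    then have "is_unit p" unfolding uni .
    then show False using p(1) not_prime_unit by blast
  qed
  show ?thesis
  proof (cases "g = 0")
    case False
    have "\<exists>t. coprime (y 0 + t * a) g" by (rule coprime_shift[OF False]) (rule cop)
    then obtain t where "coprime (y 0 + t * a) g" ..
    then obtain e f where ef: "e * (y 0 + t * a) + f * g = 1"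
      using bezout_int[of "y 0 + t * a" g] by (auto simp: coprime_iff_gcd_eq_1)
    let ?s = "\<lambda>i. if i = 0 then t else 0" and ?u = "\<lambda>i. case i of 0 \<Rightarrow> e | Suc k \<Rightarrow> f * u k"
    have "(\<Sum>i<c. ?u i * (y i + ?s i * a)) = e * (y 0 + t * a) + (\<Sum>k<Suc m. f * (u k * y (Suc k)))"
      unfolding split by (simp add: mult.assoc)
    also have "\<dots> = 1" using ef g(2) by (simp flip: sum_distrib_left)
    finally show ?thesis by (intro exI[of _ ?s] exI[of _ ?u])
  next
    case True
    have "coprime (y 0) a"
    proof (rule ccontr)
      assume "\<not> coprime (y 0) a"
      then have nu: "\<not> is_unit (gcd (y 0) a)" by (simp add: coprime_iff_gcd_eq_1)
      show False
      proof (cases "gcd (y 0) a = 0")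
        case True
        then have "y 0 = 0" "a = 0" by auto
        then show False using cop[of 2] \<open>g = 0\<close> by simp
      next
        case False
        then obtain p where "prime p" "p dvd gcd (y 0) a" using prime_divisor_exists nu by blast
        then show False using cop[of p] True by simp
      qed
    qed
    then obtain e f where ef: "e * y 0 + f * a = 1"
      using bezout_int[of "y 0" a] by (auto simp: coprime_iff_gcd_eq_1)
    have y0: "y (Suc k) = 0" if "k < Suc m" for k using g(1) True that by simp
    let ?s = "\<lambda>i. if i = 1 then 1 else 0" and ?u = "\<lambda>i. if i = 0 then e else if i = 1 then f else 0"
    have "(\<Sum>i<c. ?u i * (y i + ?s i * a)) = e * y 0 + (\<Sum>k<Suc m. if k = 0 then f * a else 0)"
      unfolding split by (intro arg_cong2[of _ _ _ _ "(+)"] sum.cong refl) (auto simp: y0)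
    also have "\<dots> = 1" using ef by simp
    finally show ?thesis by (intro exI[of _ ?s] exI[of _ ?u])
  qed
qed

locale congruence_quotient =
  fixes n q :: nat
  assumes n: "n \<ge> 3" and q: "q \<ge> 1"
begin

abbreviation "G \<equiv> SL n"
abbreviation "N \<equiv> transv_subgroup q n"

sublocale SL: group G by (rule group_SL)

lemma SL_mat [simp]: "A \<in> carrier G \<Longrightarrow> A \<in> carrier_mat n n"
  by (simp add: carrier_SL)

lemma SL_mult [intro]: "A \<in> carrier G \<Longrightarrow> B \<in> carrier G \<Longrightarrow> A * B \<in> carrier G"
  using SL.m_closed by simp

lemma transvections_SL: "transvections q n \<subseteq> carrier G"
  using transv_SL[OF n] by (auto simp: transvections_def)

lemma N_normal: "N \<lhd> G"
  unfolding transv_subgroup_def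
proof (rule SL.normal_generateI[OF transvections_SL])
  fix h g assume h: "h \<in> transvections q n" and g: "g \<in> carrier G"
  then obtain v w where vw: "h = transv n v w" "dot n w v = 0" "\<forall>k<n. int q dvd v k"
    by (auto simp: transvections_def)
  let ?g = "inv\<^bsub>G\<^esub> g"
  have gi: "?g \<in> carrier G" "g * ?g = 1\<^sub>m n" "?g * g = 1\<^sub>m n"
    using g SL.r_inv[OF g] SL.l_inv[OF g] by auto
  have "g * transv n v w * ?g = transv n (\<lambda>i. dot n (\<lambda>k. g $$ (i, k)) v) (\<lambda>j. dot n w (\<lambda>k. ?g $$ (k, j)))"
    using g gi by (intro transv_conj) auto
  moreover have "\<forall>i<n. int q dvd dot n (\<lambda>k. g $$ (i, k)) v"
    using vw(3) by (auto simp: dot_def intro!: dvd_sum)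
  ultimately show "g \<otimes>\<^bsub>G\<^esub> h \<otimes>\<^bsub>G\<^esub> ?g \<in> transvections q n"
    using dot_conj[of g n ?g w v] g gi vw by (auto simp: transvections_def)
qed

sublocale N: normal N G by (rule N_normal)

definition Q :: "int mat set monoid" where "Q = G Mod N"

sublocale Q: group Q unfolding Q_def by (rule N.factorgroup_is_group)

definition proj :: "int mat \<Rightarrow> int mat set" where "proj X = N #>\<^bsub>G\<^esub> X"

lemma proj_hom: "proj \<in> hom G Q"
  using N.r_coset_hom_Mod by (simp add: proj_def[abs_def] Q_def)

lemma proj_closed [simp]: "X \<in> carrier G \<Longrightarrow> proj X \<in> carrier Q"
  using proj_hom by (auto simp: hom_def)

lemma proj_mult: "X \<in> carrier G \<Longrightarrow> Y \<in> carrier G \<Longrightarrow> proj (X * Y) = proj X \<otimes>\<^bsub>Q\<^esub> proj Y"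
  using proj_hom by (auto simp: hom_def)

lemma N_SL: "A \<in> N \<Longrightarrow> A \<in> carrier G"
  using N.subset by blast

lemma one_Q: "\<one>\<^bsub>Q\<^esub> = N"
  by (simp add: Q_def FactGroup_def)

lemma proj_one_iff: "X \<in> carrier G \<Longrightarrow> proj X = \<one>\<^bsub>Q\<^esub> \<longleftrightarrow> X \<in> N"
  unfolding proj_def one_Q using SL.coset_join1 SL.coset_join2 N.subgroup_axioms N.subset by blast

lemma proj_N: "A \<in> N \<Longrightarrow> proj A = \<one>\<^bsub>Q\<^esub>"
  using proj_one_iff N_SL by blast

lemma transv_N: "dot n w v = 0 \<Longrightarrow> (\<And>k. k < n \<Longrightarrow> int q dvd v k) \<Longrightarrow> transv n v w \<in> N"
  unfolding transv_subgroup_def by (intro generate.incl) (auto simp: transvections_def)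

lemma elmat_N: "i < n \<Longrightarrow> j < n \<Longrightarrow> i \<noteq> j \<Longrightarrow> int q dvd t \<Longrightarrow> elmat n i j t \<in> N"
  by (intro transv_N) (auto simp: dot_linear, auto simp: unit_fun_def)

lemma proj_mult_N: "A \<in> N \<Longrightarrow> X \<in> carrier G \<Longrightarrow> proj (A * X) = proj X" "A \<in> N \<Longrightarrow> X \<in> carrier G \<Longrightarrow> proj (X * A) = proj X"
  by (simp_all add: proj_mult N_SL proj_N Q.l_one Q.r_one)

lemma N_Gamma: "N \<subseteq> Gamma q n"
  unfolding transv_subgroup_def
proof (rule SL.generate_subgroup_incl[OF _ Gamma_subgroup])
  show "transvections q n \<subseteq> Gamma q n"
    using transv_SL[OF n] by (auto simp: transvections_def Gamma_iff transv_index cong_iff_dvd_diff)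
qed

lemma Gamma_SL: "X \<in> Gamma q n \<Longrightarrow> X \<in> carrier G"
  by (simp add: Gamma_iff)

lemma Gamma_mult: "X \<in> Gamma q n \<Longrightarrow> Y \<in> Gamma q n \<Longrightarrow> X * Y \<in> Gamma q n"
  using subgroup.m_closed[OF Gamma_subgroup] by simp

text \<open>The matrix is a block of size \<open>m\<close>, extended by the identity.\<close>

definition trivial_from :: "nat \<Rightarrow> int mat \<Rightarrow> bool" where
  "trivial_from m X \<longleftrightarrow> (\<forall>i<n. \<forall>j<n. i \<ge> m \<or> j \<ge> m \<longrightarrow> X $$ (i, j) = (if i = j then 1 else 0))"

lemma unimodular_column:
  assumes X: "X \<in> carrier G" and c: "c < n"
  obtains z where "(\<Sum>k<n. z k * X $$ (k, c)) = 1"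
proof -
  let ?Y = "inv\<^bsub>G\<^esub> X"
  have Y: "?Y \<in> carrier G" "?Y * X = 1\<^sub>m n" using X SL.l_inv[OF X] by auto
  have "(\<Sum>k<n. ?Y $$ (c, k) * X $$ (k, c)) = (?Y * X) $$ (c, c)"
    using X Y c by (subst mat_mult_index[of _ n]) auto
  then show ?thesis using Y c by (intro that[of "\<lambda>k. ?Y $$ (c, k)"]) simp
qed

text \<open>The last nontrivial column \<open>c\<close> is cleared by factors from \<open>N\<close>. Column \<open>c\<close> has entries \<open>q y\<^sub>k\<close> above the diagonal entry
\<open>a = 1 + q y\<^sub>c\<close>. First \<open>A\<close> makes the entries \<open>y\<^sub>k\<close> above the diagonal unimodular, with \<open>\<Sum> u\<^sub>k y\<^sub>k = 1\<close>. This provides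
a vector \<open>w\<close> whose product with the column is 1 and which is orthogonal to \<open>v\<close>, where \<open>q v\<close> is the unit vector minus the
column; so one transvection \<open>B\<close> finishes the column. Then \<open>C\<close> clears the row.\<close>

lemma reduce_step:
  assumes X: "X \<in> Gamma q n" and m: "2 \<le> c" "Suc c \<le> n" and triv: "trivial_from (Suc c) X"
  shows "\<exists>Y \<in> Gamma q n. proj Y = proj X \<and> trivial_from c Y"
proof -
  have c: "c < n" using m by simp
  have q0: "int q > 0" using q by simp
  define x where "x k = X $$ (k, c)" for k
  define y where "y k = (x k - unit_fun c k) div int q" for k
  have dvd: "int q dvd x k - unit_fun c k" if "k < n" for k
    using X c that by (auto simp: Gamma_iff x_def unit_fun_def cong_iff_dvd_diff)
  have xy: "x k = unit_fun c k + int q * y k" if "k < n" for k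
    using dvd[OF that] by (simp add: y_def)
  have x0: "x k = 0" if "k < n" "k > c" for k
    using triv c that by (auto simp: trivial_from_def x_def)
  define a where "a = x c"
  obtain z where "(\<Sum>k<n. z k * x k) = 1"
    using unimodular_column[OF Gamma_SL[OF X] c] by (auto simp: x_def)
  also have "(\<Sum>k<n. z k * x k) = (\<Sum>k<Suc c. z k * x k)"
    using m x0 by (intro sum.mono_neutral_right) auto
  also have "\<dots> = (\<Sum>k<c. (z k * int q) * y k) + z c * a"
    using c by (auto simp: xy a_def unit_fun_def mult.assoc)
  finally obtain s u where su: "(\<Sum>k<c. u k * (y k + s k * a)) = 1"
    using unimodular_shift[OF m(1), of "\<lambda>k. z k * int q" y "z c" a] by blast
  define y' where "y' k = y k + s k * a" for k
  define A where "A = transv n (\<lambda>k. if k < c then int q * s k else 0) (unit_fun c)"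
  have A: "A \<in> N" unfolding A_def using c by (intro transv_N) auto
  define X1 where "X1 = A * X"
  have X1_index: "X1 $$ (i, j) = X $$ (i, j) + (if i < c then int q * s i * X $$ (c, j) else 0)"
    if "i < n" "j < n" for i j
    using that c Gamma_SL[OF X] unfolding X1_def A_def by (subst transv_mult_index) auto
  have X1: "X1 \<in> Gamma q n" unfolding X1_def using A N_Gamma X by (auto intro: Gamma_mult)
  have X1_col: "X1 $$ (k, c) = (if k < c then int q * y' k else if k = c then a else 0)" if "k < n" for k
    using that c x0[of k] xy[of k] unfolding X1_index[OF that c] x_def[symmetric] a_def[symmetric]
    by (auto simp: y'_def a_def unit_fun_def algebra_simps)
  have triv1: "trivial_from (Suc c) X1"
    using triv c by (auto simp: trivial_from_def X1_index)
  define v where "v k = (if k < c then - y' k else if k = c then - y c else 0)" for k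
  define w where "w k = (if k < c then - y c * u k else if k = c then 1 else 0)" for k
  have ay: "a = 1 + int q * y c" using xy[OF c] by (simp add: a_def unit_fun_def)
  have sum_c: "(\<Sum>k<n. f k) = (\<Sum>k<c. f k) + f c" if "\<And>k. k > c \<Longrightarrow> f k = 0" for f :: "nat \<Rightarrow> int"
  proof -
    have "(\<Sum>k<n. f k) = (\<Sum>k<Suc c. f k)" using m that by (intro sum.mono_neutral_right) auto
    then show ?thesis by simp
  qed
  have uy: "(\<Sum>k<c. u k * y' k) = 1" using su by (simp add: y'_def)
  have "dot n w v = (\<Sum>k<c. w k * v k) + w c * v c" unfolding dot_def by (rule sum_c) (simp add: w_def)
  also have "(\<Sum>k<c. w k * v k) = y c * (\<Sum>k<c. u k * y' k)"
    unfolding sum_distrib_left by (intro sum.cong) (auto simp: w_def v_def)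
  also have "y c * (\<Sum>k<c. u k * y' k) + w c * v c = 0" by (simp add: uy w_def v_def)
  finally have wv: "dot n w v = 0" .
  have "dot n w (\<lambda>k. X1 $$ (k, c)) = (\<Sum>k<c. w k * X1 $$ (k, c)) + w c * X1 $$ (c, c)"
    unfolding dot_def by (rule sum_c) (simp add: w_def)
  also have "(\<Sum>k<c. w k * X1 $$ (k, c)) = - y c * int q * (\<Sum>k<c. u k * y' k)"
    unfolding sum_distrib_left using c by (intro sum.cong) (auto simp: w_def X1_col)
  also have "- y c * int q * (\<Sum>k<c. u k * y' k) + w c * X1 $$ (c, c) = 1"
    using c by (simp add: uy w_def X1_col ay)
  finally have wx: "dot n w (\<lambda>k. X1 $$ (k, c)) = 1" .
  define B where "B = transv n (\<lambda>k. int q * v k) w"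
  have B: "B \<in> N" unfolding B_def using wv by (intro transv_N) (auto simp: dot_linear)
  define X2 where "X2 = B * X1"
  have X2_index: "X2 $$ (i, j) = X1 $$ (i, j) + int q * v i * dot n w (\<lambda>k. X1 $$ (k, j))"
    if "i < n" "j < n" for i j
    using that Gamma_SL[OF X1] unfolding X2_def B_def by (subst transv_mult_index) auto
  have X2: "X2 \<in> Gamma q n" unfolding X2_def using B N_Gamma X1 by (auto intro: Gamma_mult)
  have X2_col: "X2 $$ (i, c) = (if i = c then 1 else 0)" if "i < n" for i
    using that c by (auto simp: X2_index X1_col wx v_def ay)
  have triv2: "trivial_from (Suc c) X2"
    unfolding trivial_from_def
  proof (intro allI impI)
    fix i j assume ij: "i < n" "j < n" "Suc c \<le> i \<or> Suc c \<le> j"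
    have "v i = 0 \<or> dot n w (\<lambda>k. X1 $$ (k, j)) = 0"
    proof (cases "Suc c \<le> j")
      case True
      then have "dot n w (\<lambda>k. X1 $$ (k, j)) = (\<Sum>k<n. w k * (if k = j then 1 else 0))"
        using triv1 ij unfolding dot_def by (intro sum.cong) (auto simp: trivial_from_def)
      also have "\<dots> = (\<Sum>k<n. 0)" using True by (intro sum.cong) (auto simp: w_def)
      finally show ?thesis by simp
    qed (use ij in \<open>auto simp: v_def\<close>)
    then show "X2 $$ (i, j) = (if i = j then 1 else 0)"
      using triv1 ij by (auto simp: X2_index trivial_from_def)
  qed
  define r where "r j = (if j < c then X2 $$ (c, j) div int q else 0)" for j
  have r: "int q * r j = X2 $$ (c, j)" if "j < c" for j
  proof -
    have "[X2 $$ (c, j) = (if c = j then 1 else 0)] (mod int q)"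
      using that c X2 unfolding Gamma_iff by (meson less_trans)
    then have "int q dvd X2 $$ (c, j)" using that by (simp add: cong_0_iff)
    then show ?thesis using that by (simp add: r_def)
  qed
  define C where "C = transv n (\<lambda>k. - int q * unit_fun c k) r"
  have C: "C \<in> N" unfolding C_def using c by (intro transv_N) (simp_all only: dot_linear dot_unit_fun, auto simp: r_def)
  define X3 where "X3 = X2 * C"
  have X3_index: "X3 $$ (i, j) = X2 $$ (i, j) - X2 $$ (i, c) * int q * r j" if "i < n" "j < n" for i j
    using that c Gamma_SL[OF X2] unfolding X3_def C_def by (subst mult_transv_index) (auto simp: dot_linear)
  have X3: "X3 \<in> Gamma q n" unfolding X3_def using C N_Gamma X2 by (auto intro: Gamma_mult)
  have "trivial_from c X3"
    unfolding trivial_from_def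
  proof (intro allI impI)
    fix i j assume ij: "i < n" "j < n" "c \<le> i \<or> c \<le> j"
    have X3e: "X3 $$ (i, j) = X2 $$ (i, j) - (if i = c then int q * r j else 0)"
      using ij by (simp add: X3_index X2_col)
    show "X3 $$ (i, j) = (if i = j then 1 else 0)"
    proof (cases "i = c \<and> j < c")
      case True
      then show ?thesis using X3e r by simp
    next
      case False
      then have "j = c \<or> Suc c \<le> i \<or> Suc c \<le> j" "i = c \<longrightarrow> r j = 0" using ij by (auto simp: r_def)
      then show ?thesis using X3e triv2 X2_col ij by (auto simp: trivial_from_def)
    qed
  qed
  moreover have "proj X3 = proj X"
    unfolding X3_def X2_def X1_def using A B C X1 X2 X Gamma_SL
    by (simp add: proj_mult_N X1_def X2_def)
  ultimately show ?thesis using X3 by blast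
qed

lemma reduce:
  assumes X: "X \<in> Gamma q n"
  shows "\<exists>Y \<in> Gamma q n. proj Y = proj X \<and> trivial_from 2 Y"
proof -
  have "\<exists>Y \<in> Gamma q n. proj Y = proj X \<and> trivial_from (n - k) Y" if "k \<le> n - 2" for k
    using that
  proof (induction k)
    case 0
    then show ?case using X by (auto simp: trivial_from_def)
  next
    case (Suc k)
    then obtain Y where Y: "Y \<in> Gamma q n" "proj Y = proj X" "trivial_from (n - k) Y" by auto
    have "n - k = Suc (n - Suc k)" using Suc.prems n by simp
    then show ?case using reduce_step[of Y "n - Suc k"] Y Suc.prems n by auto
  qed
  from this[of "n - 2"] show ?thesis using n by simp
qed

end

section \<open>The Mennicke symbol of a two-by-two block\<close>

text \<open>A three-by-three matrix in the top left corner of the identity; identities between such matrices can be checked entry by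
entry.\<close>

definition corner3 :: "nat \<Rightarrow> int \<Rightarrow> int \<Rightarrow> int \<Rightarrow> int \<Rightarrow> int \<Rightarrow> int \<Rightarrow> int \<Rightarrow> int \<Rightarrow> int \<Rightarrow> int mat" where
  "corner3 n a b c d e f g h k = mat n n (\<lambda>(i, j). if i < 3 \<and> j < 3 then [[a, b, c], [d, e, f], [g, h, k]] ! i ! j
     else if i = j then 1 else 0)"

lemma corner3_carrier [simp]: "corner3 n a b c d e f g h k \<in> carrier_mat n n"
  by (simp add: corner3_def)

lemma less_3_cases: "(i::nat) < 3 \<longleftrightarrow> i = 0 \<or> i = 1 \<or> i = 2"
  by auto

lemma corner3_mult:
  assumes n: "n \<ge> 3"
  shows "corner3 n a b c d e f g h k * corner3 n a' b' c' d' e' f' g' h' k' =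
    corner3 n (a * a' + b * d' + c * g') (a * b' + b * e' + c * h') (a * c' + b * f' + c * k')
         (d * a' + e * d' + f * g') (d * b' + e * e' + f * h') (d * c' + e * f' + f * k')
         (g * a' + h * d' + k * g') (g * b' + h * e' + k * h') (g * c' + h * f' + k * k')"
    (is "?A * ?B = ?C")
proof (rule eq_matI)
  fix i j assume "i < dim_row ?C" "j < dim_col ?C"
  then have ij: "i < n" "j < n" by (auto simp: corner3_def)
  have AB: "(?A * ?B) $$ (i, j) = (\<Sum>l<n. ?A $$ (i, l) * ?B $$ (l, j))"
    using ij by (intro mat_mult_index) auto
  show "(?A * ?B) $$ (i, j) = ?C $$ (i, j)"
  proof (cases "i < 3")
    case True
    have "(\<Sum>l<n. ?A $$ (i, l) * ?B $$ (l, j)) = (\<Sum>l\<in>{0, 1, 2}. ?A $$ (i, l) * ?B $$ (l, j))"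
      using n ij True by (intro sum.mono_neutral_right) (auto simp: corner3_def)
    then show ?thesis unfolding AB using n ij True
      by (cases "j < 3") (auto simp: corner3_def less_3_cases)
  next
    case False
    have "(\<Sum>l<n. ?A $$ (i, l) * ?B $$ (l, j)) = (\<Sum>l<n. if l = i then ?B $$ (l, j) else 0)"
      using n ij False by (intro sum.cong) (auto simp: corner3_def)
    then show ?thesis unfolding AB using n ij False by (auto simp: corner3_def)
  qed
qed (auto simp: corner3_def)

lemma corner3_eqI:
  assumes "a = a'" "b = b'" "c = c'" "d = d'" "e = e'" "f = f'" "g = g'" "h = h'" "k = k'"
  shows "corner3 n a b c d e f g h k = corner3 n a' b' c' d' e' f' g' h' k'"
  using assms by simp

lemma corner3_one: "corner3 n 1 0 0 0 1 0 0 0 1 = 1\<^sub>m n"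
  by (rule eq_matI) (auto simp: corner3_def less_3_cases)

lemma corner3_elmat:
  assumes "n \<ge> 3"
  shows "corner3 n 1 t 0 0 1 0 0 0 1 = elmat n 0 1 t" "corner3 n 1 0 t 0 1 0 0 0 1 = elmat n 0 2 t"
    "corner3 n 1 0 0 t 1 0 0 0 1 = elmat n 1 0 t" "corner3 n 1 0 0 0 1 t 0 0 1 = elmat n 1 2 t"
    "corner3 n 1 0 0 0 1 0 t 0 1 = elmat n 2 0 t" "corner3 n 1 0 0 0 1 0 0 t 1 = elmat n 2 1 t"
  by (rule eq_matI; use assms in \<open>auto simp: corner3_def transv_index unit_fun_def less_3_cases\<close>)+

abbreviation block2 :: "nat \<Rightarrow> int \<Rightarrow> int \<Rightarrow> int \<Rightarrow> int \<Rightarrow> int mat" where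
  "block2 n a b c d \<equiv> corner3 n a b 0 c d 0 0 0 1"

text \<open>The monoid generated by the elementary matrices of size three.\<close>

inductive_set elem3 :: "nat \<Rightarrow> int mat set" for n where
  one: "1\<^sub>m n \<in> elem3 n"
| step: "i < 3 \<Longrightarrow> j < 3 \<Longrightarrow> i \<noteq> j \<Longrightarrow> X \<in> elem3 n \<Longrightarrow> elmat n i j t * X \<in> elem3 n"

lemma elem3_carrier: "X \<in> elem3 n \<Longrightarrow> X \<in> carrier_mat n n"
  by (induction rule: elem3.induct) auto

lemma elem3_SL: "X \<in> elem3 n \<Longrightarrow> n \<ge> 3 \<Longrightarrow> X \<in> carrier (SL n)"
proof (induction rule: elem3.induct)
  case one
  then show ?case by (simp add: carrier_SL)
next
  case (step i j X t)
  then have "elmat n i j t \<in> carrier (SL n)" "X \<in> carrier (SL n)" by (auto intro: elmat_SL)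
  then have "elmat n i j t \<otimes>\<^bsub>SL n\<^esub> X \<in> carrier (SL n)"
    by (rule monoid.m_closed[OF group.is_monoid[OF group_SL]])
  then show ?case by simp
qed

lemma elem3_mult: "X \<in> elem3 n \<Longrightarrow> Y \<in> elem3 n \<Longrightarrow> X * Y \<in> elem3 n"
proof (induction rule: elem3.induct)
  case one
  then show ?case by (simp add: elem3_carrier left_mult_one_mat[of _ n n])
next
  case (step i j X t)
  have "elmat n i j t * X * Y = elmat n i j t * (X * Y)"
    using step elem3_carrier by (intro assoc_mult_mat[of _ n n _ n _ n]) auto
  then show ?case using step elem3.step by simp
qed

lemma elem3_elmat: "i < 3 \<Longrightarrow> j < 3 \<Longrightarrow> i \<noteq> j \<Longrightarrow> elmat n i j t \<in> elem3 n"
  using elem3.step[of i j "1\<^sub>m n" n t] elem3.one[of n] by (simp add: right_mult_one_mat[of _ n n])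

text \<open>The Euclidean algorithm on the first column; \<open>w\<close> is the rotation by a right angle.\<close>

lemma block2_elem3:
  assumes n: "n \<ge> 3" and det: "a * d - b * c = 1"
  shows "block2 n a b c d \<in> elem3 n"
  using det
proof (induction "nat \<bar>c\<bar>" arbitrary: a b c d rule: less_induct)
  case less
  define w where "w = elmat n 0 1 1 * (elmat n 1 0 (- 1) * elmat n 0 1 1)"
  have w: "w \<in> elem3 n" unfolding w_def by (intro elem3_mult elem3_elmat) auto
  have w_eq: "w = block2 n 0 1 (- 1) 0" unfolding w_def corner3_elmat[OF n, symmetric] corner3_mult[OF n] by simp
  show ?case
  proof (cases "c = 0")
    case True
    then have "a * d = 1" using less.prems by simp
    then consider "a = 1" "d = 1" | "a = - 1" "d = - 1" by (auto simp: zmult_eq_1_iff)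
    then show ?thesis
    proof cases
      case 1
      then show ?thesis using True elem3_elmat[of 0 1 n b] by (simp add: corner3_elmat[OF n])
    next
      case 2
      have "block2 n a b c d = w * (w * elmat n 0 1 (- b))"
        unfolding w_eq corner3_elmat[OF n, symmetric] corner3_mult[OF n] using 2 True by simp
      moreover have "elmat n 0 1 (- b) \<in> elem3 n" by (rule elem3_elmat) auto
      ultimately show ?thesis using w by (metis elem3_mult)
    qed
  next
    case False
    define a' where "a' = a mod c"
    define t where "t = a div c"
    have a: "a = a' + t * c" unfolding a'_def t_def by (rule mod_div_mult_eq[symmetric])
    have "\<bar>a'\<bar> < \<bar>c\<bar>" using False abs_mod_less by (simp add: a'_def)
    then have lt: "nat \<bar>- a'\<bar> < nat \<bar>c\<bar>" by simp
    have "c * (- b + t * d) - d * (- a') = 1" using less.prems by (simp add: a algebra_simps)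
    then have "block2 n c d (- a') (- b + t * d) \<in> elem3 n" using lt by (intro less.hyps) auto
    moreover have "block2 n a b c d = elmat n 0 1 t * (w * (w * (w * block2 n c d (- a') (- b + t * d))))"
      unfolding w_eq corner3_elmat[OF n, symmetric] corner3_mult[OF n] by (simp add: a)
    moreover have "elmat n 0 1 t \<in> elem3 n" by (rule elem3_elmat) auto
    ultimately show ?thesis using w by (metis elem3_mult)
  qed
qed

context congruence_quotient
begin

lemma block2_SL: "a * d - b * c = 1 \<Longrightarrow> block2 n a b c d \<in> carrier G"
  using block2_elem3[OF n] elem3_SL[OF _ n] by blast

lemma block2_Gamma:
  assumes "a * d - b * c = 1" "[a = 1] (mod int q)" "[d = 1] (mod int q)" "int q dvd b" "int q dvd c"
  shows "block2 n a b c d \<in> Gamma q n"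
proof -
  have "[block2 n a b c d $$ (i, j) = (if i = j then 1 else 0)] (mod int q)" if "i < n" "j < n" for i j
  proof (cases "i < 3 \<and> j < 3")
    case True
    then consider "i = 0" | "i = 1" | "i = 2" by linarith
    moreover have "j = 0 \<or> j = 1 \<or> j = 2" using True by linarith
    ultimately show ?thesis
      using assms(2-5) that by cases (auto simp: corner3_def cong_0_iff)
  next
    case False
    then show ?thesis using that by (auto simp: corner3_def)
  qed
  then show ?thesis using block2_SL[OF assms(1)] by (simp add: Gamma_iff)
qed

lemma elmat_G: "i < 3 \<Longrightarrow> j < 3 \<Longrightarrow> i \<noteq> j \<Longrightarrow> elmat n i j t \<in> carrier G"
  using n by (intro elmat_SL) auto

definition commutes :: "int mat \<Rightarrow> int mat \<Rightarrow> bool" where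
  "commutes A X \<longleftrightarrow> proj A \<otimes>\<^bsub>Q\<^esub> proj X = proj X \<otimes>\<^bsub>Q\<^esub> proj A"

lemma commutes_mult:
  assumes c: "A \<in> carrier G" "X \<in> carrier G" "Y \<in> carrier G" and AX: "commutes A X" and AY: "commutes A Y"
  shows "commutes A (X * Y)"
proof -
  have "proj A \<otimes>\<^bsub>Q\<^esub> (proj X \<otimes>\<^bsub>Q\<^esub> proj Y) = (proj A \<otimes>\<^bsub>Q\<^esub> proj X) \<otimes>\<^bsub>Q\<^esub> proj Y"
    using c by (simp only: Q.m_assoc proj_closed)
  also have "\<dots> = proj X \<otimes>\<^bsub>Q\<^esub> (proj A \<otimes>\<^bsub>Q\<^esub> proj Y)"
    using c AX by (simp only: Q.m_assoc proj_closed commutes_def)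
  also have "\<dots> = (proj X \<otimes>\<^bsub>Q\<^esub> proj Y) \<otimes>\<^bsub>Q\<^esub> proj A"
    using c AY by (simp only: Q.m_assoc proj_closed commutes_def)
  finally show ?thesis using c by (simp only: commutes_def proj_mult)
qed

lemma commutesI_left:
  assumes c: "A \<in> carrier G" "X \<in> carrier G" "T \<in> N" and eq: "A * X = T * (X * A)"
  shows "commutes A X"
proof -
  have "proj (A * X) = proj (X * A)" unfolding eq by (rule proj_mult_N(1)[OF c(3) SL_mult[OF c(2,1)]])
  then show ?thesis using c by (simp only: commutes_def proj_mult)
qed

lemma commutesI_right:
  assumes c: "A \<in> carrier G" "X \<in> carrier G" "T \<in> N" and eq: "X * A = A * X * T"
  shows "commutes A X"
proof -
  have "proj (X * A) = proj (A * X)" unfolding eq by (rule proj_mult_N(2)[OF c(3) SL_mult[OF c(1,2)]])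
  then show ?thesis using c by (simp only: commutes_def proj_mult)
qed

lemma N_mult: "A \<in> N \<Longrightarrow> B \<in> N \<Longrightarrow> A * B \<in> N"
  using N.m_closed by simp

text \<open>The commutators of a block with \<open>e\<^sub>i\<^sub>3(t)\<close> and \<open>e\<^sub>3\<^sub>i(t)\<close> are products of elementary matrices in the third column or row.
Their entries are divisible by \<open>q\<close>, since the block is the identity modulo \<open>q\<close>. The remaining two kinds of elementary matrices
are commutators of these.\<close>

lemma block2_commutes:
  assumes det: "a * d - b * c = 1"
    and cong: "[a = 1] (mod int q)" "[d = 1] (mod int q)" "int q dvd b" "int q dvd c"
    and X: "X \<in> elem3 n"
  shows "commutes (block2 n a b c d) X"
proof -
  let ?A = "block2 n a b c d"
  have A: "?A \<in> carrier G" using det by (rule block2_SL)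
  have dv: "int q dvd a - 1" "int q dvd d - 1" using cong by (auto simp: cong_iff_dvd_diff)
  have elN: "elmat n i j t \<in> N" if "i < 3" "j < 3" "i \<noteq> j" "int q dvd t" for i j t
    using that n by (intro elmat_N) auto
  have 02: "commutes ?A (elmat n 0 2 t)" for t
  proof (rule commutesI_left[OF A elmat_G])
    show "elmat n 0 2 ((a - 1) * t) * elmat n 1 2 (c * t) \<in> N" using dv cong by (intro N_mult elN) auto
    show "?A * elmat n 0 2 t = elmat n 0 2 ((a - 1) * t) * elmat n 1 2 (c * t) * (elmat n 0 2 t * ?A)"
      unfolding corner3_elmat[OF n, symmetric] corner3_mult[OF n] by (rule corner3_eqI) (simp_all add: algebra_simps)
  qed auto
  have 12: "commutes ?A (elmat n 1 2 t)" for t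
  proof (rule commutesI_left[OF A elmat_G])
    show "elmat n 0 2 (b * t) * elmat n 1 2 ((d - 1) * t) \<in> N" using dv cong by (intro N_mult elN) auto
    show "?A * elmat n 1 2 t = elmat n 0 2 (b * t) * elmat n 1 2 ((d - 1) * t) * (elmat n 1 2 t * ?A)"
      unfolding corner3_elmat[OF n, symmetric] corner3_mult[OF n] by (rule corner3_eqI) (simp_all add: algebra_simps)
  qed auto
  have 20: "commutes ?A (elmat n 2 0 t)" for t
  proof (rule commutesI_right[OF A elmat_G])
    show "elmat n 2 0 (t * (a - 1)) * elmat n 2 1 (t * b) \<in> N" using dv cong by (intro N_mult elN) auto
    show "elmat n 2 0 t * ?A = ?A * elmat n 2 0 t * (elmat n 2 0 (t * (a - 1)) * elmat n 2 1 (t * b))"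
      unfolding corner3_elmat[OF n, symmetric] corner3_mult[OF n] by (rule corner3_eqI) (simp_all add: algebra_simps)
  qed auto
  have 21: "commutes ?A (elmat n 2 1 t)" for t
  proof (rule commutesI_right[OF A elmat_G])
    show "elmat n 2 0 (t * c) * elmat n 2 1 (t * (d - 1)) \<in> N" using dv cong by (intro N_mult elN) auto
    show "elmat n 2 1 t * ?A = ?A * elmat n 2 1 t * (elmat n 2 0 (t * c) * elmat n 2 1 (t * (d - 1)))"
      unfolding corner3_elmat[OF n, symmetric] corner3_mult[OF n] by (rule corner3_eqI) (simp_all add: algebra_simps)
  qed auto
  have 01: "commutes ?A (elmat n 0 1 t)" for t
  proof -
    have "elmat n 0 1 t = elmat n 0 2 t * (elmat n 2 1 1 * (elmat n 0 2 (- t) * elmat n 2 1 (- 1)))"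
      unfolding corner3_elmat[OF n, symmetric] corner3_mult[OF n] by (rule corner3_eqI) (simp_all add: algebra_simps)
    then show ?thesis by (simp only:) (intro commutes_mult[OF A] 02 21 elmat_G SL_mult; simp)
  qed
  have 10: "commutes ?A (elmat n 1 0 t)" for t
  proof -
    have "elmat n 1 0 t = elmat n 1 2 t * (elmat n 2 0 1 * (elmat n 1 2 (- t) * elmat n 2 0 (- 1)))"
      unfolding corner3_elmat[OF n, symmetric] corner3_mult[OF n] by (rule corner3_eqI) (simp_all add: algebra_simps)
    then show ?thesis by (simp only:) (intro commutes_mult[OF A] 12 20 elmat_G SL_mult; simp)
  qed
  show ?thesis
    using X
  proof (induction rule: elem3.induct)
    case one
    have "1\<^sub>m n \<in> N" using N.one_closed by simp
    then show ?case using A by (simp add: commutes_def proj_N)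
  next
    case (step i j X t)
    have "commutes ?A (elmat n i j t)"
      using step.hyps(1-3) 01 02 10 12 20 21 by (auto simp: less_3_cases)
    then show ?case using step A n by (intro commutes_mult) (auto intro: elmat_G elem3_SL)
  qed
qed

text \<open>The class modulo \<open>N\<close> of any block with first row \<open>(a, b)\<close> and a second row that is \<open>(0, 1)\<close> modulo \<open>q\<close> (\<open>mennicke_class_eq\<close>).\<close>

definition mennicke_class :: "int \<Rightarrow> int \<Rightarrow> int mat set" where
  "mennicke_class a b = proj (case SOME (c, d). a * d - b * c = 1 \<and> [d = 1] (mod int q) \<and> int q dvd c of (c, d) \<Rightarrow> block2 n a b c d)"

text \<open>Two blocks with the same first row differ by a factor \<open>e\<^sub>2\<^sub>1(t)\<close>, and \<open>t\<close> is divisible by \<open>q\<close> here.\<close>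

lemma block2_change:
  assumes "a * d - b * c = 1" "a * d' - b * c' = 1" "int q dvd c" "int q dvd c'"
  shows "proj (block2 n a b c' d') = proj (block2 n a b c d)"
proof -
  define t where "t = c' * d - c * d'"
  have ta: "t * a = c' - c"
  proof -
    have "t * a = c' * (a * d) - c * (a * d')" by (simp add: t_def algebra_simps)
    also have "\<dots> = c' * (1 + b * c) - c * (1 + b * c')" using assms by (simp add: algebra_simps)
    finally show ?thesis by (simp add: algebra_simps)
  qed
  have tb: "t * b = d' - d"
  proof -
    have "t * b = d * (b * c') - d' * (b * c)" by (simp add: t_def algebra_simps)
    also have "\<dots> = d * (a * d' - 1) - d' * (a * d - 1)" using assms by (simp add: algebra_simps)
    finally show ?thesis by (simp add: algebra_simps)
  qed
  have "block2 n a b c' d' = elmat n 1 0 t * block2 n a b c d"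
    unfolding corner3_elmat[OF n, symmetric] corner3_mult[OF n] using ta tb by (intro corner3_eqI) auto
  moreover have "elmat n 1 0 t \<in> N" using assms n by (intro elmat_N) (auto simp: t_def)
  ultimately show ?thesis using proj_mult_N block2_SL assms by simp
qed

lemma mennicke_class_eq:
  assumes "a * d - b * c = 1" "[d = 1] (mod int q)" "int q dvd c"
  shows "mennicke_class a b = proj (block2 n a b c d)"
proof -
  let ?P = "\<lambda>(c, d). a * d - b * c = 1 \<and> [d = 1] (mod int q) \<and> int q dvd c"
  have "?P (c, d)" using assms by simp
  then have P: "?P (SOME x. ?P x)" by (rule someI[of ?P])
  obtain c' d' where cd: "(SOME x. ?P x) = (c', d')" by (cases "SOME x. ?P x")
  have cd': "a * d' - b * c' = 1" "int q dvd c'" using P unfolding cd by simp_all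
  show ?thesis unfolding mennicke_class_def cd prod.case
    by (rule block2_change[OF assms(1) cd'(1) assms(3) cd'(2)])
qed

lemma block2_exists:
  assumes "[a = 1] (mod int q)" "coprime a b"
  obtains c d where "a * d - b * c = 1" "[d = 1] (mod int q)" "int q dvd c"
proof -
  have "coprime a (int q)" using assms(1) by (metis cong_imp_coprime cong_sym coprime_1_left)
  then have "coprime a (b * int q)" using assms(2) by simp
  then obtain d where d: "[a * d = 1] (mod b * int q)" using cong_solve_coprime_int by blast
  then obtain k where k: "a * d = 1 + b * int q * k" by (metis cong_iff_lin cong_sym)
  have "[a * d = 1] (mod int q)" using d by (rule cong_dvd_modulus) simp
  moreover have "[a * d = 1 * d] (mod int q)" using assms(1) by (intro cong_mult cong_refl)
  ultimately have "[d = 1] (mod int q)" by (metis cong_sym cong_trans mult_1)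
  then show ?thesis using k by (intro that[of d "int q * k"]) (auto simp: mult.assoc)
qed

lemma mennicke_class_add_right:
  assumes "[a = 1] (mod int q)" "coprime a b" "int q dvd t"
  shows "mennicke_class a (b + t * a) = mennicke_class a b"
proof -
  obtain c d where cd: "a * d - b * c = 1" "[d = 1] (mod int q)" "int q dvd c" using block2_exists assms by blast
  have det: "a * (d + t * c) - (b + t * a) * c = 1" using cd(1) by (simp add: algebra_simps)
  have "[d + t * c = 1 + t * 0] (mod int q)" using cd by (intro cong_add cong_mult cong_refl) (auto simp: cong_0_iff)
  then have "mennicke_class a (b + t * a) = proj (block2 n a (b + t * a) c (d + t * c))"
    using det cd by (intro mennicke_class_eq) auto
  also have "block2 n a (b + t * a) c (d + t * c) = block2 n a b c d * elmat n 0 1 t"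
    unfolding corner3_elmat[OF n, symmetric] corner3_mult[OF n] by (rule corner3_eqI) (simp_all add: algebra_simps)
  also have "proj \<dots> = mennicke_class a b"
    using cd assms n by (subst proj_mult_N) (auto intro!: elmat_N block2_SL simp: mennicke_class_eq)
  finally show ?thesis .
qed

text \<open>The column operation \<open>e\<^sub>2\<^sub>1(t)\<close> need not be in \<open>N\<close>, but the class of the block commutes with it, so conjugation by it
does not change the class. The result is again a block that is the identity modulo \<open>q\<close>.\<close>

lemma mennicke_class_add_left:
  assumes "[a = 1] (mod int q)" "coprime a b" "int q dvd b"
  shows "mennicke_class (a + t * b) b = mennicke_class a b"
proof -
  obtain c d where cd: "a * d - b * c = 1" "[d = 1] (mod int q)" "int q dvd c" using block2_exists assms by blast
  let ?A = "block2 n a b c d"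
  have A: "?A \<in> carrier G" using cd(1) by (rule block2_SL)
  have e: "elmat n 1 0 s \<in> carrier G" for s by (rule elmat_G) auto
  have com: "commutes ?A (elmat n 1 0 t)"
    using cd assms by (intro block2_commutes elem3_elmat) auto
  have inv: "proj (elmat n 1 0 (- t)) \<otimes>\<^bsub>Q\<^esub> proj (elmat n 1 0 t) = \<one>\<^bsub>Q\<^esub>"
  proof -
    have "elmat n 1 0 (- t) * elmat n 1 0 t = 1\<^sub>m n"
      unfolding corner3_elmat[OF n, symmetric] corner3_mult[OF n] corner3_one[symmetric] by (rule corner3_eqI) simp_all
    moreover have "1\<^sub>m n \<in> N" using N.one_closed by simp
    ultimately show ?thesis using e by (simp only: proj_N flip: proj_mult)
  qed
  have eq: "elmat n 1 0 (- t) * ?A * elmat n 1 0 t = block2 n (a + t * b) b (c + t * d - t * (a + t * b)) (d - t * b)"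
    unfolding corner3_elmat[OF n, symmetric] corner3_mult[OF n] by (rule corner3_eqI) (simp_all add: algebra_simps)
  have det: "(a + t * b) * (d - t * b) - b * (c + t * d - t * (a + t * b)) = 1"
    using cd(1) by (simp add: algebra_simps)
  have bq: "[d - t * b = 1 - t * 0] (mod int q)"
    using cd assms by (intro cong_diff cong_mult cong_refl) (auto simp: cong_0_iff)
  have "[c + t * d - t * (a + t * b) = 0 + t * 1 - t * (1 + t * 0)] (mod int q)"
    using cd assms by (intro cong_diff cong_add cong_mult cong_refl) (auto simp: cong_0_iff)
  then have cq: "int q dvd c + t * d - t * (a + t * b)" by (simp add: cong_0_iff)
  have "mennicke_class (a + t * b) b = proj (elmat n 1 0 (- t) * ?A * elmat n 1 0 t)"
    unfolding eq using det bq cq by (intro mennicke_class_eq) auto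
  also have "\<dots> = (proj (elmat n 1 0 (- t)) \<otimes>\<^bsub>Q\<^esub> proj ?A) \<otimes>\<^bsub>Q\<^esub> proj (elmat n 1 0 t)"
    by (simp only: proj_mult SL_mult e A)
  also have "\<dots> = proj (elmat n 1 0 (- t)) \<otimes>\<^bsub>Q\<^esub> (proj ?A \<otimes>\<^bsub>Q\<^esub> proj (elmat n 1 0 t))"
    by (rule Q.m_assoc) (rule proj_closed, rule e A)+
  also have "\<dots> = proj (elmat n 1 0 (- t)) \<otimes>\<^bsub>Q\<^esub> (proj (elmat n 1 0 t) \<otimes>\<^bsub>Q\<^esub> proj ?A)"
    by (simp only: com[unfolded commutes_def])
  also have "\<dots> = (proj (elmat n 1 0 (- t)) \<otimes>\<^bsub>Q\<^esub> proj (elmat n 1 0 t)) \<otimes>\<^bsub>Q\<^esub> proj ?A"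
    by (rule Q.m_assoc[symmetric]) (rule proj_closed, rule e A)+
  also have "\<dots> = proj ?A" unfolding inv by (rule Q.l_one) (rule proj_closed, rule A)
  finally show ?thesis using cd by (simp add: mennicke_class_eq)
qed

text \<open>Conjugation by a cyclic permutation matrix, which commutes with the class of the block.\<close>

lemma block2_shift:
  assumes det: "a * d - b * c = 1"
    and cong: "[a = 1] (mod int q)" "[d = 1] (mod int q)" "int q dvd b" "int q dvd c"
  shows "corner3 n 1 0 0 0 a b 0 c d \<in> carrier G" "proj (corner3 n 1 0 0 0 a b 0 c d) = proj (block2 n a b c d)"
proof -
  define P where "P = elmat n 1 0 1 * (elmat n 0 1 (- 1) * elmat n 1 0 1) * (elmat n 2 1 1 * (elmat n 1 2 (- 1) * elmat n 2 1 1))"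
  define P' where "P' = elmat n 2 1 (- 1) * (elmat n 1 2 1 * elmat n 2 1 (- 1)) * (elmat n 1 0 (- 1) * (elmat n 0 1 1 * elmat n 1 0 (- 1)))"
  let ?A = "block2 n a b c d" and ?B = "corner3 n 1 0 0 0 a b 0 c d"
  have P3: "P \<in> elem3 n" unfolding P_def by (intro elem3_mult elem3_elmat) simp_all
  have P3': "P' \<in> elem3 n" unfolding P'_def by (intro elem3_mult elem3_elmat) simp_all
  then have P: "P \<in> carrier G" "P' \<in> carrier G" using P3 elem3_SL n by auto
  have A: "?A \<in> carrier G" using det by (rule block2_SL)
  have P_eq: "P = corner3 n 0 0 1 1 0 0 0 1 0" "P' = corner3 n 0 1 0 0 0 1 1 0 0"
    unfolding P_def P'_def corner3_elmat[OF n, symmetric] by (simp_all add: corner3_mult[OF n])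
  have B_eq: "?B = P * ?A * P'" and BP: "?B * P = P * ?A"
    unfolding P_eq by (simp_all add: corner3_mult[OF n])
  show B: "?B \<in> carrier G" unfolding B_eq by (intro SL_mult P A)
  have "proj ?B \<otimes>\<^bsub>Q\<^esub> proj P = proj ?A \<otimes>\<^bsub>Q\<^esub> proj P"
    using block2_commutes[OF det cong P3] B A P BP by (simp add: commutes_def flip: proj_mult)
  then show "proj ?B = proj ?A" using A B P by (simp add: Q.right_cancel)
qed

text \<open>Mennicke's computation. One factor is moved to the lower right corner. The product of the two matrices has
first row \<open>(a, a b, b b')\<close>, and row and column operations from \<open>N\<close>, together with the rotation \<open>w\<close> of the last two coordinates,
turn it into a block with first row \<open>(a, b b')\<close>.\<close>

lemma mennicke_class_mult:
  assumes a: "[a = 1] (mod int q)" and b: "coprime a b" "coprime a b'" "int q dvd b" "int q dvd b'"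
  shows "mennicke_class a (b * b') = mennicke_class a b \<otimes>\<^bsub>Q\<^esub> mennicke_class a b'"
proof -
  obtain c d where cd: "a * d - b * c = 1" "[d = 1] (mod int q)" "int q dvd c" using block2_exists[OF a b(1)] .
  obtain c' d' where cd': "a * d' - b' * c' = 1" "[d' = 1] (mod int q)" "int q dvd c'" using block2_exists[OF a b(2)] .
  define e where "e = d' - c' * d * b'"
  let ?A = "block2 n a b c d" and ?B = "corner3 n 1 0 0 0 a b' 0 c' d'" and ?C = "block2 n a (b * b') (- c * c') e"
  define w where "w = elmat n 2 1 1 * (elmat n 1 2 (- 1) * elmat n 2 1 1)"
  have w3: "w \<in> elem3 n" unfolding w_def by (intro elem3_mult elem3_elmat) simp_all
  then have w: "w \<in> carrier G" using elem3_SL n by auto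
  have w_eq: "w = corner3 n 1 0 0 0 0 (- 1) 0 1 0"
    unfolding w_def corner3_elmat[OF n, symmetric] by (simp add: corner3_mult[OF n])
  have det: "a * e - b * b' * (- c * c') = 1"
  proof -
    have "a * e - b * b' * (- c * c') = a * d' - c' * b' * (a * d - b * c)"
      by (simp add: e_def algebra_simps)
    then show ?thesis using cd cd' by (simp add: algebra_simps)
  qed
  have eq1: "[e = 1 - 0 * d * b'] (mod int q)"
    unfolding e_def using cd' by (intro cong_diff cong_mult cong_refl) (auto simp: cong_0_iff)
  have A: "?A \<in> carrier G" and C: "?C \<in> carrier G" using cd det by (auto intro: block2_SL)
  have B: "?B \<in> carrier G" "proj ?B = mennicke_class a b'"
    using block2_shift[OF cd'(1) a cd'(2) b(4) cd'(3)] mennicke_class_eq[OF cd'] by auto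
  define R where "R = elmat n 0 2 b * (elmat n 2 0 c * elmat n 2 1 (d * b'))"
  have R: "R \<in> N" unfolding R_def using b cd n by (intro N_mult elmat_N) auto
  have L: "elmat n 2 1 (- c') \<in> N" using cd' n by (intro elmat_N) auto
  have ad: "a * d = 1 + b * c" "a * d' = 1 + b' * c'" using cd cd' by auto
  have "elmat n 2 1 (- c') * (?A * ?B * w) * R = w * ?C"
    unfolding w_eq R_def corner3_elmat[OF n, symmetric]
    by (simp add: corner3_mult[OF n] e_def; rule corner3_eqI; (simp add: algebra_simps; fail)?; (insert ad, Groebner_Basis.algebra)?)
  then have "proj (elmat n 2 1 (- c') * (?A * ?B * w) * R) = proj (w * ?C)" by simp
  then have "proj ?A \<otimes>\<^bsub>Q\<^esub> proj ?B \<otimes>\<^bsub>Q\<^esub> proj w = proj w \<otimes>\<^bsub>Q\<^esub> proj ?C"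
    using A B C w R L by (simp add: proj_mult_N SL_mult N_SL proj_mult)
  also have "\<dots> = proj ?C \<otimes>\<^bsub>Q\<^esub> proj w"
    using block2_commutes[OF det a _ _ _ w3] eq1 b cd by (simp add: commutes_def)
  finally have "proj ?A \<otimes>\<^bsub>Q\<^esub> proj ?B = proj ?C"
    using A B(1) C w by (simp add: Q.right_cancel)
  moreover have "mennicke_class a (b * b') = proj ?C" using det eq1 cd by (intro mennicke_class_eq) auto
  ultimately show ?thesis using B mennicke_class_eq[OF cd] by simp
qed

end

section \<open>Congruence subgroups are generated by transvections\<close>

text \<open>The vanishing theorem concerns symbols with values in a type of class \<open>ab_group_add\<close>, whereas the values at hand
lie in a group given by a carrier. The product of all abelian groups with elements of type \<open>'a\<close> is a type of this class
into which each of these groups embeds. Groups that are not abelian are replaced by a trivial one.\<close>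

definition comm_part :: "'a monoid \<Rightarrow> 'a monoid" where
  "comm_part G = (if comm_group G then G
     else \<lparr>carrier = {undefined}, mult = (\<lambda>_ _. undefined), one = undefined\<rparr>)"

interpretation comm_part: comm_group "comm_part G" for G :: "'a monoid"
proof (cases "comm_group G")
  case False
  then show "comm_group (comm_part G)" by (intro comm_groupI) (auto simp: comm_part_def)
qed (simp add: comm_part_def)

typedef 'a comm_family = "{f :: 'a monoid \<Rightarrow> 'a. \<forall>G. f G \<in> carrier (comm_part G)}"
  using comm_part.one_closed by fast

setup_lifting type_definition_comm_family

instantiation comm_family :: (type) ab_group_add
begin

lift_definition zero_comm_family :: "'a comm_family" is "\<lambda>G. \<one>\<^bsub>comm_part G\<^esub>"
  by simp

lift_definition plus_comm_family :: "'a comm_family \<Rightarrow> 'a comm_family \<Rightarrow> 'a comm_family"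
  is "\<lambda>f g G. f G \<otimes>\<^bsub>comm_part G\<^esub> g G"
  by simp

lift_definition uminus_comm_family :: "'a comm_family \<Rightarrow> 'a comm_family"
  is "\<lambda>f G. inv\<^bsub>comm_part G\<^esub> f G"
  by simp

definition minus_comm_family :: "'a comm_family \<Rightarrow> 'a comm_family \<Rightarrow> 'a comm_family" where
  "minus_comm_family f g = f + (- g)"

instance
proof
  fix f g h :: "'a comm_family"
  show "f + g + h = f + (g + h)" by transfer (simp add: comm_part.m_assoc)
  show "f + g = g + f" by transfer (simp add: comm_part.m_comm)
  show "0 + f = f" by transfer simp
  show "- f + f = 0" by transfer simp
qed (simp add: minus_comm_family_def)

end

definition embed_comm :: "'a monoid \<Rightarrow> 'a \<Rightarrow> 'a comm_family" where
  "embed_comm G x = Abs_comm_family (\<lambda>G'. if G' = G then x else \<one>\<^bsub>comm_part G'\<^esub>)"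

context
  fixes G :: "'a monoid"
  assumes G: "comm_group G"
begin

lemma Rep_embed_comm:
  assumes "x \<in> carrier G"
  shows "Rep_comm_family (embed_comm G x) = (\<lambda>G'. if G' = G then x else \<one>\<^bsub>comm_part G'\<^esub>)"
proof -
  have "comm_part G = G" using G by (simp add: comm_part_def)
  then show ?thesis unfolding embed_comm_def using assms by (intro Abs_comm_family_inverse) auto
qed

lemma embed_comm_mult:
  assumes x: "x \<in> carrier G" "y \<in> carrier G"
  shows "embed_comm G (x \<otimes>\<^bsub>G\<^esub> y) = embed_comm G x + embed_comm G y"
proof -
  have cp: "comm_part G = G" using G by (simp add: comm_part_def)
  have xy: "x \<otimes>\<^bsub>G\<^esub> y \<in> carrier G" using comm_part.m_closed[of x G y] x by (simp add: cp)
  have "Rep_comm_family (embed_comm G (x \<otimes>\<^bsub>G\<^esub> y)) = Rep_comm_family (embed_comm G x + embed_comm G y)"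
    unfolding plus_comm_family.rep_eq Rep_embed_comm[OF x(1)] Rep_embed_comm[OF x(2)] Rep_embed_comm[OF xy]
    by (auto simp: fun_eq_iff cp)
  then show ?thesis by (simp add: Rep_comm_family_inject)
qed

lemma embed_comm_eq_0:
  assumes x: "x \<in> carrier G" "embed_comm G x = 0"
  shows "x = \<one>\<^bsub>G\<^esub>"
proof -
  have "Rep_comm_family (embed_comm G x) G = Rep_comm_family 0 G" using x by simp
  then show ?thesis
    unfolding Rep_embed_comm[OF x(1)] zero_comm_family.rep_eq using G by (simp add: comm_part_def)
qed

end

lemma det_2_2:
  fixes f :: "nat \<times> nat \<Rightarrow> int"
  shows "det (mat 2 2 f) = f (0, 0) * f (1, 1) - f (0, 1) * f (1, 0)"
proof -
  let ?A = "mat 2 2 f"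
  have "det ?A = (\<Sum>j<2. ?A $$ (0, j) * cofactor ?A 0 j)" by (rule laplace_expansion_row) auto
  also have "\<dots> = f (0, 0) * cofactor ?A 0 0 + f (0, 1) * cofactor ?A 0 1" by (simp add: numeral_2_eq_2)
  also have "cofactor ?A 0 0 = f (1, 1)"
    unfolding cofactor_def by (subst det_single) (auto simp: mat_delete_def)
  also have "cofactor ?A 0 1 = - f (1, 0)"
    unfolding cofactor_def by (subst det_single) (auto simp: mat_delete_def)
  finally show ?thesis by simp
qed

context congruence_quotient
begin

lemma det_trivial_from_2:
  assumes A: "A \<in> carrier_mat n n" and triv: "trivial_from 2 A"
  shows "det A = A $$ (0, 0) * A $$ (1, 1) - A $$ (0, 1) * A $$ (1, 0)"
proof -
  let ?B = "mat 2 2 (\<lambda>(i, j). A $$ (i, j))"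
  have t: "A $$ (i, j) = (if i = j then 1 else 0)" if "i < n" "j < n" "i \<ge> 2 \<or> j \<ge> 2" for i j
    using triv that unfolding trivial_from_def by blast
  have "A = four_block_mat ?B (0\<^sub>m 2 (n - 2)) (0\<^sub>m (n - 2) 2) (1\<^sub>m (n - 2))"
    using A n by (intro eq_matI) (auto simp: t)
  moreover have "det (four_block_mat ?B (0\<^sub>m 2 (n - 2)) (0\<^sub>m (n - 2) 2) (1\<^sub>m (n - 2))) = det ?B * det (1\<^sub>m (n - 2) :: int mat)"
    by (intro det_four_block_mat_upper_right_zero) auto
  ultimately show ?thesis by (simp add: det_2_2)
qed

lemma trivial_from_2_block2:
  assumes X: "X \<in> Gamma q n" and triv: "trivial_from 2 X"
  obtains a b c d where "X = block2 n a b c d" "a * d - b * c = 1" "[a = 1] (mod int q)" "[d = 1] (mod int q)"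
    "int q dvd b" "int q dvd c"
proof -
  have Xc: "X \<in> carrier_mat n n" "det X = 1" using X by (auto simp: Gamma_iff carrier_SL)
  have "X = block2 n (X $$ (0, 0)) (X $$ (0, 1)) (X $$ (1, 0)) (X $$ (1, 1))"
  proof (rule eq_matI)
    let ?B = "block2 n (X $$ (0, 0)) (X $$ (0, 1)) (X $$ (1, 0)) (X $$ (1, 1))"
    fix i j assume "i < dim_row ?B" "j < dim_col ?B"
    then have ij: "i < n" "j < n" by (auto simp: corner3_def)
    show "X $$ (i, j) = ?B $$ (i, j)"
    proof (cases "i < 2 \<and> j < 2")
      case True
      then have "i = 0 \<or> i = 1" "j = 0 \<or> j = 1" by auto
      then show ?thesis using ij by (auto simp: corner3_def)
    next
      case False
      then have "X $$ (i, j) = (if i = j then 1 else 0)" using triv ij by (auto simp: trivial_from_def)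
      moreover have "?B $$ (i, j) = (if i = j then 1 else 0)"
      proof (cases "i < 3 \<and> j < 3")
        case True
        then have "i = 0 \<or> i = 1 \<or> i = 2" "j = 0 \<or> j = 1 \<or> j = 2" by auto
        then show ?thesis using False ij by (auto simp: corner3_def)
      qed (use ij in \<open>auto simp: corner3_def\<close>)
      ultimately show ?thesis by simp
    qed
  qed (use Xc in \<open>auto simp: corner3_def\<close>)
  moreover have "X $$ (0, 0) * X $$ (1, 1) - X $$ (0, 1) * X $$ (1, 0) = 1"
    using det_trivial_from_2[OF Xc(1) triv] Xc(2) by simp
  moreover have "[X $$ (i, j) = (if i = j then 1 else 0)] (mod int q)" if "i < n" "j < n" for i j
    using X that by (simp add: Gamma_iff)
  from this[of 0 0] this[of 1 1] this[of 0 1] this[of 1 0]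
  have "[X $$ (0, 0) = 1] (mod int q)" "[X $$ (1, 1) = 1] (mod int q)" "int q dvd X $$ (0, 1)" "int q dvd X $$ (1, 0)"
    using n by (auto simp: cong_0_iff)
  ultimately show ?thesis using that by blast
qed

text \<open>The quotient of \<open>Gamma q n\<close> by \<open>N\<close>. It is abelian because every element is the class of a block.\<close>

definition V :: "int mat set monoid" where "V = Q\<lparr>carrier := proj ` Gamma q n\<rparr>"

lemma proj_Gamma_block2:
  assumes "x \<in> proj ` Gamma q n"
  obtains a b c d where "x = proj (block2 n a b c d)" "a * d - b * c = 1" "[a = 1] (mod int q)" "[d = 1] (mod int q)"
    "int q dvd b" "int q dvd c"
proof -
  obtain X where X: "X \<in> Gamma q n" "x = proj X" using assms by blast
  obtain Y where Y: "Y \<in> Gamma q n" "proj Y = proj X" "trivial_from 2 Y" using reduce[OF X(1)] by blast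
  obtain a b c d where "Y = block2 n a b c d" "a * d - b * c = 1" "[a = 1] (mod int q)" "[d = 1] (mod int q)"
    "int q dvd b" "int q dvd c" using trivial_from_2_block2[OF Y(1,3)] .
  then show ?thesis using X Y that by metis
qed

lemma V_comm_group: "comm_group V"
proof -
  interpret proj: group_hom G Q proj
    by (intro group_hom.intro group_hom_axioms.intro proj_hom SL.is_group Q.is_group)
  have sub: "subgroup (proj ` Gamma q n) Q" by (rule proj.subgroup_img_is_subgroup[OF Gamma_subgroup])
  have "group V" unfolding V_def by (rule subgroup.subgroup_is_group[OF sub Q.is_group])
  moreover have "x \<otimes>\<^bsub>V\<^esub> y = y \<otimes>\<^bsub>V\<^esub> x" if xy: "x \<in> carrier V" "y \<in> carrier V" for x y
  proof -
    have img: "x \<in> proj ` Gamma q n" "y \<in> proj ` Gamma q n" using xy by (simp_all add: V_def)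
    obtain a b c d where x: "x = proj (block2 n a b c d)" "a * d - b * c = 1" "[a = 1] (mod int q)" "[d = 1] (mod int q)"
      "int q dvd b" "int q dvd c" by (rule proj_Gamma_block2[OF img(1)])
    obtain a' b' c' d' where y: "y = proj (block2 n a' b' c' d')" "a' * d' - b' * c' = 1"
      by (rule proj_Gamma_block2[OF img(2)])
    show ?thesis using block2_commutes[OF x(2-6) block2_elem3[OF n y(2)]] by (simp add: V_def commutes_def x y)
  qed
  ultimately show ?thesis by (rule group.group_comm_groupI)
qed

sublocale V: comm_group V by (rule V_comm_group)

lemma mennicke_class_V:
  assumes "[a = 1] (mod int q)" "coprime a b" "int q dvd b"
  shows "mennicke_class a b \<in> carrier V"
proof -
  obtain c d where cd: "a * d - b * c = 1" "[d = 1] (mod int q)" "int q dvd c" using block2_exists assms by blast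
  then show ?thesis using assms block2_Gamma[OF cd(1)] by (auto simp: mennicke_class_eq V_def)
qed

lemma one_N: "1\<^sub>m n \<in> N"
  using N.one_closed by simp

text \<open>Column operations take the row \<open>(a, q)\<close> to \<open>(1, 0)\<close>.\<close>

lemma mennicke_class_level:
  assumes a: "[a = 1] (mod int q)"
  shows "mennicke_class a (int q) = \<one>\<^bsub>Q\<^esub>"
proof -
  obtain k where k: "a = 1 + k * int q" using a by (metis cong_iff_lin cong_sym mult.commute)
  have "mennicke_class a (int q) = mennicke_class 1 (int q)" unfolding k by (rule mennicke_class_add_left) auto
  also have "\<dots> = mennicke_class 1 (0 + int q * 1)" by simp
  also have "\<dots> = mennicke_class 1 0" by (rule mennicke_class_add_right) auto
  also have "\<dots> = proj (block2 n 1 0 0 1)" by (rule mennicke_class_eq) auto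
  also have "\<dots> = \<one>\<^bsub>Q\<^esub>" unfolding corner3_one using one_N by (rule proj_N)
  finally show ?thesis .
qed

text \<open>Dividing the second entry by \<open>q\<close> does not spoil multiplicativity, because the row \<open>(a, q)\<close> has trivial class.\<close>

definition mennicke :: "int \<Rightarrow> int \<Rightarrow> int mat set comm_family" where
  "mennicke c a = embed_comm V (mennicke_class a (int q * c))"

lemma mennicke_symbol_block2: "mennicke_symbol (int q) mennicke"
proof
  show "int q > 0" using q by simp
next
  fix a c t :: int assume a: "[a = 1] (mod int q)" and c: "coprime c a"
  have aq: "coprime a (int q)" using a by (metis cong_imp_coprime cong_sym coprime_1_left)
  have "mennicke_class a (int q * c + (int q * t) * a) = mennicke_class a (int q * c)"
    using a c aq by (intro mennicke_class_add_right) (auto simp: coprime_commute)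
  then show "mennicke (c + t * a) a = mennicke c a" by (simp add: mennicke_def algebra_simps)
next
  fix a c t :: int assume a: "[a = 1] (mod int q)" and c: "coprime c a"
  have aq: "coprime a (int q)" using a by (metis cong_imp_coprime cong_sym coprime_1_left)
  have "mennicke_class (a + t * (int q * c)) (int q * c) = mennicke_class a (int q * c)"
    using a c aq by (intro mennicke_class_add_left) (auto simp: coprime_commute)
  then show "mennicke c (a + t * (int q * c)) = mennicke c a" by (simp add: mennicke_def)
next
  fix a c c' :: int assume a: "[a = 1] (mod int q)" and c: "coprime c a" "coprime c' a"
  have aq: "coprime a (int q)" using a by (metis cong_imp_coprime cong_sym coprime_1_left)
  have cl: "mennicke_class a (int q * x) \<in> carrier V" if "coprime x a" for x
    using a aq that by (intro mennicke_class_V) (auto simp: coprime_commute)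
  have cq: "x \<in> carrier V \<Longrightarrow> x \<in> carrier Q" for x
    using Gamma_SL by (auto simp: V_def)
  have "mennicke_class a ((int q * (c * c')) * int q) = mennicke_class a (int q * (c * c')) \<otimes>\<^bsub>Q\<^esub> mennicke_class a (int q)"
    using a aq c by (intro mennicke_class_mult) (auto simp: coprime_commute)
  then have 1: "mennicke_class a ((int q * (c * c')) * int q) = mennicke_class a (int q * (c * c'))"
    using cl[of "c * c'"] c cq by (simp add: mennicke_class_level[OF a])
  have 2: "mennicke_class a ((int q * c) * (int q * c')) = mennicke_class a (int q * c) \<otimes>\<^bsub>Q\<^esub> mennicke_class a (int q * c')"
    using a aq c by (intro mennicke_class_mult) (auto simp: coprime_commute)
  have "(int q * c) * (int q * c') = (int q * (c * c')) * int q" by simp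
  with 1 2 have "mennicke_class a (int q * (c * c')) = mennicke_class a (int q * c) \<otimes>\<^bsub>V\<^esub> mennicke_class a (int q * c')"
    by (simp add: V_def)
  then show "mennicke (c * c') a = mennicke c a + mennicke c' a"
    using cl c by (simp add: mennicke_def embed_comm_mult[OF V_comm_group])
qed

text \<open>The class of a block is the Mennicke symbol of its first row, which vanishes.\<close>

theorem Gamma_eq_transv_subgroup: "Gamma q n = N"
proof
  show "N \<subseteq> Gamma q n" by (rule N_Gamma)
  show "Gamma q n \<subseteq> N"
  proof
    fix X assume X: "X \<in> Gamma q n"
    then obtain a b c d where x: "proj X = proj (block2 n a b c d)" "a * d - b * c = 1" "[a = 1] (mod int q)"
      "[d = 1] (mod int q)" "int q dvd b" "int q dvd c" using proj_Gamma_block2[of "proj X"] by blast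
    have ab: "coprime a b"
    proof (rule coprimeI)
      fix e assume "e dvd a" "e dvd b"
      then have "e dvd a * d - b * c" by (intro dvd_diff dvd_mult2)
      then show "is_unit e" using x(2) by simp
    qed
    obtain b' where b': "b = int q * b'" using x(5) by blast
    have "mennicke b' a = 0"
      using mennicke_symbol.F_eq_0[OF mennicke_symbol_block2 x(3), of b'] ab by (simp add: b' coprime_commute)
    then have "mennicke_class a b = \<one>\<^bsub>V\<^esub>"
      unfolding mennicke_def b'[symmetric] using mennicke_class_V[OF x(3) ab x(5)] by (rule embed_comm_eq_0[OF V_comm_group, rotated])
    then have "proj X = \<one>\<^bsub>Q\<^esub>" using x by (simp add: mennicke_class_eq V_def)
    then show "X \<in> N" using Gamma_SL[OF X] proj_one_iff by simp
  qed
qed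

end

section \<open>First-order terms of congruence subgroups\<close>

text \<open>The relation \<open>X \<equiv> I + d A\<close> modulo \<open>d\<^sup>2\<close>. It determines \<open>A\<close> modulo \<open>d\<close> only, which is why \<open>A\<close> is not defined
as a function of \<open>X\<close>.\<close>

definition first_order :: "nat \<Rightarrow> nat \<Rightarrow> int mat \<Rightarrow> (nat \<Rightarrow> nat \<Rightarrow> int) \<Rightarrow> bool" where
  "first_order n d X A \<longleftrightarrow>
    (\<forall>i<n. \<forall>j<n. [X $$ (i, j) = (if i = j then 1 else 0) + int d * A i j] (mod int d ^ 2))"

lemma first_order_mult:
  assumes X: "X \<in> carrier_mat n n" "first_order n d X A" and Y: "Y \<in> carrier_mat n n" "first_order n d Y B"
  shows "first_order n d (X * Y) (\<lambda>i j. A i j + B i j)"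
  unfolding first_order_def
proof (intro allI impI)
  fix i j assume ij: "i < n" "j < n"
  let ?e = "\<lambda>i j. (if i = j then 1 else 0) :: int"
  have "[(\<Sum>k<n. X $$ (i, k) * Y $$ (k, j)) = (\<Sum>k<n. (?e i k + int d * A i k) * (?e k j + int d * B k j))] (mod int d ^ 2)"
    using X(2) Y(2) ij by (intro cong_sum cong_mult) (auto simp: first_order_def)
  also have "(\<Sum>k<n. (?e i k + int d * A i k) * (?e k j + int d * B k j)) =
    (\<Sum>k<n. (if k = i then ?e k j + int d * B k j else 0) + (if k = j then int d * A i k else 0) + int d ^ 2 * (A i k * B k j))"
    by (intro sum.cong) (auto simp: power2_eq_square algebra_simps)
  also have "\<dots> = ?e i j + int d * (A i j + B i j) + int d ^ 2 * (\<Sum>k<n. A i k * B k j)"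
    using ij by (simp add: sum.distrib sum_distrib_left algebra_simps)
  also have "[\<dots> = ?e i j + int d * (A i j + B i j)] (mod int d ^ 2)"
    by (simp add: cong_iff_dvd_diff)
  finally show "[(X * Y) $$ (i, j) = ?e i j + int d * (A i j + B i j)] (mod int d ^ 2)"
    using X(1) Y(1) ij by (simp add: mat_mult_index del: index_mult_mat(1))
qed

lemma first_order_one: "first_order n d (1\<^sub>m n) (\<lambda>i j. 0)"
  by (auto simp: first_order_def)

lemma first_order_cong:
  assumes "first_order n d X A" "\<And>i j. i < n \<Longrightarrow> j < n \<Longrightarrow> [A i j = B i j] (mod int d)"
  shows "first_order n d X B"
  unfolding first_order_def
proof (intro allI impI)
  fix i j assume ij: "i < n" "j < n"
  have "[int d * A i j = int d * B i j] (mod int d * int d)" using assms(2)[OF ij] by (rule cong_cmult_leftI)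
  then have "[(if i = j then 1 else 0) + int d * A i j = (if i = j then 1 else 0) + int d * B i j] (mod int d ^ 2)"
    by (intro cong_add cong_refl) (simp add: power2_eq_square)
  with assms(1)[unfolded first_order_def, rule_format, OF ij]
  show "[X $$ (i, j) = (if i = j then 1 else 0) + int d * B i j] (mod int d ^ 2)"
    by (rule cong_trans)
qed

lemma first_order_unique:
  assumes "first_order n d X A" "first_order n d X B" "d \<ge> 1" "i < n" "j < n"
  shows "[A i j = B i j] (mod int d)"
proof -
  have "[(if i = j then 1 else 0) + int d * A i j = (if i = j then 1 else 0) + int d * B i j] (mod int d ^ 2)"
    using assms unfolding first_order_def by (meson cong_sym cong_trans)
  then have "int d ^ 2 dvd int d * (A i j - B i j)" by (simp add: cong_iff_dvd_diff algebra_simps)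
  then show ?thesis using assms(3) by (simp add: power2_eq_square cong_iff_dvd_diff)
qed

lemma Gamma_first_order:
  assumes "X \<in> Gamma d n"
  obtains A where "first_order n d X A"
proof
  show "first_order n d X (\<lambda>i j. (X $$ (i, j) - (if i = j then 1 else 0)) div int d)"
    using assms by (auto simp: first_order_def Gamma_iff cong_iff_dvd_diff)
qed

lemma first_order_Gamma:
  assumes "X \<in> carrier (SL n)" "first_order n d X A"
  shows "X \<in> Gamma d n"
proof -
  have "[X $$ (i, j) = (if i = j then 1 else 0)] (mod int d)" if "i < n" "j < n" for i j
  proof -
    have "[X $$ (i, j) = (if i = j then 1 else 0) + int d * A i j] (mod int d)"
      using assms(2) that unfolding first_order_def by (meson cong_dvd_modulus dvd_power zero_less_numeral)
    also have "[(if i = j then 1 else 0) + int d * A i j = (if i = j then 1 else 0)] (mod int d)"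
      by (simp add: cong_iff_dvd_diff)
    finally show ?thesis .
  qed
  then show ?thesis using assms(1) by (simp add: Gamma_iff)
qed

lemma first_order_inv:
  assumes X: "X \<in> carrier (SL n)" "first_order n d X A" and d: "d \<ge> 1"
  shows "first_order n d (inv\<^bsub>SL n\<^esub> X) (\<lambda>i j. - A i j)"
proof -
  let ?Y = "inv\<^bsub>SL n\<^esub> X"
  have Y: "?Y \<in> carrier (SL n)" "X * ?Y = 1\<^sub>m n"
    using group.inv_closed[OF group_SL X(1)] group.r_inv[OF group_SL X(1)] by auto
  have "?Y \<in> Gamma d n"
    using subgroup.m_inv_closed[OF Gamma_subgroup first_order_Gamma[OF X]] .
  then obtain B where B: "first_order n d ?Y B" by (rule Gamma_first_order)
  have "first_order n d (1\<^sub>m n) (\<lambda>i j. A i j + B i j)"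
    using first_order_mult[OF _ X(2) _ B] X(1) Y by (simp add: carrier_SL)
  then have "[0 = A i j + B i j] (mod int d)" if "i < n" "j < n" for i j
    using first_order_unique[OF first_order_one _ d that] by blast
  then have "[B i j = - A i j] (mod int d)" if "i < n" "j < n" for i j
    using that by (simp add: cong_iff_dvd_diff add.commute dvd_diff_commute)
  then show ?thesis by (rule first_order_cong[OF B])
qed

lemma first_order_transv: "first_order n d (transv n (\<lambda>k. int d * v k) w) (\<lambda>i j. v i * w j)"
  by (auto simp: first_order_def transv_index mult.assoc)

text \<open>It suffices to look at transvections, because these generate: the trace of \<open>v w\<^sup>T\<close> is \<open>w \<bullet> v\<close>.\<close>

lemma first_order_trace:
  assumes n: "n \<ge> 3" and d: "d \<ge> 1" and X: "X \<in> Gamma d n" "first_order n d X A"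
  shows "int d dvd (\<Sum>i<n. A i i)"
proof -
  interpret congruence_quotient n d using n d by unfold_locales
  have "\<exists>A. first_order n d X A \<and> int d dvd (\<Sum>i<n. A i i)" if "X \<in> generate G (transvections d n)" for X
    using that
  proof (induction rule: generate.induct)
    case one
    show ?case using first_order_one by (intro exI[of _ "\<lambda>i j. 0"]) simp
  next
    case (incl X)
    then obtain v w where vw: "X = transv n v w" "dot n w v = 0" "\<forall>k<n. int d dvd v k" by (auto simp: transvections_def)
    have eq: "X = transv n (\<lambda>k. int d * (v k div int d)) w" unfolding vw using vw(3) by (intro transv_cong) auto
    have "int d * (\<Sum>i<n. v i div int d * w i) = dot n w v"
      unfolding dot_def sum_distrib_left using vw(3) by (intro sum.cong) auto
    then have "(\<Sum>i<n. v i div int d * w i) = 0" using vw(2) d by simp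
    then show ?case unfolding eq using first_order_transv[of n d "\<lambda>k. v k div int d" w] by auto
  next
    case (inv X)
    then obtain v w where vw: "X = transv n v w" "dot n w v = 0" "\<forall>k<n. int d dvd v k" by (auto simp: transvections_def)
    have eq: "X = transv n (\<lambda>k. int d * (v k div int d)) w" unfolding vw using vw(3) by (intro transv_cong) auto
    have "int d * (\<Sum>i<n. v i div int d * w i) = dot n w v"
      unfolding dot_def sum_distrib_left using vw(3) by (intro sum.cong) auto
    then have 0: "(\<Sum>i<n. v i div int d * w i) = 0" using vw(2) d by simp
    have "first_order n d (inv\<^bsub>G\<^esub> X) (\<lambda>i j. - (v i div int d * w j))"
      using inv transvections_SL first_order_transv[of n d "\<lambda>k. v k div int d" w] d unfolding eq[symmetric]
      by (intro first_order_inv) auto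
    then show ?case using 0 by (intro exI[of _ "\<lambda>i j. - (v i div int d * w j)"]) (simp add: sum_negf)
  next
    case (eng X Y)
    then obtain A B where "first_order n d X A" "int d dvd (\<Sum>i<n. A i i)" "first_order n d Y B" "int d dvd (\<Sum>i<n. B i i)"
      by blast
    moreover have "X \<in> carrier_mat n n" "Y \<in> carrier_mat n n"
      using eng.hyps SL.generate_incl[OF transvections_SL] by auto
    ultimately show ?case using first_order_mult[of X n d A Y B]
      by (intro exI[of _ "\<lambda>i j. A i j + B i j"]) (auto simp: sum.distrib)
  qed
  then obtain B where B: "first_order n d X B" "int d dvd (\<Sum>i<n. B i i)"
    using X(1) Gamma_eq_transv_subgroup unfolding transv_subgroup_def by blast
  have "[(\<Sum>i<n. A i i) = (\<Sum>i<n. B i i)] (mod int d)"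
    using first_order_unique[OF X(2) B(1) d] by (intro cong_sum) auto
  then show ?thesis using B(2) by (simp add: cong_dvd_iff)
qed

lemma subgroup_transv_multiple:
  assumes K: "subgroup K (SL n)" and transv: "transv n v w \<in> K" and wv: "dot n w v = 0"
  shows "transv n (\<lambda>k. c * v k) w \<in> K"
proof -
  have nat: "transv n (\<lambda>k. int m * v k) w \<in> K" for m
  proof (induction m)
    case 0
    then show ?case using subgroup.one_closed[OF K] by (simp add: transv_0)
  next
    case (Suc m)
    have "transv n (\<lambda>k. int m * v k) w * transv n v w = transv n (\<lambda>k. int (Suc m) * v k) w"
      using wv by (subst transv_add_left) (auto simp: algebra_simps)
    then show ?case using subgroup.m_closed[OF K Suc.IH transv] by simp
  qed
  have neg: "transv n (\<lambda>k. - int m * v k) w \<in> K" for m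
  proof -
    have "transv n (\<lambda>k. - int m * v k) w * transv n (\<lambda>k. int m * v k) w = transv n (\<lambda>k. - int m * v k + int m * v k) w"
      by (rule transv_add_left) (simp add: dot_linear wv)
    also have "\<dots> = 1\<^sub>m n" by (rule transv_0) simp
    finally have 1: "transv n (\<lambda>k. - int m * v k) w * transv n (\<lambda>k. int m * v k) w = 1\<^sub>m n" .
    have c: "transv n (\<lambda>k. int m * v k) w \<in> carrier (SL n)" using nat subgroup.subset[OF K] by blast
    then have "det (transv n (\<lambda>k. - int m * v k) w) = 1"
      using arg_cong[OF 1, of det] det_mult[of "transv n (\<lambda>k. - int m * v k) w" n "transv n (\<lambda>k. int m * v k) w"]
      by (simp add: carrier_SL)
    then have c': "transv n (\<lambda>k. - int m * v k) w \<in> carrier (SL n)" by (simp add: carrier_SL)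
    have "inv\<^bsub>SL n\<^esub> (transv n (\<lambda>k. int m * v k) w) = transv n (\<lambda>k. - int m * v k) w"
      using 1 c c' by (intro group.inv_equality[OF group_SL]) auto
    then show ?thesis using subgroup.m_inv_closed[OF K nat[of m]] by simp
  qed
  show ?thesis
  proof (cases "c \<ge> 0")
    case True
    then show ?thesis using nat[of "nat c"] by simp
  next
    case False
    then show ?thesis using neg[of "nat (- c)"] by simp
  qed
qed

section \<open>The generating set and its minimality\<close>

locale generators =
  fixes n d :: nat
  assumes n: "n \<ge> 3" and d: "d \<ge> 1"
begin

abbreviation "G \<equiv> SL n"

sublocale SL: group G by (rule group_SL)

lemma elem_elmat: "i < n \<Longrightarrow> j < n \<Longrightarrow> i \<noteq> j \<Longrightarrow> elem n i j = elmat n i j 1"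
  by (rule eq_matI) (auto simp: elem_def transv_index unit_fun_def)

lemma elem_pow:
  assumes ij: "i < n" "j < n" "i \<noteq> j"
  shows "elem n i j [^]\<^bsub>G\<^esub> m = elmat n i j (int m)"
proof (induction m)
  case 0
  then show ?case by (simp add: transv_0)
next
  case (Suc m)
  have "elem n i j [^]\<^bsub>G\<^esub> Suc m = elmat n i j (int m) * elmat n i j 1"
    using Suc ij by (simp add: elem_elmat)
  also have "\<dots> = transv n (\<lambda>k. int m * unit_fun i k + 1 * unit_fun i k) (unit_fun j)"
    using ij by (intro transv_add_left) (simp only: dot_linear dot_unit_fun, simp add: unit_fun_def)
  also have "\<dots> = elmat n i j (int (Suc m))" by (intro transv_cong) (simp add: algebra_simps)
  finally show ?case .
qed

lemma inv_elem:
  assumes ij: "i < n" "j < n" "i \<noteq> j"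
  shows "inv\<^bsub>G\<^esub> (elem n i j) = elmat n i j (- 1)"
proof (rule SL.inv_equality)
  have "elmat n i j (- 1) * elmat n i j 1 = transv n (\<lambda>k. - 1 * unit_fun i k + 1 * unit_fun i k) (unit_fun j)"
    using ij by (intro transv_add_left) (simp only: dot_linear dot_unit_fun, simp add: unit_fun_def)
  also have "\<dots> = 1\<^sub>m n" by (rule transv_0) simp
  finally show "elmat n i j (- 1) \<otimes>\<^bsub>G\<^esub> elem n i j = \<one>\<^bsub>G\<^esub>" using ij by (simp add: elem_elmat)
qed (use ij in \<open>simp_all add: elem_elmat elmat_SL[of i n j 1, simplified] elmat_SL[of i n j "- 1", simplified]\<close>)

text \<open>The generator with index \<open>k\<close> of the second kind is the transvection \<open>I + d (e\<^sub>0 + e\<^sub>k) (e\<^sub>k - e\<^sub>0)\<^sup>T\<close>, with first-order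
diagonal \<open>- 1\<close> at \<open>0\<close> and \<open>1\<close> at \<open>k\<close>.\<close>

abbreviation yv :: "nat \<Rightarrow> nat \<Rightarrow> int" where "yv k \<equiv> \<lambda>i. unit_fun 0 i + unit_fun k i"
abbreviation yw :: "nat \<Rightarrow> nat \<Rightarrow> int" where "yw k \<equiv> \<lambda>j. unit_fun k j - unit_fun 0 j"

lemma conj_elem:
  assumes k: "1 \<le> k" "k < n"
  shows "elem n k 0 \<otimes>\<^bsub>G\<^esub> elem n 0 k [^]\<^bsub>G\<^esub> d \<otimes>\<^bsub>G\<^esub> inv\<^bsub>G\<^esub> (elem n k 0) = transv n (\<lambda>i. int d * yv k i) (yw k)"
proof -
  have k0: "0 < n" "k \<noteq> 0" "0 \<noteq> k" using k by auto
  have "elmat n k 0 1 * elmat n k 0 (- 1) = transv n (\<lambda>i. 1 * unit_fun k i + - 1 * unit_fun k i) (unit_fun 0)"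
    using k k0 by (intro transv_add_left) (simp only: dot_linear dot_unit_fun, simp add: unit_fun_def)
  also have "\<dots> = 1\<^sub>m n" by (rule transv_0) simp
  finally have "elmat n k 0 1 * elmat n 0 k (int d) * elmat n k 0 (- 1) =
    transv n (\<lambda>i. dot n (\<lambda>j. elmat n k 0 1 $$ (i, j)) (\<lambda>j. int d * unit_fun 0 j)) (\<lambda>j. dot n (unit_fun k) (\<lambda>i. elmat n k 0 (- 1) $$ (i, j)))"
    by (intro transv_conj) auto
  also have "\<dots> = transv n (\<lambda>i. int d * yv k i) (yw k)"
  proof (rule transv_cong)
    fix i j assume ij: "i < n" "j < n"
    have "dot n (\<lambda>j. elmat n k 0 1 $$ (i, j)) (\<lambda>j. int d * unit_fun 0 j) = int d * yv k i"
      by (simp only: dot_linear dot_unit_fun(2)[OF k0(1)] transv_index[OF ij(1) k0(1)]) (simp add: unit_fun_def)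
    moreover have "dot n (unit_fun k) (\<lambda>i. elmat n k 0 (- 1) $$ (i, j)) = yw k j"
      by (simp only: dot_unit_fun(1)[OF k(2)] transv_index[OF k(2) ij(2)]) (simp add: unit_fun_def)
    ultimately show "dot n (\<lambda>j. elmat n k 0 1 $$ (i, j)) (\<lambda>j. int d * unit_fun 0 j) *
        dot n (unit_fun k) (\<lambda>i. elmat n k 0 (- 1) $$ (i, j)) = int d * yv k i * yw k j" by simp
  qed
  finally show ?thesis
    unfolding elem_pow[OF k0(1) k(2) k0(3)] inv_elem[OF k(2) k0(1,2)]
    unfolding elem_elmat[OF k(2) k0(1,2)] mult_SL .
qed

lemma gens_eq:
  "gens d n = {elmat n i j (int d) | i j. i < n \<and> j < n \<and> i \<noteq> j} \<union> {transv n (\<lambda>i. int d * yv k i) (yw k) | k. 1 \<le> k \<and> k < n}"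
proof -
  have "x = elem n i j [^]\<^bsub>G\<^esub> d \<and> i < n \<and> j < n \<and> i \<noteq> j \<longleftrightarrow> x = elmat n i j (int d) \<and> i < n \<and> j < n \<and> i \<noteq> j" for x i j
  proof (cases "i < n \<and> j < n \<and> i \<noteq> j")
    case True
    then have "elem n i j [^]\<^bsub>G\<^esub> d = elmat n i j (int d)" by (intro elem_pow) auto
    then show ?thesis by (simp only:)
  qed (simp only: simp_thms)
  moreover have "x = elem n k 0 \<otimes>\<^bsub>G\<^esub> elem n 0 k [^]\<^bsub>G\<^esub> d \<otimes>\<^bsub>G\<^esub> inv\<^bsub>G\<^esub> (elem n k 0) \<and> 1 \<le> k \<and> k < n \<longleftrightarrow>
      x = transv n (\<lambda>i. int d * yv k i) (yw k) \<and> 1 \<le> k \<and> k < n" for x k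
  proof (cases "1 \<le> k \<and> k < n")
    case True
    then show ?thesis using conj_elem[of k] by (simp only: simp_thms)
  qed (simp only: simp_thms)
  ultimately show ?thesis unfolding gens_def by (simp only:)
qed

lemma dot_y: "1 \<le> k \<Longrightarrow> k < n \<Longrightarrow> dot n (yw k) (yv k) = 0"
  by (simp add: dot_linear) (simp add: unit_fun_def)

lemma gens_Gamma: "gens d n \<subseteq> Gamma d n"
proof -
  have "elmat n i j (int d) \<in> Gamma d n" if "i < n" "j < n" "i \<noteq> j" for i j
    using first_order_Gamma[OF elmat_SL first_order_transv[of n d "unit_fun i" "unit_fun j"]] that by blast
  moreover have "transv n (\<lambda>i. int d * yv k i) (yw k) \<in> Gamma d n" if "1 \<le> k" "k < n" for k
  proof (rule first_order_Gamma[OF transv_SL first_order_transv])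
    show "dot n (yw k) (\<lambda>i. int d * yv k i) = 0" by (simp only: dot_linear(4) dot_y[OF that] mult_zero_right)
  qed (rule n)
  ultimately show ?thesis unfolding gens_eq by blast
qed

definition H :: "int mat set" where "H = generate G (gens d n)"

lemma H_subgroup: "subgroup H G"
  unfolding H_def using gens_Gamma by (intro SL.generate_is_subgroup) (auto simp: Gamma_iff)

lemma H_Gamma: "H \<subseteq> Gamma d n"
  unfolding H_def by (rule SL.generate_subgroup_incl[OF gens_Gamma Gamma_subgroup])

lemma elmat_H:
  assumes ij: "i < n" "j < n" "i \<noteq> j"
  shows "elmat n i j (int d * c) \<in> H"
proof -
  have "elmat n i j (int d) \<in> H" unfolding H_def gens_eq using ij by (intro generate.incl) blast
  then have "transv n (\<lambda>k. c * (int d * unit_fun i k)) (unit_fun j) \<in> H"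
  proof (rule subgroup_transv_multiple[OF H_subgroup])
    show "dot n (unit_fun j) (\<lambda>k. int d * unit_fun i k) = 0"
      using ij by (simp only: dot_linear(4) dot_unit_fun(1)) (simp add: unit_fun_def)
  qed
  then show ?thesis by (simp add: mult_ac)
qed

lemma y_H:
  assumes k: "1 \<le> k" "k < n"
  shows "transv n (\<lambda>i. int d * (c * yv k i)) (yw k) \<in> H"
proof -
  have "transv n (\<lambda>i. int d * yv k i) (yw k) \<in> H" unfolding H_def gens_eq using k by (intro generate.incl) blast
  then have "transv n (\<lambda>i. c * (int d * yv k i)) (yw k) \<in> H"
  proof (rule subgroup_transv_multiple[OF H_subgroup])
    show "dot n (yw k) (\<lambda>i. int d * yv k i) = 0" by (simp only: dot_linear(4) dot_y[OF k] mult_zero_right)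
  qed
  then show ?thesis by (simp add: mult.left_commute)
qed

sublocale elementary_subgroup n H "int d"
proof
  fix i j t assume ij: "i < n" "j < n" "i \<noteq> j" and "int d dvd t"
  then obtain c where "t = int d * c" by blast
  then show "elmat n i j t \<in> H" using elmat_H[OF ij, of c] by simp
qed (use n H_subgroup in \<open>auto simp: subgroup_def\<close>)

definition achievable :: "(nat \<Rightarrow> nat \<Rightarrow> int) \<Rightarrow> bool" where
  "achievable A \<longleftrightarrow> (\<exists>h\<in>H. first_order n d h A)"

lemma H_SL: "h \<in> H \<Longrightarrow> h \<in> carrier G"
  using subgroup.subset[OF H_subgroup] by blast

lemma achievable_add: "achievable A \<Longrightarrow> achievable B \<Longrightarrow> achievable (\<lambda>i j. A i j + B i j)"
  unfolding achievable_def using first_order_mult mult_K H_SL by (metis carrier_SL)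

lemma achievable_sum:
  "finite S \<Longrightarrow> (\<And>x. x \<in> S \<Longrightarrow> achievable (f x)) \<Longrightarrow> achievable (\<lambda>i j. \<Sum>x\<in>S. f x i j)"
proof (induction S rule: finite_induct)
  case empty
  then show ?case unfolding achievable_def using one_K first_order_one by auto
next
  case (insert x S)
  then have "achievable (\<lambda>i j. f x i j + (\<Sum>x\<in>S. f x i j))" by (intro achievable_add) auto
  then show ?case using insert.hyps by simp
qed

text \<open>The conjugates provide the diagonal, up to the entry at 0, which the trace condition determines. The
off-diagonal entries are then corrected by elementary matrices.\<close>

lemma achievable_trace:
  assumes tr: "int d dvd (\<Sum>i<n. A i i)"
  shows "achievable A"
proof -
  define Y where "Y = (\<lambda>i j. \<Sum>k\<in>{1..<n}. (A k k * yv k i) * yw k j)"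
  define C where "C i j = A i j - Y i j" for i j
  let ?S = "{(i, j). i < n \<and> j < n \<and> i \<noteq> j}"
  have fin: "finite ?S" by (rule finite_subset[of _ "{..<n} \<times> {..<n}"]) auto
  have Y: "achievable Y"
    unfolding Y_def
  proof (rule achievable_sum)
    fix k assume "k \<in> {1..<n}"
    then show "achievable (\<lambda>i j. (A k k * yv k i) * yw k j)"
      unfolding achievable_def using first_order_transv[of n d "\<lambda>i. A k k * yv k i" "yw k"] y_H[of k "A k k"] by auto
  qed simp
  have "achievable (\<lambda>i j. \<Sum>p\<in>?S. (C (fst p) (snd p) * unit_fun (fst p) i) * unit_fun (snd p) j)"
  proof (rule achievable_sum[OF fin])
    fix p assume "p \<in> ?S"
    then have p: "fst p < n" "snd p < n" "fst p \<noteq> snd p" by auto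
    have "transv n (\<lambda>k. int d * (C (fst p) (snd p) * unit_fun (fst p) k)) (unit_fun (snd p)) \<in> H"
      using elmat_H[OF p, of "C (fst p) (snd p)"] by (simp add: mult.assoc)
    then show "achievable (\<lambda>i j. (C (fst p) (snd p) * unit_fun (fst p) i) * unit_fun (snd p) j)"
      unfolding achievable_def using first_order_transv by (rule bexI[rotated])
  qed
  with Y have "achievable (\<lambda>i j. Y i j + (\<Sum>p\<in>?S. (C (fst p) (snd p) * unit_fun (fst p) i) * unit_fun (snd p) j))"
    by (rule achievable_add)
  then obtain h where h: "h \<in> H"
    "first_order n d h (\<lambda>i j. Y i j + (\<Sum>p\<in>?S. (C (fst p) (snd p) * unit_fun (fst p) i) * unit_fun (snd p) j))"
    unfolding achievable_def by blast
  have off: "(\<Sum>p\<in>?S. (C (fst p) (snd p) * unit_fun (fst p) i) * unit_fun (snd p) j) = (if i \<noteq> j then C i j else 0)"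
    if ij: "i < n" "j < n" for i j
  proof -
    have "(\<Sum>p\<in>?S. (C (fst p) (snd p) * unit_fun (fst p) i) * unit_fun (snd p) j) = (\<Sum>p\<in>?S. if p = (i, j) then C i j else 0)"
      by (intro sum.cong) (auto simp: unit_fun_def)
    then show ?thesis using fin ij by simp
  qed
  have Y_diag: "Y i i = (if i = 0 then - (\<Sum>k\<in>{1..<n}. A k k) else A i i)" if "i < n" for i
  proof (cases "i = 0")
    case True
    then show ?thesis unfolding Y_def by (auto simp: unit_fun_def sum_negf[symmetric] intro!: sum.cong)
  next
    case False
    have "Y i i = (\<Sum>k\<in>{1..<n}. if k = i then A i i else 0)"
      unfolding Y_def using False by (intro sum.cong) (auto simp: unit_fun_def)
    then show ?thesis using False that by simp
  qed
  have tr0: "(\<Sum>i<n. A i i) = A 0 0 + (\<Sum>k\<in>{1..<n}. A k k)"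
  proof -
    have "{..<n} = insert 0 {1..<n}" using n by auto
    then show ?thesis by simp
  qed
  have "first_order n d h A"
  proof (rule first_order_cong[OF h(2)])
    fix i j assume ij: "i < n" "j < n"
    show "[Y i j + (\<Sum>p\<in>?S. (C (fst p) (snd p) * unit_fun (fst p) i) * unit_fun (snd p) j) = A i j] (mod int d)"
    proof (cases "i = j")
      case True
      have "int d dvd - (\<Sum>i<n. A i i)" using tr by simp
      moreover have "- (\<Sum>k = 1..<n. A k k) - A 0 0 = - (\<Sum>i<n. A i i)" using tr0 by simp
      ultimately have "int d dvd - (\<Sum>k = 1..<n. A k k) - A 0 0" by (simp only:)
      then show ?thesis using True ij by (simp add: off Y_diag cong_iff_dvd_diff)
    next
      case False
      then show ?thesis unfolding off[OF ij] by (simp add: C_def)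
    qed
  qed
  then show ?thesis using h(1) unfolding achievable_def by blast
qed

lemma transv_subgroup_square_H: "transv_subgroup (d ^ 2) n \<subseteq> H"
  unfolding transv_subgroup_def
proof (rule SL.generate_subgroup_incl[OF _ H_subgroup])
  show "transvections (d ^ 2) n \<subseteq> H"
    using transvection_K by (auto simp: transvections_def)
qed

text \<open>Any \<open>X\<close> is, up to a factor from \<open>Gamma (d\<^sup>2) n\<close>, the element of \<open>H\<close> with the same first-order term. That group is
generated by transvections of level \<open>d\<^sup>2\<close> and hence contained in \<open>H\<close>.\<close>

theorem H_eq_Gamma: "H = Gamma d n"
proof
  show "H \<subseteq> Gamma d n" by (rule H_Gamma)
  show "Gamma d n \<subseteq> H"
  proof
    fix X assume X: "X \<in> Gamma d n"
    then obtain A where A: "first_order n d X A" by (rule Gamma_first_order)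
    have "achievable A" using first_order_trace[OF n d X A] by (rule achievable_trace)
    then obtain h where h: "h \<in> H" "first_order n d h A" unfolding achievable_def by blast
    let ?g = "inv\<^bsub>G\<^esub> h"
    have hc: "h \<in> carrier G" "?g \<in> carrier G" "?g * h = 1\<^sub>m n" "X \<in> carrier G"
      using H_SL[OF h(1)] SL.l_inv[OF H_SL[OF h(1)]] X by (auto simp: Gamma_iff)
    have "first_order n d (X * ?g) (\<lambda>i j. A i j + - A i j)"
      using first_order_mult[OF _ A _ first_order_inv[OF hc(1) h(2) d]] hc by (simp add: carrier_SL)
    then have "first_order n d (X * ?g) (\<lambda>i j. 0)" by simp
    moreover have "X * ?g \<in> carrier G" using SL.m_closed[OF hc(4,2)] by simp
    ultimately have "X * ?g \<in> Gamma (d ^ 2) n"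
      by (simp add: Gamma_iff first_order_def)
    also have "Gamma (d ^ 2) n = transv_subgroup (d ^ 2) n"
      using n d by (intro congruence_quotient.Gamma_eq_transv_subgroup congruence_quotient.intro) auto
    finally have "X * ?g \<in> H" using transv_subgroup_square_H by blast
    then have "X * ?g * h \<in> H" using h(1) mult_K by blast
    also have "X * ?g * h = X"
      using hc by (simp add: assoc_mult_mat[of _ n n _ n _ n] carrier_SL right_mult_one_mat[of _ n n])
    finally show "X \<in> H" .
  qed
qed

lemma card_gens: "finite (gens d n) \<and> card (gens d n) \<le> n ^ 2 - 1"
proof -
  let ?S = "{(i, j). i < n \<and> j < n \<and> i \<noteq> j}"
  have S: "?S = {..<n} \<times> {..<n} - (\<lambda>i. (i, i)) ` {..<n}" by auto
  have "card ?S = card ({..<n} \<times> {..<n}) - card ((\<lambda>i. (i, i)) ` {..<n})"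
    unfolding S by (intro card_Diff_subset) auto
  also have "card ((\<lambda>i. (i, i)) ` {..<n}) = n" by (subst card_image) (auto simp: inj_on_def)
  finally have cS: "card ?S = n * n - n" by simp
  have fS: "finite ?S" unfolding S by simp
  have eq: "gens d n = (\<lambda>(i, j). elmat n i j (int d)) ` ?S \<union> (\<lambda>k. transv n (\<lambda>i. int d * yv k i) (yw k)) ` {1..<n}"
    unfolding gens_eq by (intro arg_cong2[of _ _ _ _ "(\<union>)"]) auto
  have "card (gens d n) \<le> card ((\<lambda>(i, j). elmat n i j (int d)) ` ?S) + card ((\<lambda>k. transv n (\<lambda>i. int d * yv k i) (yw k)) ` {1..<n})"
    unfolding eq by (rule card_Un_le)
  also have "\<dots> \<le> card ?S + card {1..<n}" using fS by (intro add_mono card_image_le) auto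
  also have "\<dots> = n ^ 2 - 1" using n by (simp add: cS power2_eq_square)
  finally show ?thesis unfolding eq using fS by simp
qed

text \<open>The first-order terms of \<open>T\<close> span all matrices of trace zero modulo \<open>d\<close>. Such a matrix is prescribed by its entries
outside the position \<open>(0, 0)\<close>, so that there are \<open>d\<close> to the power \<open>n\<^sup>2 - 1\<close> of them, and at most \<open>d\<close> to the power \<open>card T\<close>
combinations with coefficients modulo \<open>d\<close>.\<close>

lemma generating_set_card:
  assumes d2: "d \<ge> 2" and T: "finite T" "generate G T = Gamma d n"
  shows "n ^ 2 - 1 \<le> card T"
proof -
  have TG: "T \<subseteq> Gamma d n" unfolding T(2)[symmetric] by (auto intro: generate.incl)
  then have TSL: "T \<subseteq> carrier G" by (auto simp: Gamma_iff)
  define D where "D t = (SOME A. first_order n d t A)" for t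
  have D: "first_order n d t (D t)" if "t \<in> T" for t
    unfolding D_def using Gamma_first_order[of t d n] that TG by (metis someI subsetD)
  have gen: "\<exists>c. first_order n d X (\<lambda>i j. \<Sum>t\<in>T. c t * D t i j)" if "X \<in> generate G T" for X
    using that
  proof (induction rule: generate.induct)
    case one
    show ?case using first_order_one by (intro exI[of _ "\<lambda>t. 0"]) simp
  next
    case (incl t)
    have "(\<lambda>i j. \<Sum>s\<in>T. (if s = t then 1 else 0) * D s i j) = D t"
      using incl T(1) by (simp add: fun_eq_iff if_distrib if_distribR cong: if_cong)
    then show ?case using D[OF incl] by (metis (no_types))
  next
    case (inv t)
    have "(\<lambda>i j. \<Sum>s\<in>T. (if s = t then - 1 else 0) * D s i j) = (\<lambda>i j. - D t i j)"
      using inv T(1) by (simp add: fun_eq_iff if_distrib if_distribR cong: if_cong)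
    then show ?case using first_order_inv[OF _ D[OF inv] d] inv TSL by (metis (no_types) subsetD)
  next
    case (eng X Y)
    then obtain a b where ab: "first_order n d X (\<lambda>i j. \<Sum>t\<in>T. a t * D t i j)"
      "first_order n d Y (\<lambda>i j. \<Sum>t\<in>T. b t * D t i j)" by blast
    have "X \<in> carrier_mat n n" "Y \<in> carrier_mat n n"
      using eng.hyps SL.generate_incl[OF TSL] by (auto simp: carrier_SL)
    from first_order_mult[OF this(1) ab(1) this(2) ab(2)] show ?case
      by (intro exI[of _ "\<lambda>t. a t + b t"]) (simp add: algebra_simps sum.distrib)
  qed
  define P where "P = {..<n} \<times> {..<n} - {(0 :: nat, 0 :: nat)}"
  define R where "R = {0..<int d}"
  define \<Phi> where "\<Phi> c = restrict (\<lambda>(i, j). (\<Sum>t\<in>T. c t * D t i j) mod int d) P" for c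
  have "P \<rightarrow>\<^sub>E R \<subseteq> \<Phi> ` (T \<rightarrow>\<^sub>E R)"
  proof
    fix f assume f: "f \<in> P \<rightarrow>\<^sub>E R"
    define A where "A i j = (if i = 0 \<and> j = 0 then - (\<Sum>k\<in>{1..<n}. f (k, k)) else f (i, j))" for i j
    have "{..<n} = insert 0 {1..<n}" using n by auto
    then have "(\<Sum>i<n. A i i) = A 0 0 + (\<Sum>k\<in>{1..<n}. A k k)" by simp
    also have "(\<Sum>k\<in>{1..<n}. A k k) = (\<Sum>k\<in>{1..<n}. f (k, k))" by (intro sum.cong) (auto simp: A_def)
    finally have "int d dvd (\<Sum>i<n. A i i)" by (simp add: A_def)
    then obtain h where h: "h \<in> H" "first_order n d h A"
      using achievable_trace unfolding achievable_def by blast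
    then obtain c where c: "first_order n d h (\<lambda>i j. \<Sum>t\<in>T. c t * D t i j)"
      using gen H_eq_Gamma T(2) by blast
    define c' where "c' = restrict (\<lambda>t. c t mod int d) T"
    have "c' \<in> T \<rightarrow>\<^sub>E R" using d2 by (auto simp: c'_def R_def)
    moreover have "f = \<Phi> c'"
    proof
      fix p
      show "f p = \<Phi> c' p"
      proof (cases "p \<in> P")
        case True
        obtain i j where pij: "p = (i, j)" by (cases p)
        have p: "p = (i, j)" "i < n" "j < n" "\<not> (i = 0 \<and> j = 0)" using True pij by (auto simp: P_def)
        have "[(\<Sum>t\<in>T. c' t * D t i j) = (\<Sum>t\<in>T. c t * D t i j)] (mod int d)"
          by (intro cong_sum cong_mult cong_refl) (simp add: c'_def)
        also have "[(\<Sum>t\<in>T. c t * D t i j) = A i j] (mod int d)"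
          using first_order_unique[OF c h(2) d p(2,3)] .
        finally have "(\<Sum>t\<in>T. c' t * D t i j) mod int d = f p mod int d"
          using p by (simp add: cong_def A_def)
        moreover have "f p \<in> R" using f True by auto
        ultimately show ?thesis using True p by (simp add: \<Phi>_def R_def)
      next
        case False
        then show ?thesis using f by (auto simp: \<Phi>_def)
      qed
    qed
    ultimately show "f \<in> \<Phi> ` (T \<rightarrow>\<^sub>E R)" by blast
  qed
  moreover have fin: "finite (T \<rightarrow>\<^sub>E R)" using T(1) by (intro finite_PiE) (auto simp: R_def)
  ultimately have "card (P \<rightarrow>\<^sub>E R) \<le> card (T \<rightarrow>\<^sub>E R)" by (rule surj_card_le[rotated])
  moreover have "finite P" by (simp add: P_def)
  ultimately have "d ^ card P \<le> d ^ card T" using T(1) by (simp add: card_PiE R_def)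
  then have "card P \<le> card T" using d2 by (simp add: power_increasing_iff)
  moreover have "card P = n ^ 2 - 1"
    using n by (simp add: P_def power2_eq_square)
  ultimately show ?thesis by simp
qed

end

theorem corollary1p3:
  fixes n d :: nat
  assumes "n \<ge> 3" and "d \<ge> 1"
  shows "generate (SL n) (gens d n) = Gamma d n \<and>
    (d \<ge> 2 \<longrightarrow>
      irredundant_generating_set (SL n) (Gamma d n) (gens d n) \<and>
      least_size_generating_set (SL n) (Gamma d n) (gens d n))"
proof -
  interpret generators n d using assms by unfold_locales
  have gen: "generate (SL n) (gens d n) = Gamma d n" using H_eq_Gamma by (simp add: H_def)
  have fin: "finite (gens d n)" and le: "card (gens d n) \<le> n ^ 2 - 1" using card_gens by auto
  have "irredundant_generating_set (SL n) (Gamma d n) (gens d n)" if d2: "d \<ge> 2"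
    unfolding irredundant_generating_set_def
  proof (intro conjI allI impI notI)
    fix T assume T: "T \<subset> gens d n" "generate (SL n) T = Gamma d n"
    then have "finite T" "card T < card (gens d n)" using fin by (auto intro: finite_subset psubset_card_mono)
    then show False using generating_set_card[OF d2 _ T(2)] le by simp
  qed (rule gen)
  moreover have "least_size_generating_set (SL n) (Gamma d n) (gens d n)" if d2: "d \<ge> 2"
    unfolding least_size_generating_set_def using fin gen generating_set_card[OF d2] le
    by (meson le_trans)
  ultimately show ?thesis using gen by blast
qed

end
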